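(* Let $\nabla$ be a torsion-free connection on a smooth manifold $M$. For $X\in\mathfrak{X}(M)$, $$[\nabla^s,L^s_X]=2\nabla^s_{\nabla X}+\iota^s_{2\,\mathrm{sym}\,\iota_XR_\nabla+R^s_\nabla X}$$ as operators on $\Upsilon^\bullet(M)$.
   Context: $M$ is a smooth manifold of positive dimension; a connection on $M$ is an affine connection on $TM$, extended to tensor fields. $\Upsilon^r(M)=\Gamma(\mathrm{Sym}^rT^*M)$ is the space of totally symmetric covariant $r$-tensor fields, $\Upsilon^0(M)=C^\infty(M)$, $\Upsilon^\bullet(M)=\bigoplus_r\Upsilon^r(M)$, with symmetric product $\varphi\odot\psi=\frac{(r+l)!}{r!\,l!}\mathrm{sym}(\varphi\otimes\psi)$ ($\mathrm{sym}$ = average over permutations). Derivations are with respect to $\odot$, without signs, and $[D,D']=D\circ D'-D'\circ D$. The symmetric derivative is $\nabla^sf=df$ and $(\nabla^s\varphi)(X_1,\dots,X_{r+1})=\sum_j(\nabla_{X_j}\varphi)(X_1,\dots,\hat X_j,\dots,X_{r+1})$ for $\varphi\in\Upsilon^r(M)$. The symmetric Lie derivative is $L^s_X=[\iota_X,\nabla^s]$, where $\iota_X$ is the contraction in the first argument (zero on functions). For $\sigma\in\Gamma(\mathrm{Sym}^kT^*M\otimes TM)$, the symmetric contraction $\iota^s_\sigma$ is the unique degree-$(k-1)$ derivation of $\Upsilon^\bullet(M)$ with $\iota^s_\sigma f=0$ for functions and $(\iota^s_\sigma\alpha)(X_1,\dots,X_k)=\alpha(\sigma(X_1,\dots,X_k))$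 for $1$-forms $\alpha$. For $A\in\Gamma(\mathrm{End}\,TM)$, $\nabla^s_A=[\iota^s_A,\nabla^s]$; here $\nabla X$ is the endomorphism $Y\mapsto\nabla_YX$. With $R_\nabla(X,Y)Z=\nabla_X\nabla_YZ-\nabla_Y\nabla_XZ-\nabla_{[X,Y]}Z$, we have $(2\,\mathrm{sym}\,\iota_XR_\nabla)(Y,Z)=R_\nabla(X,Y)Z+R_\nabla(X,Z)Y$. The symmetric curvature operator $R^s_\nabla$ is $(R^s_\nabla X)(Y,Z)=\nabla_Y\nabla_ZX+\nabla_Z\nabla_YX-\nabla_{[Y,Z]_s}X$, where $[Y,Z]_s=\nabla_YZ+\nabla_ZY$. *)

theory Defs
  imports "HOL-Analysis.Analysis" "HOL-Combinatorics.Permutations" "HOL-Library.Function_Algebras"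
begin

section \<open>Smooth manifolds\<close>

text \<open>Both notions are only used on open sets.\<close>

primrec Ck_on :: "nat \<Rightarrow> 'e::euclidean_space set \<Rightarrow> ('e \<Rightarrow> 'b::real_normed_vector) \<Rightarrow> bool" where
  "Ck_on 0 S f \<longleftrightarrow> continuous_on S f"
| "Ck_on (Suc k) S f \<longleftrightarrow>
     (\<forall>x\<in>S. f differentiable (at x)) \<and> (\<forall>v. Ck_on k S (\<lambda>x. frechet_derivative f (at x) v))"

definition smooth_on :: "'e::euclidean_space set \<Rightarrow> ('e \<Rightarrow> 'b::real_normed_vector) \<Rightarrow> bool" where
  "smooth_on S f \<longleftrightarrow> (\<forall>k. Ck_on k S f)"

text \<open>A smooth manifold is a Hausdorff, second countable space (a type \<open>'a\<close> of the corresponding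
  classes) with an atlas of smoothly compatible charts into a Euclidean space \<open>'e\<close>.  The dimension
  \<open>DIM('e)\<close> is positive for every type of class \<open>euclidean_space\<close>.\<close>

type_synonym ('a, 'e) atlas = "('a set \<times> ('a \<Rightarrow> 'e)) set"

definition smooth_atlas ::
  "('a::{t2_space,second_countable_topology}, 'e::euclidean_space) atlas \<Rightarrow> bool" where
  "smooth_atlas A \<longleftrightarrow>
     (\<Union>(U, x)\<in>A. U) = UNIV \<and>
     (\<forall>(U, x)\<in>A. open U \<and> open (x ` U) \<and> homeomorphism U (x ` U) x (inv_into U x)) \<and>
     (\<forall>(U, x)\<in>A. \<forall>(V, y)\<in>A. smooth_on (x ` (U \<inter> V)) (y \<circ> inv_into U x))"

definition smooth_funs :: "('a::topological_space, 'e::euclidean_space) atlas \<Rightarrow> ('a \<Rightarrow> real) set" where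
  "smooth_funs A = {f. \<forall>(U, x)\<in>A. smooth_on (x ` U) (f \<circ> inv_into U x)}"

text \<open>Tangent vectors at \<open>p\<close> are the derivations at \<open>p\<close> of the algebra of smooth functions,
  extended by 0 to all functions so that equality of tangent vectors is equality in HOL.\<close>

type_synonym 'a tvec = "('a \<Rightarrow> real) \<Rightarrow> real"

definition tangent_space ::
  "('a::topological_space, 'e::euclidean_space) atlas \<Rightarrow> 'a \<Rightarrow> 'a tvec set" where
  "tangent_space A p =
     {v. (\<forall>f\<in>smooth_funs A. \<forall>g\<in>smooth_funs A. v (\<lambda>q. f q + g q) = v f + v g) \<and>
         (\<forall>f\<in>smooth_funs A. \<forall>c. v (\<lambda>q. c * f q) = c * v f) \<and>
         (\<forall>f\<in>smooth_funs A. \<forall>g\<in>smooth_funs A. v (\<lambda>q. f q * g q) = f p * v g + g p * v f) \<and>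
         (\<forall>f. f \<notin> smooth_funs A \<longrightarrow> v f = 0)}"

type_synonym 'a vfield = "'a \<Rightarrow> 'a tvec"

definition vfields :: "('a::topological_space, 'e::euclidean_space) atlas \<Rightarrow> 'a vfield set" where
  "vfields A =
     {X. (\<forall>p. X p \<in> tangent_space A p) \<and> (\<forall>f\<in>smooth_funs A. (\<lambda>p. X p f) \<in> smooth_funs A)}"

text \<open>\<open>fscale f\<close> multiplies vector fields as well as tensor fields by the function \<open>f\<close>; sums and
  differences of such fields are the pointwise ones of \<open>+\<close> and \<open>-\<close> on function types.\<close>

definition fscale :: "('a \<Rightarrow> real) \<Rightarrow> ('a \<Rightarrow> 'b \<Rightarrow> real) \<Rightarrow> 'a \<Rightarrow> 'b \<Rightarrow> real" where
  "fscale f T = (\<lambda>p y. f p * T p y)"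

definition lie_bracket :: "'a vfield \<Rightarrow> 'a vfield \<Rightarrow> 'a vfield" where
  "lie_bracket X Y = (\<lambda>p f. X p (\<lambda>q. Y q f) - Y p (\<lambda>q. X q f))"


section \<open>Symmetric tensor fields\<close>

text \<open>A tensor field assigns to \<open>p\<close> a function of lists of tangent vectors at \<open>p\<close>; the length of the
  list is the covariant degree.  One type thus houses all degrees: an element of the direct sum is a
  single such function, and its component of degree \<open>r\<close> is its restriction to lists of length \<open>r\<close>.
  A function \<open>f\<close> is identified with the degree 0 tensor field whose value at \<open>p\<close> on \<open>[]\<close> is \<open>f p\<close>.
  \<open>'a vtensor\<close> is the analogue with values in the tangent spaces.\<close>

type_synonym 'a tensor = "'a \<Rightarrow> 'a tvec list \<Rightarrow> real"
type_synonym 'a vtensor = "'a \<Rightarrow> 'a tvec list \<Rightarrow> 'a tvec"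

definition at_fields :: "('a \<Rightarrow> 'a tvec list \<Rightarrow> 'b) \<Rightarrow> 'a vfield list \<Rightarrow> 'a \<Rightarrow> 'b" where
  "at_fields T Xs = (\<lambda>p. T p (map (\<lambda>X. X p) Xs))"

definition sym_form ::
  "('a::topological_space, 'e::euclidean_space) atlas \<Rightarrow> 'a \<Rightarrow> nat \<Rightarrow> ('a tvec list \<Rightarrow> real) \<Rightarrow> bool" where
  "sym_form A p r B \<longleftrightarrow>
     (\<forall>vs i v w. length vs = r \<and> set vs \<subseteq> tangent_space A p \<and> i < r \<and>
        v \<in> tangent_space A p \<and> w \<in> tangent_space A p \<longrightarrow>
        B (vs[i := v + w]) = B (vs[i := v]) + B (vs[i := w])) \<and>
     (\<forall>vs i v c. length vs = r \<and> set vs \<subseteq> tangent_space A p \<and> i < r \<and> v \<in> tangent_space A p \<longrightarrow>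
        B (vs[i := (\<lambda>f. c * v f)]) = c * B (vs[i := v])) \<and>
     (\<forall>vs ws. length vs = r \<and> set vs \<subseteq> tangent_space A p \<and> mset ws = mset vs \<longrightarrow> B ws = B vs) \<and>
     (\<forall>vs. \<not> (length vs = r \<and> set vs \<subseteq> tangent_space A p) \<longrightarrow> B vs = 0)"

definition Upsilon ::
  "('a::topological_space, 'e::euclidean_space) atlas \<Rightarrow> nat \<Rightarrow> 'a tensor set" where
  "Upsilon A r =
     {\<phi>. (\<forall>p. sym_form A p r (\<phi> p)) \<and>
         (\<forall>Xs. length Xs = r \<and> set Xs \<subseteq> vfields A \<longrightarrow> at_fields \<phi> Xs \<in> smooth_funs A)}"

definition component :: "nat \<Rightarrow> 'a tensor \<Rightarrow> 'a tensor" where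
  "component r \<Phi> = (\<lambda>p vs. if length vs = r then \<Phi> p vs else 0)"

definition Upsilon_sum ::
  "('a::topological_space, 'e::euclidean_space) atlas \<Rightarrow> 'a tensor set" where
  "Upsilon_sum A = {\<Phi>. (\<forall>r. component r \<Phi> \<in> Upsilon A r) \<and> finite {r. component r \<Phi> \<noteq> 0}}"

text \<open>Sections of \<open>Sym\<^sup>k T\<^sup>*M \<otimes> TM\<close>; for \<open>k = 1\<close> these are the sections of \<open>End TM\<close>.\<close>

definition sym_vtensors ::
  "('a::topological_space, 'e::euclidean_space) atlas \<Rightarrow> nat \<Rightarrow> 'a vtensor set" where
  "sym_vtensors A k =
     {\<sigma>. (\<forall>p f. sym_form A p k (\<lambda>vs. \<sigma> p vs f)) \<and>
         (\<forall>p vs. length vs = k \<and> set vs \<subseteq> tangent_space A p \<longrightarrow> \<sigma> p vs \<in> tangent_space A p) \<and>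
         (\<forall>Xs. length Xs = k \<and> set Xs \<subseteq> vfields A \<longrightarrow> at_fields \<sigma> Xs \<in> vfields A)}"

text \<open>The tensor field with prescribed values on vector fields (meaningful for prescriptions that
  are multilinear over the smooth functions and symmetric).\<close>

definition tensor_of ::
  "('a::topological_space, 'e::euclidean_space) atlas \<Rightarrow> ('a vfield list \<Rightarrow> 'a \<Rightarrow> real) \<Rightarrow> 'a tensor" where
  "tensor_of A F =
     (THE \<Phi>. \<Phi> \<in> Upsilon_sum A \<and> (\<forall>Xs. set Xs \<subseteq> vfields A \<longrightarrow> at_fields \<Phi> Xs = F Xs))"

definition vtensor_of ::
  "('a::topological_space, 'e::euclidean_space) atlas \<Rightarrow> nat \<Rightarrow> ('a vfield list \<Rightarrow> 'a vfield) \<Rightarrow> 'a vtensor" where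
  "vtensor_of A k F =
     (THE \<sigma>. \<sigma> \<in> sym_vtensors A k \<and>
        (\<forall>Xs. length Xs = k \<and> set Xs \<subseteq> vfields A \<longrightarrow> at_fields \<sigma> Xs = F Xs))"


subsection \<open>The symmetric product\<close>

definition symmetrize :: "('v list \<Rightarrow> real) \<Rightarrow> 'v list \<Rightarrow> real" where
  "symmetrize B vs =
     (\<Sum>\<pi> | \<pi> permutes {..<length vs}. B (permute_list \<pi> vs)) / fact (length vs)"

text \<open>\<open>\<phi> \<otimes> \<psi>\<close> for \<open>\<phi>\<close> of degree \<open>r\<close>.\<close>

definition tensor_prod :: "nat \<Rightarrow> 'a tensor \<Rightarrow> 'a tensor \<Rightarrow> 'a tensor" where
  "tensor_prod r \<phi> \<psi> = (\<lambda>p vs. \<phi> p (take r vs) * \<psi> p (drop r vs))"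

definition sym_prod_hom :: "nat \<Rightarrow> nat \<Rightarrow> 'a tensor \<Rightarrow> 'a tensor \<Rightarrow> 'a tensor" where
  "sym_prod_hom r l \<phi> \<psi> =
     (\<lambda>p vs. fact (r + l) / (fact r * fact l) * symmetrize (tensor_prod r \<phi> \<psi> p) vs)"

definition sym_prod :: "'a tensor \<Rightarrow> 'a tensor \<Rightarrow> 'a tensor"  (infixl "\<odot>" 70) where
  "\<Phi> \<odot> \<Psi> = (\<lambda>p vs. \<Sum>r\<le>length vs.
     sym_prod_hom r (length vs - r) (component r \<Phi>) (component (length vs - r) \<Psi>) p vs)"


section \<open>Operators on symmetric tensor fields\<close>

definition commutator ::
  "('a tensor \<Rightarrow> 'a tensor) \<Rightarrow> ('a tensor \<Rightarrow> 'a tensor) \<Rightarrow> 'a tensor \<Rightarrow> 'a tensor" where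
  "commutator D D' = (\<lambda>\<Phi>. D (D' \<Phi>) - D' (D \<Phi>))"

text \<open>Derivations of degree \<open>d\<close>; outside \<open>Upsilon_sum A\<close> they are 0 by convention, so that an
  operator on \<open>Upsilon_sum A\<close> is represented by a unique HOL function.\<close>

definition derivation ::
  "('a::topological_space, 'e::euclidean_space) atlas \<Rightarrow> int \<Rightarrow> ('a tensor \<Rightarrow> 'a tensor) \<Rightarrow> bool" where
  "derivation A d D \<longleftrightarrow>
     (\<forall>\<Phi>\<in>Upsilon_sum A. D \<Phi> \<in> Upsilon_sum A) \<and>
     (\<forall>\<Phi>\<in>Upsilon_sum A. \<forall>\<Psi>\<in>Upsilon_sum A. D (\<Phi> + \<Psi>) = D \<Phi> + D \<Psi>) \<and>
     (\<forall>\<Phi>\<in>Upsilon_sum A. \<forall>c. D (fscale (\<lambda>_. c) \<Phi>) = fscale (\<lambda>_. c) (D \<Phi>)) \<and>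
     (\<forall>\<Phi>\<in>Upsilon_sum A. \<forall>\<Psi>\<in>Upsilon_sum A. D (\<Phi> \<odot> \<Psi>) = D \<Phi> \<odot> \<Psi> + \<Phi> \<odot> D \<Psi>) \<and>
     (\<forall>r. \<forall>\<phi>\<in>Upsilon A r. \<forall>s. int s \<noteq> int r + d \<longrightarrow> component s (D \<phi>) = 0) \<and>
     (\<forall>\<Phi>. \<Phi> \<notin> Upsilon_sum A \<longrightarrow> D \<Phi> = 0)"

definition sym_contraction ::
  "('a::topological_space, 'e::euclidean_space) atlas \<Rightarrow> nat \<Rightarrow> 'a vtensor \<Rightarrow> 'a tensor \<Rightarrow> 'a tensor" where
  "sym_contraction A k \<sigma> =
     (THE D. derivation A (int k - 1) D \<and>
        (\<forall>f\<in>Upsilon A 0. D f = 0) \<and>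
        (\<forall>\<alpha>\<in>Upsilon A 1. \<forall>Xs. length Xs = k \<and> set Xs \<subseteq> vfields A \<longrightarrow>
           at_fields (D \<alpha>) Xs = at_fields \<alpha> [at_fields \<sigma> Xs]))"

definition contraction :: "'a vfield \<Rightarrow> 'a tensor \<Rightarrow> 'a tensor" where
  "contraction X \<Phi> = (\<lambda>p vs. \<Phi> p (X p # vs))"


subsection \<open>Connections\<close>

type_synonym 'a connection = "'a vfield \<Rightarrow> 'a vfield \<Rightarrow> 'a vfield"

definition is_connection ::
  "('a::topological_space, 'e::euclidean_space) atlas \<Rightarrow> 'a connection \<Rightarrow> bool" where
  "is_connection A nabla \<longleftrightarrow>
     (\<forall>X\<in>vfields A. \<forall>Y\<in>vfields A. nabla X Y \<in> vfields A) \<and>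
     (\<forall>X\<in>vfields A. \<forall>X'\<in>vfields A. \<forall>Y\<in>vfields A. nabla (X + X') Y = nabla X Y + nabla X' Y) \<and>
     (\<forall>f\<in>smooth_funs A. \<forall>X\<in>vfields A. \<forall>Y\<in>vfields A. nabla (fscale f X) Y = fscale f (nabla X Y)) \<and>
     (\<forall>X\<in>vfields A. \<forall>Y\<in>vfields A. \<forall>Y'\<in>vfields A. nabla X (Y + Y') = nabla X Y + nabla X Y') \<and>
     (\<forall>f\<in>smooth_funs A. \<forall>X\<in>vfields A. \<forall>Y\<in>vfields A.
        nabla X (fscale f Y) = fscale f (nabla X Y) + fscale (\<lambda>p. X p f) Y)"

definition torsion_free ::
  "('a::topological_space, 'e::euclidean_space) atlas \<Rightarrow> 'a connection \<Rightarrow> bool" where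
  "torsion_free A nabla \<longleftrightarrow>
     (\<forall>X\<in>vfields A. \<forall>Y\<in>vfields A. nabla X Y - nabla Y X = lie_bracket X Y)"

text \<open>\<open>(\<nabla>\<^sub>X \<phi>)(Y\<^sub>1, \<dots>, Y\<^sub>r) = X (\<phi>(Y\<^sub>1, \<dots>, Y\<^sub>r)) - \<Sum>\<^sub>i \<phi>(Y\<^sub>1, \<dots>, \<nabla>\<^sub>X Y\<^sub>i, \<dots>, Y\<^sub>r)\<close>\<close>

definition cov_deriv ::
  "('a::topological_space, 'e::euclidean_space) atlas \<Rightarrow> 'a connection \<Rightarrow> 'a vfield \<Rightarrow> 'a tensor \<Rightarrow> 'a tensor" where
  "cov_deriv A nabla X \<Phi> =
     tensor_of A (\<lambda>Ys p. X p (at_fields \<Phi> Ys) -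
       (\<Sum>i<length Ys. at_fields \<Phi> (Ys[i := nabla X (Ys ! i)]) p))"

text \<open>The empty list gets the empty sum 0 (there is no component of degree 0), and singletons
  \<open>[X]\<close> get \<open>X f\<close>, where \<open>f\<close> is the component of degree 0; so this is \<open>df\<close> on functions.\<close>

definition sym_deriv ::
  "('a::topological_space, 'e::euclidean_space) atlas \<Rightarrow> 'a connection \<Rightarrow> 'a tensor \<Rightarrow> 'a tensor" where
  "sym_deriv A nabla \<Phi> =
     tensor_of A (\<lambda>Xs p. \<Sum>j<length Xs.
       at_fields (cov_deriv A nabla (Xs ! j) \<Phi>) (take j Xs @ drop (Suc j) Xs) p)"

definition sym_lie ::
  "('a::topological_space, 'e::euclidean_space) atlas \<Rightarrow> 'a connection \<Rightarrow> 'a vfield \<Rightarrow> 'a tensor \<Rightarrow> 'a tensor" where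
  "sym_lie A nabla X = commutator (contraction X) (sym_deriv A nabla)"

definition sym_deriv_along ::
  "('a::topological_space, 'e::euclidean_space) atlas \<Rightarrow> 'a connection \<Rightarrow> 'a vtensor \<Rightarrow> 'a tensor \<Rightarrow> 'a tensor" where
  "sym_deriv_along A nabla \<sigma> = commutator (sym_contraction A 1 \<sigma>) (sym_deriv A nabla)"

definition nabla_endo ::
  "('a::topological_space, 'e::euclidean_space) atlas \<Rightarrow> 'a connection \<Rightarrow> 'a vfield \<Rightarrow> 'a vtensor" where
  "nabla_endo A nabla X = vtensor_of A 1 (\<lambda>Ys. nabla (Ys ! 0) X)"

definition curvature :: "'a connection \<Rightarrow> 'a vfield \<Rightarrow> 'a vfield \<Rightarrow> 'a vfield \<Rightarrow> 'a vfield" where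
  "curvature nabla X Y Z = nabla X (nabla Y Z) - nabla Y (nabla X Z) - nabla (lie_bracket X Y) Z"

text \<open>\<open>2 sym \<iota>\<^sub>X R\<close>, i.e. \<open>(Y, Z) \<mapsto> R(X, Y) Z + R(X, Z) Y\<close>\<close>

definition sym_curvature_contraction ::
  "('a::topological_space, 'e::euclidean_space) atlas \<Rightarrow> 'a connection \<Rightarrow> 'a vfield \<Rightarrow> 'a vtensor" where
  "sym_curvature_contraction A nabla X =
     vtensor_of A 2 (\<lambda>Ys p f. 2 * symmetrize (\<lambda>Zs. curvature nabla X (Zs ! 0) (Zs ! 1) p f) Ys)"

definition sym_bracket :: "'a connection \<Rightarrow> 'a vfield \<Rightarrow> 'a vfield \<Rightarrow> 'a vfield" where
  "sym_bracket nabla Y Z = nabla Y Z + nabla Z Y"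

definition sym_curvature ::
  "('a::topological_space, 'e::euclidean_space) atlas \<Rightarrow> 'a connection \<Rightarrow> 'a vfield \<Rightarrow> 'a vtensor" where
  "sym_curvature A nabla X =
     vtensor_of A 2 (\<lambda>Ys. let Y = Ys ! 0; Z = Ys ! 1 in
       nabla Y (nabla Z X) + nabla Z (nabla Y X) - nabla (sym_bracket nabla Y Z) X)"

end

theory Submission
  imports Defs
begin

text \<open>
  Write \<open>D\<close> for the symmetric derivative, \<open>L\<^sub>X\<close> for the symmetric Lie derivative, \<open>\<iota>\<^sub>Y\<close> for the
  contraction with a vector field and \<open>A\<close> for the endomorphism \<open>Y \<mapsto> \<nabla>\<^sub>Y X\<close>.  An operator on
  symmetric tensor fields is determined by its part of degree 0 and by its commutators with all
  \<open>\<iota>\<^sub>Y\<close> (\<open>operator_eqI\<close>), and the commutators that occur here are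
  \<open>[\<iota>\<^sub>Y, D] = L\<^sub>Y\<close>, \<open>[\<iota>\<^sub>Z, L\<^sub>X] = - \<iota>\<close> of \<open>[X, Z]\<^sub>s\<close> (\<open>contraction_sym_lie\<close>), and
  \<open>[\<iota>\<^sub>Y, \<iota>\<^sup>s\<^sub>\<sigma>] = \<iota>\<^sup>s\<close> of \<open>\<sigma>(Y, \<dots>)\<close> (\<open>contraction_contr_tensor\<close>).  Taking the commutator of
  \<open>[D, L\<^sub>X] = 2 [\<iota>\<^sup>s\<^sub>A, D] + \<iota>\<^sup>s\<^sub>\<rho>\<close> with \<open>\<iota>\<^sub>Y\<close> leaves an identity between operators that preserve the
  degree (\<open>commutator_of_sym_lie\<close>), and the commutator of that one with \<open>\<iota>\<^sub>Z\<close> leaves an identity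
  between contractions with vector fields.  The latter is a computation with \<open>\<nabla>\<close>
  (\<open>curv_term_identity\<close>), which shows that \<open>\<rho>\<close> has to be the sum of the two curvature terms.

  The larger part of the text makes these operators accessible.  The covariant and the symmetric
  derivative are given by their values on vector fields, so one needs that symmetric maps of lists of
  vector fields, multilinear over the smooth functions, correspond to symmetric tensor fields
  (\<open>tensor_of\<close>).  This follows from a cut-off local frame (\<open>local_frame\<close>), whose construction
  uses Hadamard's lemma and a bump function.  The symmetric contraction is characterized as a
  derivation of the symmetric product.  That product is rewritten as a shuffle product
  (\<open>sym_prod_eq_shuffle\<close>), for which contractions visibly are derivations (\<open>contr_shuffle\<close>), and a
  derivation is determined by its values on functions and 1-forms because these generate all
  symmetric tensor fields locally (\<open>derivation_eqI\<close>).
\<close>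

section \<open>Smooth functions on open subsets of a Euclidean space\<close>

lemma Ck_on_cong:
  assumes "Ck_on k S f" "open S" "\<And>x. x \<in> S \<Longrightarrow> f x = g x"
  shows "Ck_on k S g"
  using assms
proof (induction k arbitrary: f g)
  case 0
  then show ?case by (auto cong: continuous_on_cong_simp)
next
  case (Suc k)
  have D: "(g has_derivative frechet_derivative f (at x)) (at x)" if "x \<in> S" for x
  proof (rule has_derivative_transform_within_open[OF _ \<open>open S\<close> that Suc.prems(3)])
    show "(f has_derivative frechet_derivative f (at x)) (at x)"
      using Suc.prems(1) that frechet_derivative_works by auto
  qed auto
  have E: "frechet_derivative f (at x) = frechet_derivative g (at x)" if "x \<in> S" for x
    using D[OF that] by (rule frechet_derivative_at)
  have "Ck_on k S (\<lambda>x. frechet_derivative g (at x) v)" for v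
    by (rule Suc.IH[of "\<lambda>x. frechet_derivative f (at x) v"]) (use Suc.prems E in auto)
  with D show ?case by (auto simp: differentiable_def)
qed

lemma Ck_on_SucI:
  assumes "open S" "\<And>x. x \<in> S \<Longrightarrow> (f has_derivative D x) (at x)" "\<And>v. Ck_on k S (\<lambda>x. D x v)"
  shows "Ck_on (Suc k) S f"
proof -
  have "Ck_on k S (\<lambda>x. frechet_derivative f (at x) v)" for v
    by (rule Ck_on_cong[OF assms(3)[of v] assms(1)]) (use frechet_derivative_at[OF assms(2)] in auto)
  then show ?thesis using assms(2) by (auto simp: differentiable_def)
qed

lemma Ck_on_SucD:
  assumes "Ck_on (Suc k) S f"
  shows "x \<in> S \<Longrightarrow> (f has_derivative frechet_derivative f (at x)) (at x)"
    and "Ck_on k S (\<lambda>x. frechet_derivative f (at x) v)"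
  using assms frechet_derivative_works by auto

lemma Ck_on_mono: "Ck_on k S f \<Longrightarrow> T \<subseteq> S \<Longrightarrow> Ck_on k T f"
  by (induction k arbitrary: f) (auto intro: continuous_on_subset)

lemma Ck_on_continuous_on: "Ck_on k S f \<Longrightarrow> continuous_on S f"
  by (cases k) (auto intro!: differentiable_imp_continuous_on differentiable_at_imp_differentiable_on)

lemma Ck_on_SucE: "Ck_on (Suc k) S f \<Longrightarrow> Ck_on k S f"
proof (induction k arbitrary: f)
  case 0
  then show ?case by (simp add: Ck_on_continuous_on[of "Suc 0"])
next
  case (Suc k)
  then show ?case by auto
qed

lemma Ck_on_local:
  assumes "\<And>x. x \<in> S \<Longrightarrow> \<exists>T. open T \<and> x \<in> T \<and> Ck_on k T f"
  shows "Ck_on k S f"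
  using assms
proof (induction k arbitrary: f)
  case 0
  show ?case unfolding Ck_on.simps
  proof (rule continuous_at_imp_continuous_on, rule ballI)
    fix x assume "x \<in> S"
    then obtain T where "open T" "x \<in> T" "continuous_on T f" using 0 by auto
    then show "isCont f x" using continuous_on_eq_continuous_at by blast
  qed
next
  case (Suc k)
  have "Ck_on k S (\<lambda>x. frechet_derivative f (at x) v)" for v
    using Suc.prems by (intro Suc.IH) fastforce
  moreover have "f differentiable (at x)" if "x \<in> S" for x
    using Suc.prems[OF that] by auto
  ultimately show ?case by auto
qed

lemma Ck_on_const: "open S \<Longrightarrow> Ck_on k S (\<lambda>_. c)"
proof (induction k arbitrary: c)
  case (Suc k)
  then show ?case by (intro Ck_on_SucI[where D="\<lambda>_ _. 0"]) auto
qed auto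

lemma Ck_on_add:
  assumes "open S" "Ck_on k S f" "Ck_on k S g"
  shows "Ck_on k S (\<lambda>x. f x + g x)"
  using assms
proof (induction k arbitrary: f g)
  case 0
  then show ?case by (auto intro: continuous_intros)
next
  case (Suc k)
  note D = Ck_on_SucD[OF Suc.prems(2)] Ck_on_SucD[OF Suc.prems(3)]
  show ?case
    by (rule Ck_on_SucI[OF Suc.prems(1) has_derivative_add[OF D(1,3)]])
      (use Suc.IH Suc.prems(1) D(2,4) in auto)
qed

lemma Ck_on_mult:
  fixes f g :: "'e::euclidean_space \<Rightarrow> real"
  assumes "open S" "Ck_on k S f" "Ck_on k S g"
  shows "Ck_on k S (\<lambda>x. f x * g x)"
  using assms
proof (induction k arbitrary: f g)
  case 0
  then show ?case by (auto intro: continuous_intros)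
next
  case (Suc k)
  note D = Ck_on_SucD[OF Suc.prems(2)] Ck_on_SucD[OF Suc.prems(3)]
  show ?case
    by (rule Ck_on_SucI[OF Suc.prems(1) has_derivative_mult[OF D(1,3)]])
      (use Suc.prems(1) D(2,4) Suc.prems(2,3)[THEN Ck_on_SucE] in \<open>auto intro!: Ck_on_add Suc.IH\<close>)
qed

lemma Ck_on_sum:
  assumes "open S" "\<And>i. i \<in> I \<Longrightarrow> Ck_on k S (f i)"
  shows "Ck_on k S (\<lambda>x. \<Sum>i\<in>I. f i x)"
  using assms(2)
  by (induction I rule: infinite_finite_induct) (auto intro!: Ck_on_add Ck_on_const assms(1))

lemma Ck_on_inner:
  assumes "open S" "Ck_on k S f"
  shows "Ck_on k S (\<lambda>x. f x \<bullet> (c::'b::real_inner))"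
  using assms
proof (induction k arbitrary: f)
  case 0
  then show ?case by (auto intro: continuous_intros)
next
  case (Suc k)
  note D = Ck_on_SucD[OF Suc.prems(2)]
  show ?case
    by (rule Ck_on_SucI[OF Suc.prems(1) has_derivative_inner_left[OF D(1)]])
      (use Suc.IH Suc.prems(1) D(2) in auto)
qed

lemma linear_euclidean_expansion:
  assumes "linear f"
  shows "f v = (\<Sum>i\<in>Basis. (v \<bullet> i) *\<^sub>R f i)"
proof -
  have "f v = f (\<Sum>i\<in>Basis. (v \<bullet> i) *\<^sub>R i)" by (simp add: euclidean_representation)
  then show ?thesis by (simp add: linear_sum[OF assms] linear_scale[OF assms])
qed

text \<open>The directions of differentiation in \<open>Ck_on\<close> are constant, whereas the chain rule differentiates
  \<open>f\<close> in the varying direction \<open>Dg(x) v\<close>; expanding this direction in the standard basis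
  makes the induction hypothesis applicable to the partial derivatives of \<open>f\<close>.\<close>
lemma Ck_on_compose:
  fixes f :: "'f::euclidean_space \<Rightarrow> real" and g :: "'e::euclidean_space \<Rightarrow> 'f"
  assumes "open S" "open T" "g ` S \<subseteq> T" "Ck_on k S g" "Ck_on k T f"
  shows "Ck_on k S (\<lambda>x. f (g x))"
  using assms
proof (induction k arbitrary: f)
  case 0
  then show ?case by (auto intro: continuous_on_compose2)
next
  case (Suc k)
  note Dg = Ck_on_SucD[OF Suc.prems(4)] and Df = Ck_on_SucD[OF Suc.prems(5)]
  let ?D = "\<lambda>x v. \<Sum>i\<in>Basis. (frechet_derivative g (at x) v \<bullet> i) * frechet_derivative f (at (g x)) i"
  show ?case
  proof (rule Ck_on_SucI[OF Suc.prems(1), where D = ?D])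
    fix x assume "x \<in> S"
    then have gx: "g x \<in> T" using Suc.prems(3) by auto
    have "linear (frechet_derivative f (at (g x)))"
      using Df(1)[OF gx] by (simp add: has_derivative_linear)
    note lin = linear_euclidean_expansion[OF this]
    have "((\<lambda>x. f (g x)) has_derivative
        (\<lambda>v. frechet_derivative f (at (g x)) (frechet_derivative g (at x) v))) (at x)"
      using has_derivative_compose[OF Dg(1)[OF \<open>x \<in> S\<close>] Df(1)[OF gx]] by simp
    then show "((\<lambda>x. f (g x)) has_derivative ?D x) (at x)"
      by (subst (asm) lin) simp
  next
    fix v
    have "Ck_on k S (\<lambda>x. frechet_derivative f (at (g x)) i)" for i
      by (rule Suc.IH[OF Suc.prems(1-3) Ck_on_SucE[OF Suc.prems(4)] Df(2)])
    then show "Ck_on k S (\<lambda>x. ?D x v)"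
      using Suc.prems(1) Dg(2) by (intro Ck_on_sum Ck_on_mult Ck_on_inner) auto
  qed
qed

lemma smooth_on_cong:
  "smooth_on S f \<Longrightarrow> open S \<Longrightarrow> (\<And>x. x \<in> S \<Longrightarrow> f x = g x) \<Longrightarrow> smooth_on S g"
  unfolding smooth_on_def by (meson Ck_on_cong)

lemma smooth_on_mono: "smooth_on S f \<Longrightarrow> T \<subseteq> S \<Longrightarrow> smooth_on T f"
  unfolding smooth_on_def by (meson Ck_on_mono)

lemma smooth_on_local:
  "(\<And>x. x \<in> S \<Longrightarrow> \<exists>T. open T \<and> x \<in> T \<and> smooth_on T f) \<Longrightarrow> smooth_on S f"
  unfolding smooth_on_def by (meson Ck_on_local)

lemma smooth_on_const: "open S \<Longrightarrow> smooth_on S (\<lambda>_. c)"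
  by (simp add: smooth_on_def Ck_on_const)

lemma smooth_on_add: "open S \<Longrightarrow> smooth_on S f \<Longrightarrow> smooth_on S g \<Longrightarrow> smooth_on S (\<lambda>x. f x + g x)"
  by (simp add: smooth_on_def Ck_on_add)

lemma smooth_on_mult:
  fixes f g :: "'e::euclidean_space \<Rightarrow> real"
  shows "open S \<Longrightarrow> smooth_on S f \<Longrightarrow> smooth_on S g \<Longrightarrow> smooth_on S (\<lambda>x. f x * g x)"
  by (simp add: smooth_on_def Ck_on_mult)

lemma smooth_on_sum:
  "open S \<Longrightarrow> (\<And>i. i \<in> I \<Longrightarrow> smooth_on S (f i)) \<Longrightarrow> smooth_on S (\<lambda>x. \<Sum>i\<in>I. f i x)"
  by (simp add: smooth_on_def Ck_on_sum)

lemma smooth_on_compose: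
  fixes f :: "'f::euclidean_space \<Rightarrow> real"
  shows "open S \<Longrightarrow> open T \<Longrightarrow> g ` S \<subseteq> T \<Longrightarrow> smooth_on S g \<Longrightarrow> smooth_on T f \<Longrightarrow>
    smooth_on S (\<lambda>x. f (g x))"
  by (simp add: smooth_on_def Ck_on_compose)

lemma smooth_on_continuous_on: "smooth_on S f \<Longrightarrow> continuous_on S f"
  unfolding smooth_on_def by (metis Ck_on.simps(1))

lemma smooth_on_frechet_derivative:
  "smooth_on S f \<Longrightarrow> smooth_on S (\<lambda>x. frechet_derivative f (at x) v)"
  unfolding smooth_on_def by (auto intro: Ck_on_SucD(2))

lemma smooth_on_has_derivative:
  "smooth_on S f \<Longrightarrow> x \<in> S \<Longrightarrow> (f has_derivative frechet_derivative f (at x)) (at x)"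
  unfolding smooth_on_def by (auto intro: Ck_on_SucD(1))

lemma smooth_on_inner_left: "smooth_on UNIV (\<lambda>y::'e::euclidean_space. y \<bullet> c)"
proof -
  have "Ck_on k UNIV (\<lambda>y::'e. y \<bullet> c)" for k
  proof (cases k)
    case (Suc j)
    have "((\<lambda>y. y \<bullet> c) has_derivative (\<lambda>v. v \<bullet> c)) (at x)" for x :: 'e
      by (auto intro!: derivative_eq_intros)
    then show ?thesis unfolding Suc by (intro Ck_on_SucI) (auto intro: Ck_on_const)
  qed (auto intro: continuous_intros)
  then show ?thesis by (simp add: smooth_on_def)
qed


subsection \<open>A bump function\<close>

text \<open>The derivative of \<open>flat m\<close> is a combination of \<open>flat (m + 1)\<close> and \<open>flat (m + 2)\<close>; the family is
  therefore closed under differentiation, and all its members are smooth at once.\<close>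

definition flat :: "nat \<Rightarrow> real \<Rightarrow> real" where
  "flat m t = (if t > 0 then exp (- inverse t) * inverse t ^ m else 0)"

lemma flat_has_derivative: "(flat m has_derivative
    (\<lambda>v. v * (flat (Suc (Suc m)) t - real m * flat (Suc m) t))) (at t)"
proof -
  consider "t > 0" | "t < 0" | "t = 0" by linarith
  then show ?thesis
  proof cases
    case 1
    have "((\<lambda>t. exp (- inverse t) * inverse t ^ m) has_field_derivative
        exp (- inverse t) * (inverse t)\<^sup>2 * inverse t ^ m
          + exp (- inverse t) * (- (real m * inverse t ^ (m - 1) * (inverse t)\<^sup>2))) (at t)"
      using 1 by (auto intro!: derivative_eq_intros simp: power2_eq_square)
    moreover have "real m * inverse t ^ (m - 1) * (inverse t)\<^sup>2 = real m * inverse t ^ Suc m"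
      by (cases m) (auto simp: power2_eq_square)
    then have "exp (- inverse t) * (inverse t)\<^sup>2 * inverse t ^ m
          + exp (- inverse t) * (- (real m * inverse t ^ (m - 1) * (inverse t)\<^sup>2))
        = flat (Suc (Suc m)) t - real m * flat (Suc m) t"
      using 1 by (simp add: flat_def power2_eq_square)
    ultimately have "((\<lambda>t. exp (- inverse t) * inverse t ^ m) has_field_derivative
        (flat (Suc (Suc m)) t - real m * flat (Suc m) t)) (at t)" by simp
    then have "((\<lambda>t. exp (- inverse t) * inverse t ^ m) has_derivative
        (\<lambda>v. v * (flat (Suc (Suc m)) t - real m * flat (Suc m) t))) (at t)"
      unfolding has_field_derivative_def by (simp add: mult_commute_abs)
    then show ?thesis
      by (rule has_derivative_transform_within_open[of _ _ _ _ "{0<..}"]) (use 1 in \<open>auto simp: flat_def\<close>)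
  next
    case 2
    have "((\<lambda>_::real. 0::real) has_derivative (\<lambda>v. 0)) (at t)" by simp
    then have "(flat m has_derivative (\<lambda>v. 0)) (at t)"
      by (rule has_derivative_transform_within_open[of _ _ _ _ "{..<0}"]) (use 2 in \<open>auto simp: flat_def\<close>)
    with 2 show ?thesis by (auto simp: flat_def)
  next
    case 3
    have "((\<lambda>s::real. s ^ Suc m / exp s) \<longlongrightarrow> 0) at_top"
      by (rule tendsto_power_div_exp_0)
    then have "((\<lambda>h. inverse h ^ Suc m / exp (inverse h)) \<longlongrightarrow> 0) (at_right (0::real))"
      by (rule filterlim_compose[OF _ filterlim_inverse_at_top_right])
    moreover have "\<forall>\<^sub>F h in at_right (0::real). inverse h ^ Suc m / exp (inverse h) = (flat m h - flat m 0) / (h - 0)"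
      using eventually_at_right_less[of "0::real"]
      by eventually_elim (auto simp: flat_def exp_minus field_simps)
    ultimately have R: "((\<lambda>h. (flat m h - flat m 0) / (h - 0)) \<longlongrightarrow> 0) (at_right 0)"
      by (rule Lim_transform_eventually)
    have "\<forall>\<^sub>F h in at_left (0::real). h < 0"
      by (simp add: eventually_at_filter)
    then have "\<forall>\<^sub>F h in at_left (0::real). 0 = (flat m h - flat m 0) / (h - 0)"
      by eventually_elim (auto simp: flat_def)
    then have L: "((\<lambda>h. (flat m h - flat m 0) / (h - 0)) \<longlongrightarrow> 0) (at_left 0)"
      by (rule Lim_transform_eventually[OF tendsto_const])
    have "(flat m has_field_derivative 0) (at 0)"
      unfolding has_field_derivative_iff using filterlim_split_at[OF L R] by simp
    then have "(flat m has_derivative (\<lambda>v. 0)) (at 0)"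
      by (simp add: has_field_derivative_def lambda_zero)
    with 3 show ?thesis by (simp add: flat_def)
  qed
qed

lemma smooth_on_flat: "smooth_on UNIV (flat m)"
proof -
  have "Ck_on k UNIV (flat m)" for k
  proof (induction k arbitrary: m)
    case 0
    show ?case using flat_has_derivative
      by (auto intro!: continuous_at_imp_continuous_on has_derivative_continuous)
  next
    case (Suc k)
    have "Ck_on k UNIV (\<lambda>t. v * (flat (Suc (Suc m)) t + (- real m) * flat (Suc m) t))" for v
      by (intro Ck_on_mult Ck_on_add Ck_on_const Suc) auto
    then show ?case by (intro Ck_on_SucI[OF _ flat_has_derivative]) auto
  qed
  then show ?thesis by (simp add: smooth_on_def)
qed

lemma smooth_bump_exists:
  fixes c :: "'e::euclidean_space"
  assumes "r > 0"
  obtains b :: "'e \<Rightarrow> real" where "smooth_on UNIV b" "\<And>y. b y \<noteq> 0 \<longleftrightarrow> y \<in> ball c r"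
proof
  \<comment> \<open>This is \<open>r\<^sup>2 - |y - c|\<^sup>2\<close>, spelled out as a polynomial to make smoothness evident.\<close>
  let ?g = "\<lambda>y. r\<^sup>2 + (\<Sum>i\<in>Basis. (- 1) * ((y \<bullet> i + (- (c \<bullet> i))) * (y \<bullet> i + (- (c \<bullet> i)))))"
  show "smooth_on UNIV (\<lambda>y. flat 0 (?g y))"
    by (intro smooth_on_compose[OF open_UNIV open_UNIV _ _ smooth_on_flat] smooth_on_add smooth_on_sum
        smooth_on_mult smooth_on_const smooth_on_inner_left open_UNIV subset_UNIV)
  fix y
  have "(norm (y - c))\<^sup>2 = (\<Sum>i\<in>Basis. (y \<bullet> i - c \<bullet> i) * (y \<bullet> i - c \<bullet> i))"
    unfolding power2_norm_eq_inner by (subst euclidean_inner) (simp add: inner_diff_left)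
  then have "?g y = r\<^sup>2 - (norm (y - c))\<^sup>2" by (simp add: sum_negf)
  moreover have "r\<^sup>2 - (norm (y - c))\<^sup>2 > 0 \<longleftrightarrow> norm (y - c) < r"
    using assms power2_less_imp_less[of "norm (y - c)" r] power_strict_mono[of "norm (y - c)" r 2]
    by auto
  ultimately show "flat 0 (?g y) \<noteq> 0 \<longleftrightarrow> y \<in> ball c r"
    by (simp add: flat_def dist_norm norm_minus_commute)
qed


subsection \<open>Hadamard's lemma\<close>

lemma continuous_on_slice:
  assumes "continuous_on (A \<times> B) (\<lambda>(x, t). F x t)" "x \<in> A"
  shows "continuous_on B (F x)"
proof -
  have "continuous_on B (\<lambda>t. (\<lambda>(x, t). F x t) (x, t))"
    by (rule continuous_on_compose2[OF assms(1)]) (use assms(2) in \<open>auto intro: continuous_intros\<close>)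
  then show ?thesis by simp
qed

text \<open>Differentiation under the integral sign turns the weight \<open>t ^ m\<close> into \<open>t ^ (m + 1)\<close>, so the
  induction on the order of differentiability has to run over all exponents \<open>m\<close>.\<close>

lemma Ck_on_averaged:
  fixes g :: "'e::euclidean_space \<Rightarrow> real"
  assumes W: "open W" "convex W" and c: "c \<in> W" and g: "smooth_on W g"
  shows "Ck_on k W (\<lambda>y. integral {0..1} (\<lambda>t. t ^ m * g (c + t *\<^sub>R (y - c))))"
  using g
proof (induction k arbitrary: m g)
  have seg: "c + t *\<^sub>R (y - c) \<in> W" if "y \<in> W" "t \<in> {0..1}" for y t
  proof -
    have "(1 - t) *\<^sub>R c + t *\<^sub>R y \<in> W" using W(2) c that by (intro convexD) auto
    then show ?thesis by (simp add: algebra_simps)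
  qed
  have C: "continuous_on (W \<times> {0..1}) (\<lambda>(y, t). t ^ n * h (c + t *\<^sub>R (y - c)))"
    if "smooth_on W h" for n and h :: "'e \<Rightarrow> real"
  proof -
    have "continuous_on W h" using that by (rule smooth_on_continuous_on)
    then have "continuous_on (W \<times> {0..1}) (\<lambda>z. h (c + snd z *\<^sub>R (fst z - c)))"
      by (rule continuous_on_compose2) (use seg in \<open>auto intro!: continuous_intros\<close>)
    then show ?thesis unfolding split_beta by (intro continuous_on_mult continuous_on_power continuous_on_snd continuous_on_id)
  qed
  {
    case 0
    show ?case
      using integral_continuous_on_param[of W 0 1 "\<lambda>y t. t ^ m * g (c + t *\<^sub>R (y - c))"] C[OF 0]
      by simp
  next
    case (Suc k)
    let ?f = "\<lambda>y t. t ^ m * g (c + t *\<^sub>R (y - c))"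
    let ?d = "\<lambda>y t v. t ^ Suc m * frechet_derivative g (at (c + t *\<^sub>R (y - c))) v"
    have bl: "bounded_linear (?d y t)" if "y \<in> W" "t \<in> {0..1}" for y t
      using has_derivative_bounded_linear[OF smooth_on_has_derivative[OF Suc.prems seg[OF that]]]
      by (rule bounded_linear_const_mult)
    have D: "((\<lambda>y. ?f y t) has_derivative ?d y t) (at y)" if "y \<in> W" "t \<in> {0..1}" for y t
    proof -
      have lin: "linear (frechet_derivative g (at (c + t *\<^sub>R (y - c))))"
        by (rule has_derivative_linear[OF smooth_on_has_derivative[OF Suc.prems seg[OF that]]])
      have "((\<lambda>y. c + t *\<^sub>R (y - c)) has_derivative (\<lambda>v. t *\<^sub>R v)) (at y)"
        by (auto intro!: derivative_eq_intros)
      from has_derivative_compose[OF this smooth_on_has_derivative[OF Suc.prems seg[OF that]]]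
      have "((\<lambda>y. g (c + t *\<^sub>R (y - c))) has_derivative
          (\<lambda>v. frechet_derivative g (at (c + t *\<^sub>R (y - c))) (t *\<^sub>R v))) (at y)" by simp
      from has_derivative_mult_right[OF this, of "t ^ m"] show ?thesis
        by (simp add: linear_scale[OF lin] mult_ac)
    qed
    define fx where "fx y t = Blinfun (?d y t)" for y t
    have fx: "blinfun_apply (fx y t) = ?d y t" if "y \<in> W" "t \<in> {0..1}" for y t
      unfolding fx_def using bl[OF that] by (rule bounded_linear_Blinfun_apply)
    have cfx: "continuous_on (W \<times> cbox 0 1) (\<lambda>(y, t). fx y t)"
    proof (rule continuous_on_blinfun_componentwise)
      fix i :: 'e
      have "continuous_on (W \<times> {0..1}) (\<lambda>(y, t). ?d y t i)"
        by (rule C[OF smooth_on_frechet_derivative[OF Suc.prems]])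
      then show "continuous_on (W \<times> cbox 0 1) (\<lambda>z. blinfun_apply (case z of (y, t) \<Rightarrow> fx y t) i)"
        unfolding cbox_interval by (rule continuous_on_eq) (auto simp: fx)
    qed
    have int: "?f y integrable_on cbox 0 1" if "y \<in> W" for y
      using continuous_on_slice[OF C[OF Suc.prems] that]
      by (simp add: integrable_continuous_interval)
    have L: "((\<lambda>y. integral {0..1} (?f y)) has_derivative (\<lambda>v. integral {0..1} (\<lambda>t. ?d y t v))) (at y)"
      if y: "y \<in> W" for y
    proof -
      have "((\<lambda>y. integral (cbox 0 1) (?f y)) has_derivative integral (cbox 0 1) (fx y)) (at y within W)"
      proof (rule leibniz_rule[OF _ int cfx y W(2)])
        fix z and t :: real assume "z \<in> W" "t \<in> cbox 0 1"
        then show "((\<lambda>y. ?f y t) has_derivative blinfun_apply (fx z t)) (at z within W)"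
          using has_derivative_at_withinI[OF D] fx by auto
      qed
      moreover have "blinfun_apply (integral (cbox 0 1) (fx y)) = (\<lambda>v. integral {0..1} (\<lambda>t. ?d y t v))"
      proof
        fix v
        have "fx y integrable_on cbox 0 1"
          by (rule integrable_continuous[OF continuous_on_slice[OF cfx y]])
        then have "blinfun_apply (integral (cbox 0 1) (fx y)) v
            = integral (cbox 0 1) (\<lambda>t. blinfun_apply (fx y t) v)"
          by (simp add: blinfun_apply_integral)
        also have "\<dots> = integral (cbox 0 1) (\<lambda>t. ?d y t v)"
          by (rule integral_cong) (use fx[OF y] in auto)
        finally show "blinfun_apply (integral (cbox 0 1) (fx y)) v = integral {0..1} (\<lambda>t. ?d y t v)" by simp
      qed
      ultimately show ?thesis
        by (simp add: at_within_open[OF y W(1)])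
    qed
    show ?case
      by (rule Ck_on_SucI[OF W(1) L Suc.IH[OF smooth_on_frechet_derivative[OF Suc.prems]]])
  }
qed

text \<open>The increment \<open>f y - f c\<close> is the integral of the derivative of \<open>f\<close> along the segment from \<open>c\<close> to
  \<open>y\<close>, and this derivative is linear in \<open>y - c\<close>.\<close>
lemma Hadamard:
  fixes f :: "'e::euclidean_space \<Rightarrow> real"
  assumes W: "open W" "convex W" and c: "c \<in> W" and f: "smooth_on W f"
  obtains g :: "'e \<Rightarrow> 'e \<Rightarrow> real" where
    "\<And>i. smooth_on W (g i)" "\<And>i. g i c = frechet_derivative f (at c) i"
    "\<And>y. y \<in> W \<Longrightarrow> f y = f c + (\<Sum>i\<in>Basis. ((y - c) \<bullet> i) * g i y)"
proof
  let ?g = "\<lambda>i y. integral {0..1} (\<lambda>t. t ^ 0 * frechet_derivative f (at (c + t *\<^sub>R (y - c))) i)"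
  show "smooth_on W (?g i)" for i
    unfolding smooth_on_def
    by (intro allI Ck_on_averaged[OF W c smooth_on_frechet_derivative[OF f]])
  show "?g i c = frechet_derivative f (at c) i" for i by simp
  fix y assume y: "y \<in> W"
  have seg: "c + t *\<^sub>R (y - c) \<in> W" if "t \<in> {0..1}" for t
  proof -
    have "(1 - t) *\<^sub>R c + t *\<^sub>R y \<in> W" using W(2) c y that by (intro convexD) auto
    then show ?thesis by (simp add: algebra_simps)
  qed
  let ?D = "\<lambda>t. frechet_derivative f (at (c + t *\<^sub>R (y - c)))"
  have "((\<lambda>t. f (c + t *\<^sub>R (y - c))) has_vector_derivative ?D t (y - c)) (at t within {0..1})"
    if t: "t \<in> {0..1}" for t
  proof -
    have "((\<lambda>t. c + t *\<^sub>R (y - c)) has_derivative (\<lambda>s. s *\<^sub>R (y - c))) (at t)"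
      by (auto intro!: derivative_eq_intros)
    from has_derivative_compose[OF this smooth_on_has_derivative[OF f seg[OF t]]]
    have "((\<lambda>t. f (c + t *\<^sub>R (y - c))) has_derivative (\<lambda>s. ?D t (s *\<^sub>R (y - c)))) (at t)" by simp
    then have "((\<lambda>t. f (c + t *\<^sub>R (y - c))) has_vector_derivative ?D t (y - c)) (at t)"
      using has_derivative_linear[OF smooth_on_has_derivative[OF f seg[OF t]]]
      by (simp add: has_vector_derivative_def linear_scale)
    then show ?thesis by (rule has_vector_derivative_at_within)
  qed
  then have "((\<lambda>t. ?D t (y - c)) has_integral f (c + 1 *\<^sub>R (y - c)) - f (c + 0 *\<^sub>R (y - c))) {0..1}"
    by (intro fundamental_theorem_of_calculus) auto
  then have 1: "integral {0..1} (\<lambda>t. ?D t (y - c)) = f y - f c"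
    by (simp add: integral_unique)
  have "continuous_on {0..1} (\<lambda>t. ?D t i)" for i
  proof (rule continuous_on_compose2[where g="\<lambda>z. frechet_derivative f (at z) i"])
    show "continuous_on W (\<lambda>z. frechet_derivative f (at z) i)"
      by (rule smooth_on_continuous_on[OF smooth_on_frechet_derivative[OF f]])
  qed (use seg in \<open>auto intro!: continuous_intros\<close>)
  then have int: "(\<lambda>t. ?D t i) integrable_on {0..1}" for i
    by (rule integrable_continuous_interval)
  have "integral {0..1} (\<lambda>t. ?D t (y - c)) = integral {0..1} (\<lambda>t. \<Sum>i\<in>Basis. ((y - c) \<bullet> i) * ?D t i)"
  proof (rule integral_cong)
    fix t :: real assume t: "t \<in> {0..1}"
    show "?D t (y - c) = (\<Sum>i\<in>Basis. ((y - c) \<bullet> i) * ?D t i)"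
      using linear_euclidean_expansion[OF has_derivative_linear[OF
            smooth_on_has_derivative[OF f seg[OF t]]], of "y - c"] by simp
  qed
  also have "\<dots> = (\<Sum>i\<in>Basis. ((y - c) \<bullet> i) * integral {0..1} (\<lambda>t. ?D t i))"
    by (subst integral_sum) (auto intro: integrable_on_mult_right int)
  finally show "f y = f c + (\<Sum>i\<in>Basis. ((y - c) \<bullet> i) * ?g i y)"
    using 1 by simp
qed


section \<open>Smooth functions and vector fields on a manifold\<close>

lemma sum_fun_apply: "(\<Sum>i\<in>I. f i) x = (\<Sum>i\<in>I. f i x)"
  by (induction I rule: infinite_finite_induct) auto

locale smooth_manifold =
  fixes A :: "('a::{t2_space,second_countable_topology}, 'e::euclidean_space) atlas"
  assumes atlas: "smooth_atlas A"
begin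

abbreviation "CF \<equiv> smooth_funs A"
abbreviation "TM \<equiv> tangent_space A"
abbreviation "VF \<equiv> vfields A"
abbreviation "ST \<equiv> Upsilon_sum A"

lemma chart_at:
  obtains U x where "(U, x) \<in> A" "p \<in> U"
proof -
  have "p \<in> (\<Union>(U, x)\<in>A. U)" using atlas by (simp add: smooth_atlas_def)
  then show ?thesis using that by blast
qed

lemma chart:
  assumes "(U, x) \<in> A"
  shows open_domain: "open U" and open_range: "open (x ` U)"
    and chart_homeo: "homeomorphism U (x ` U) x (inv_into U x)"
  using assms atlas unfolding smooth_atlas_def by auto

lemma chart_inverse:
  assumes "(U, x) \<in> A"
  shows "q \<in> U \<Longrightarrow> inv_into U x (x q) = q" and "y \<in> x ` U \<Longrightarrow> x (inv_into U x y) = y"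
    and "y \<in> x ` U \<Longrightarrow> inv_into U x y \<in> U"
  using chart_homeo[OF assms] by (auto simp: homeomorphism_def f_inv_into_f inv_into_into)

lemma chart_open_image:
  assumes "(U, x) \<in> A" "open S"
  shows "open (x ` (U \<inter> S))"
proof -
  have "openin (top_of_set (x ` U)) (x ` (U \<inter> S))"
    by (rule homeomorphism_imp_open_map[OF chart_homeo[OF assms(1)]]) (use assms(2) in auto)
  then show ?thesis using open_range[OF assms(1)] openin_open_eq by blast
qed

lemma transition_smooth:
  assumes "(U, x) \<in> A" "(V, y) \<in> A"
  shows "smooth_on (x ` (U \<inter> V)) (y \<circ> inv_into U x)"
  using assms atlas unfolding smooth_atlas_def by fast

lemma smooth_funsD:
  "f \<in> CF \<Longrightarrow> (U, x) \<in> A \<Longrightarrow> smooth_on (x ` U) (f \<circ> inv_into U x)"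
  unfolding smooth_funs_def by auto

lemma smooth_const: "(\<lambda>_. c) \<in> CF"
  unfolding smooth_funs_def by (auto simp: o_def intro: smooth_on_const open_range)

lemma smooth_add: "f \<in> CF \<Longrightarrow> g \<in> CF \<Longrightarrow> f + g \<in> CF"
  unfolding smooth_funs_def by (fastforce simp: o_def plus_fun_def intro: smooth_on_add open_range)

lemma smooth_mult: "f \<in> CF \<Longrightarrow> g \<in> CF \<Longrightarrow> f * g \<in> CF"
  unfolding smooth_funs_def by (fastforce simp: o_def times_fun_def intro: smooth_on_mult open_range)

lemma smooth_zero: "0 \<in> CF"
  using smooth_const[of 0] by (simp add: zero_fun_def)

lemma smooth_uminus: "f \<in> CF \<Longrightarrow> - f \<in> CF"
  using smooth_mult[OF smooth_const[of "-1"], of f] by (simp add: times_fun_def fun_Compl_def)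

lemma smooth_diff: "f \<in> CF \<Longrightarrow> g \<in> CF \<Longrightarrow> f - g \<in> CF"
  using smooth_add[OF _ smooth_uminus] by (metis diff_conv_add_uminus)

lemma smooth_sum: "(\<And>i. i \<in> I \<Longrightarrow> f i \<in> CF) \<Longrightarrow> (\<Sum>i\<in>I. f i) \<in> CF"
  by (induction I rule: infinite_finite_induct) (auto intro: smooth_add smooth_zero)

lemmas smooth_intros =
  smooth_const smooth_add smooth_mult smooth_zero smooth_uminus smooth_diff smooth_sum


subsection \<open>Tangent vectors\<close>

lemma tangent_zero: "0 \<in> TM p"
  by (simp add: tangent_space_def)

lemma tangent_add: "v \<in> TM p \<Longrightarrow> w \<in> TM p \<Longrightarrow> v + w \<in> TM p"
  by (simp add: tangent_space_def algebra_simps)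

lemma tangent_scale: "v \<in> TM p \<Longrightarrow> (\<lambda>f. c * v f) \<in> TM p"
  by (simp add: tangent_space_def algebra_simps)

lemma tangent_apply:
  assumes "v \<in> TM p"
  shows tangent_apply_add: "f \<in> CF \<Longrightarrow> g \<in> CF \<Longrightarrow> v (f + g) = v f + v g"
    and tangent_apply_scale: "f \<in> CF \<Longrightarrow> v ((\<lambda>_. c) * f) = c * v f"
    and tangent_apply_mult: "f \<in> CF \<Longrightarrow> g \<in> CF \<Longrightarrow> v (f * g) = f p * v g + g p * v f"
    and tangent_apply_nonsmooth: "f \<notin> CF \<Longrightarrow> v f = 0"
  using assms by (auto simp: tangent_space_def plus_fun_def times_fun_def)

lemma tangent_apply_zero: "v \<in> TM p \<Longrightarrow> v 0 = 0"
  using tangent_apply_scale[of v p 0 0] by (simp add: smooth_zero)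

lemma tangent_apply_sum:
  assumes "v \<in> TM p" "\<And>i. i \<in> I \<Longrightarrow> f i \<in> CF"
  shows "v (\<Sum>i\<in>I. f i) = (\<Sum>i\<in>I. v (f i))"
  using assms(2)
  by (induction I rule: infinite_finite_induct)
    (auto simp: tangent_apply_zero[OF assms(1)] tangent_apply_add[OF assms(1)] smooth_sum)

lemma tangent_apply_diff:
  assumes "v \<in> TM p" "f \<in> CF" "g \<in> CF"
  shows "v (f - g) = v f - v g"
  using tangent_apply_add[OF assms(1) smooth_diff[OF assms(2,3)] assms(3)] by simp

lemma vfields_tangent: "X \<in> VF \<Longrightarrow> X p \<in> TM p"
  and vfields_smooth: "X \<in> VF \<Longrightarrow> f \<in> CF \<Longrightarrow> (\<lambda>p. X p f) \<in> CF"
  by (auto simp: vfields_def)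

lemma vfields_zero: "0 \<in> VF"
  using smooth_zero tangent_zero by (simp add: vfields_def zero_fun_def)

lemma vfields_add: "X \<in> VF \<Longrightarrow> Y \<in> VF \<Longrightarrow> X + Y \<in> VF"
  using smooth_add tangent_add by (auto simp: vfields_def plus_fun_def)

lemma vfields_fscale:
  assumes "f \<in> CF" "X \<in> VF"
  shows "fscale f X \<in> VF"
proof -
  have "(\<lambda>p. f p * X p g) \<in> CF" if "g \<in> CF" for g
    using smooth_mult[OF assms(1) vfields_smooth[OF assms(2) that]] by (simp add: times_fun_def)
  then show ?thesis
    using assms(2) by (auto simp: vfields_def fscale_def intro: tangent_scale)
qed

lemma fscale_minus_one: "fscale (\<lambda>_. - 1) X = - X"
  by (auto simp: fscale_def fun_eq_iff)

lemma vfields_uminus: "X \<in> VF \<Longrightarrow> - X \<in> VF"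
  using vfields_fscale[OF smooth_const[of "-1"]] by (simp add: fscale_minus_one)

lemma vfields_diff: "X \<in> VF \<Longrightarrow> Y \<in> VF \<Longrightarrow> X - Y \<in> VF"
  using vfields_add[OF _ vfields_uminus] by (metis diff_conv_add_uminus)

lemma vfields_sum: "(\<And>i. i \<in> I \<Longrightarrow> X i \<in> VF) \<Longrightarrow> (\<Sum>i\<in>I. X i) \<in> VF"
  by (induction I rule: infinite_finite_induct) (auto intro: vfields_add vfields_zero)


subsection \<open>Extension by zero and local frames\<close>

lemma extension_by_zero_smooth:
  fixes h :: "'e \<Rightarrow> real"
  assumes U: "(U, x) \<in> A" and h: "smooth_on (x ` U) h" and K: "cball c r \<subseteq> x ` U"
    and out: "\<And>y. y \<notin> cball c r \<Longrightarrow> h y = 0"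
  shows "(\<lambda>q. if q \<in> U then h (x q) else 0) \<in> CF" (is "?h \<in> _")
proof -
  \<comment> \<open>The Hausdorff property enters here: the compact set \<open>?K\<close> is closed in the whole manifold.\<close>
  let ?K = "inv_into U x ` cball c r"
  have "compact ?K"
    using chart_homeo[OF U] K
    by (intro compact_continuous_image) (auto simp: homeomorphism_def elim: continuous_on_subset)
  then have cl: "open (- ?K)" by (simp add: compact_imp_closed open_Compl)
  have "smooth_on (y ` V) (?h \<circ> inv_into V y)" if V: "(V, y) \<in> A" for V y
  proof (rule smooth_on_local)
    fix z assume z: "z \<in> y ` V"
    define q where "q = inv_into V y z"
    have q: "q \<in> V" "y q = z" using chart_inverse[OF V] z by (auto simp: q_def)
    show "\<exists>T. open T \<and> z \<in> T \<and> smooth_on T (?h \<circ> inv_into V y)"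
    proof (cases "q \<in> U")
      case True
      let ?T = "y ` (V \<inter> U)"
      have T: "open ?T" by (rule chart_open_image[OF V open_domain[OF U]])
      have "smooth_on ?T (\<lambda>z. h ((x \<circ> inv_into V y) z))"
        by (rule smooth_on_compose[OF T open_range[OF U] _ transition_smooth[OF V U] h])
          (use chart_inverse[OF V] in auto)
      then have "smooth_on ?T (?h \<circ> inv_into V y)"
        by (rule smooth_on_cong[OF _ T]) (use chart_inverse[OF V] in auto)
      then show ?thesis using T q True by blast
    next
      case False
      let ?T = "y ` (V \<inter> - ?K)"
      have T: "open ?T" by (rule chart_open_image[OF V cl])
      have "(?h \<circ> inv_into V y) w = 0" if "w \<in> ?T" for w
      proof -
        obtain s where s: "s \<in> V" "s \<notin> ?K" "w = y s" using \<open>w \<in> ?T\<close> by auto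
        have "h (x s) = 0" if "s \<in> U"
        proof (rule out, rule)
          assume "x s \<in> cball c r"
          then have "inv_into U x (x s) \<in> ?K" by (rule imageI)
          with s(2) chart_inverse(1)[OF U that] show False by simp
        qed
        then show ?thesis using s chart_inverse[OF V] by simp
      qed
      then have "smooth_on ?T (?h \<circ> inv_into V y)"
        by (intro smooth_on_cong[OF smooth_on_const[OF T, of 0] T]) simp
      moreover have "q \<notin> ?K" using False K chart_inverse[OF U] by auto
      ultimately show ?thesis using T q by blast
    qed
  qed
  then show ?thesis by (auto simp: smooth_funs_def)
qed

text \<open>Where \<open>\<beta> \<noteq> 0\<close> there are coordinates \<open>x\<^sub>i\<close> with \<open>\<xi> i = \<beta> x\<^sub>i\<close> and \<open>E i = \<beta> \<partial>\<^sub>i\<close>, and the formula is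
  \<open>v f = \<Sum>\<^sub>i v(x\<^sub>i) \<partial>\<^sub>i f\<close> with the denominators cleared: \<open>\<beta> v(\<xi> i) - (\<xi> i) v(\<beta>) = \<beta>\<^sup>2 v(x\<^sub>i)\<close>.  In this
  form it involves only globally defined smooth objects and holds at every point of the manifold.
  For its proof, Hadamard's lemma expands \<open>\<beta>\<^sup>2 f\<close>, and \<open>v\<close> is applied to the expansion.\<close>

lemma local_frame:
  obtains \<beta> :: "'a \<Rightarrow> real" and \<xi> :: "'e \<Rightarrow> 'a \<Rightarrow> real" and E :: "'e \<Rightarrow> 'a vfield" where
    "\<beta> \<in> CF" "\<beta> p \<noteq> 0" "\<And>i. \<xi> i \<in> CF" "\<And>i. E i \<in> VF"
    "\<And>q v f. v \<in> TM q \<Longrightarrow> f \<in> CF \<Longrightarrow>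
       \<beta> q ^ 3 * v f = (\<Sum>i\<in>Basis. (\<beta> q * v (\<xi> i) - \<xi> i q * v \<beta>) * E i q f)"
proof -
  obtain U x where U: "(U, x) \<in> A" "p \<in> U" by (rule chart_at)
  obtain e where e: "e > 0" "cball (x p) e \<subseteq> x ` U"
    using open_range[OF U(1)] U(2) open_contains_cball by (metis imageI)
  define r where "r = e / 2"
  have r: "r > 0" "r < e" using e(1) by (auto simp: r_def)
  define W where "W = ball (x p) e"
  have W: "open W" "convex W" "W \<subseteq> x ` U" "cball (x p) r \<subseteq> W" "cball (x p) r \<subseteq> x ` U"
    using e(2) r by (auto simp: W_def)
  obtain b :: "'e \<Rightarrow> real" where b: "smooth_on UNIV b" "\<And>y. b y \<noteq> 0 \<longleftrightarrow> y \<in> ball (x p) r"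
    using smooth_bump_exists[OF r(1)] by metis
  have b0: "b y = 0" if "y \<notin> cball (x p) r" for y using b(2)[of y] that by auto
  note bU = smooth_on_mono[OF b(1) subset_UNIV, of "x ` U"]
  define ext where "ext h q = (if q \<in> U then h (x q) else 0)" for h :: "'e \<Rightarrow> real" and q
  have ext: "ext h \<in> CF" if "smooth_on (x ` U) h" "\<And>y. b y = 0 \<Longrightarrow> h y = 0" for h
    unfolding ext_def by (rule extension_by_zero_smooth[OF U(1) that(1) W(5)]) (use that(2) b0 in auto)
  define \<beta> where "\<beta> = ext b"
  define \<xi> where "\<xi> i = ext (\<lambda>y. b y * (y \<bullet> i))" for i
  define loc where "loc f = f \<circ> inv_into U x" for f :: "'a \<Rightarrow> real"
  define E where "E i q f = (if f \<in> CF
    then ext (\<lambda>y. b y * frechet_derivative (loc f) (at y) i) q else 0)" for i q f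
  have loc: "smooth_on (x ` U) (loc f)" if "f \<in> CF" for f
    using smooth_funsD[OF that U(1)] by (simp add: loc_def)
  have \<beta>: "\<beta> \<in> CF" unfolding \<beta>_def by (rule ext[OF bU])
  have \<xi>: "\<xi> i \<in> CF" for i
    unfolding \<xi>_def
    by (intro ext smooth_on_mult[OF open_range[OF U(1)] bU]
        smooth_on_mono[OF smooth_on_inner_left subset_UNIV]) auto
  have E: "E i \<in> VF" for i
  proof -
    have D: "frechet_derivative (loc f) (at (x q)) = D"
      if "q \<in> U" "(loc f has_derivative D) (at (x q))" for f q D
      using frechet_derivative_at[OF that(2)] by simp
    have d: "(loc f has_derivative frechet_derivative (loc f) (at (x q))) (at (x q))"
      if "f \<in> CF" "q \<in> U" for f q
      using smooth_on_has_derivative[OF loc[OF that(1)]] that(2) by simp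
    have lq: "loc f (x q) = f q" if "q \<in> U" for f q
      using that chart_inverse[OF U(1)] by (simp add: loc_def)
    have 1: "E i q (\<lambda>s. f s + g s) = E i q f + E i q g" if fg: "f \<in> CF" "g \<in> CF" for q f g
    proof -
      have "(loc (\<lambda>s. f s + g s) has_derivative (\<lambda>v. frechet_derivative (loc f) (at (x q)) v
          + frechet_derivative (loc g) (at (x q)) v)) (at (x q))" if "q \<in> U"
        using has_derivative_add[OF d[OF fg(1) that] d[OF fg(2) that]] by (simp add: loc_def o_def)
      from D[OF _ this] smooth_add[OF fg] show ?thesis
        using fg by (auto simp: E_def ext_def plus_fun_def algebra_simps)
    qed
    have 2: "E i q (\<lambda>s. c * f s) = c * E i q f" if f: "f \<in> CF" for q f c
    proof -
      have "(loc (\<lambda>s. c * f s) has_derivative (\<lambda>v. c * frechet_derivative (loc f) (at (x q)) v)) (at (x q))"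
        if "q \<in> U"
        using has_derivative_mult_right[OF d[OF f that]] by (simp add: loc_def o_def)
      from D[OF _ this] smooth_mult[OF smooth_const f, of c] show ?thesis
        using f by (auto simp: E_def ext_def times_fun_def algebra_simps)
    qed
    have 3: "E i q (\<lambda>s. f s * g s) = f q * E i q g + g q * E i q f"
      if fg: "f \<in> CF" "g \<in> CF" for q f g
    proof -
      have "(loc (\<lambda>s. f s * g s) has_derivative (\<lambda>v. f q * frechet_derivative (loc g) (at (x q)) v
          + frechet_derivative (loc f) (at (x q)) v * g q)) (at (x q))" if "q \<in> U"
        using has_derivative_mult[OF d[OF fg(1) that] d[OF fg(2) that]] unfolding lq[OF that]
        by (simp add: loc_def o_def)
      from D[OF _ this] smooth_mult[OF fg] show ?thesis
        using fg by (auto simp: E_def ext_def times_fun_def algebra_simps)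
    qed
    have 4: "(\<lambda>q. E i q f) \<in> CF" if f: "f \<in> CF" for f
    proof -
      have "ext (\<lambda>y. b y * frechet_derivative (loc f) (at y) i) \<in> CF"
        by (intro ext smooth_on_mult[OF open_range[OF U(1)] bU] smooth_on_frechet_derivative loc f) auto
      then show ?thesis using f by (simp add: E_def)
    qed
    show ?thesis using 1 2 3 4 by (auto simp: vfields_def tangent_space_def E_def)
  qed
  have "\<beta> q ^ 3 * v f = (\<Sum>i\<in>Basis. (\<beta> q * v (\<xi> i) - \<xi> i q * v \<beta>) * E i q f)"
    if v: "v \<in> TM q" and f: "f \<in> CF" for q v f
  proof (cases "\<beta> q = 0")
    case True
    then have "E i q f = 0" for i by (auto simp: E_def \<beta>_def ext_def)
    with True show ?thesis by simp
  next
    case False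
    then have q: "q \<in> U" "x q \<in> W"
      using b(2)[of "x q"] W(4) by (auto simp: \<beta>_def ext_def split: if_splits)
    let ?y = "x q"
    obtain g where g: "\<And>i. smooth_on W (g i)" "\<And>i. g i ?y = frechet_derivative (loc f) (at ?y) i"
      "\<And>y. y \<in> W \<Longrightarrow> loc f y = loc f ?y + (\<Sum>i\<in>Basis. ((y - ?y) \<bullet> i) * g i y)"
      using Hadamard[OF W(1,2) q(2) smooth_on_mono[OF loc[OF f] W(3)]] by blast
    define G where "G i = ext (\<lambda>y. if y \<in> W then b y * g i y else 0)" for i
    have G: "G i \<in> CF" for i
      unfolding G_def
    proof (rule ext)
      show "smooth_on (x ` U) (\<lambda>y. if y \<in> W then b y * g i y else 0)"
      proof (rule smooth_on_local)
        fix y assume "y \<in> x ` U"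
        show "\<exists>T. open T \<and> y \<in> T \<and> smooth_on T (\<lambda>y. if y \<in> W then b y * g i y else 0)"
        proof (cases "y \<in> W")
          case True
          have "smooth_on W (\<lambda>y. b y * g i y)"
            by (rule smooth_on_mult[OF W(1) smooth_on_mono[OF b(1) subset_UNIV] g(1)])
          then have "smooth_on W (\<lambda>y. if y \<in> W then b y * g i y else 0)"
            by (rule smooth_on_cong[OF _ W(1)]) auto
          with True W(1) show ?thesis by blast
        next
          case False
          have o: "open (- cball (x p) r)" by (simp add: open_Compl)
          have "smooth_on (- cball (x p) r) (\<lambda>y. if y \<in> W then b y * g i y else 0)"
            by (rule smooth_on_cong[OF smooth_on_const[OF o, of 0] o]) (use b0 in auto)
          moreover have "y \<in> - cball (x p) r" using False W(4) by blast
          ultimately show ?thesis using o by blast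
        qed
      qed
    qed auto
    \<comment> \<open>Hadamard's expansion, multiplied by \<open>\<beta>\<^sup>2\<close> to extend it over the whole manifold.\<close>
    have id: "(\<beta> * \<beta>) * f = (\<lambda>_. f q) * (\<beta> * \<beta>) + (\<Sum>i\<in>Basis. (\<xi> i - (\<lambda>_. ?y \<bullet> i) * \<beta>) * G i)"
    proof
      fix s
      have fs: "b (x s) * b (x s) * f s = f q * (b (x s) * b (x s)) +
          (\<Sum>i\<in>Basis. (b (x s) * (x s \<bullet> i) - (?y \<bullet> i) * b (x s)) * (b (x s) * g i (x s)))"
        if "s \<in> U" "x s \<in> W"
      proof -
        have "f s = f q + (\<Sum>i\<in>Basis. ((x s - ?y) \<bullet> i) * g i (x s))"
          using g(3)[OF that(2)] chart_inverse[OF U(1)] that(1) q(1) by (simp add: loc_def)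
        then show ?thesis
          by (simp add: algebra_simps sum_distrib_left inner_diff_left flip: sum.distrib)
      qed
      have "b (x s) = 0" if "x s \<notin> W" using b0 W(4) that by blast
      with fs show "((\<beta> * \<beta>) * f) s = ((\<lambda>_. f q) * (\<beta> * \<beta>) + (\<Sum>i\<in>Basis. (\<xi> i - (\<lambda>_. ?y \<bullet> i) * \<beta>) * G i)) s"
        by (cases "s \<in> U"; cases "x s \<in> W") (auto simp: sum_fun_apply \<beta>_def \<xi>_def G_def ext_def)
    qed
    note va = tangent_apply_add[OF v] tangent_apply_scale[OF v] tangent_apply_mult[OF v]
      tangent_apply_diff[OF v] tangent_apply_sum[OF v]
    note S = smooth_intros \<beta> \<xi> G f
    have Gq: "G i q = \<beta> q * frechet_derivative (loc f) (at ?y) i" for i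
      using q g(2) by (simp add: G_def \<beta>_def ext_def)
    have \<xi>q: "\<xi> i q = \<beta> q * (?y \<bullet> i)" for i
      using q by (simp add: \<xi>_def \<beta>_def ext_def)
    \<comment> \<open>In the Leibniz rule only one term survives, since \<open>\<xi> i - x\<^sub>i(q) \<beta>\<close> vanishes at \<open>q\<close>.\<close>
    have v_summand: "v ((\<xi> i - (\<lambda>_. ?y \<bullet> i) * \<beta>) * G i) = G i q * (v (\<xi> i) - (?y \<bullet> i) * v \<beta>)" for i
      by (simp add: va S \<xi>q)
    have "v ((\<beta> * \<beta>) * f) = \<beta> q * \<beta> q * v f + f q * v (\<beta> * \<beta>)"
      by (simp add: va(3)[OF smooth_mult[OF \<beta> \<beta>] f])
    moreover have "v ((\<beta> * \<beta>) * f) = f q * v (\<beta> * \<beta>) + (\<Sum>i\<in>Basis. G i q * (v (\<xi> i) - (?y \<bullet> i) * v \<beta>))"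
      unfolding id
      by (subst va(1), (intro S)+, subst va(2), (intro S)+, subst va(5), (intro S)+) (simp add: v_summand)
    ultimately have "\<beta> q * \<beta> q * v f = (\<Sum>i\<in>Basis. G i q * (v (\<xi> i) - (?y \<bullet> i) * v \<beta>))" by linarith
    then have "\<beta> q * (\<beta> q * \<beta> q * v f) = \<beta> q * (\<Sum>i\<in>Basis. G i q * (v (\<xi> i) - (?y \<bullet> i) * v \<beta>))" by simp
    moreover have "E i q f = G i q" for i
      using f q by (simp add: E_def Gq ext_def \<beta>_def)
    ultimately show ?thesis
      by (simp add: power3_eq_cube sum_distrib_left \<xi>q algebra_simps)
  qed
  moreover have "\<beta> p \<noteq> 0" using b(2)[of "x p"] r U by (simp add: \<beta>_def ext_def)
  ultimately show ?thesis using that \<beta> \<xi> E by blast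
qed

end


section \<open>Tensor fields as multilinear maps over the smooth functions\<close>

lemma symmetric_if_adjacent_swaps:
  assumes swap: "\<And>xs u v ys. set (xs @ u # v # ys) \<subseteq> S \<Longrightarrow> F (xs @ u # v # ys) = F (xs @ v # u # ys)"
    and "set Xs \<subseteq> S" "mset Ys = mset Xs"
  shows "F Ys = F Xs"
  using assms
proof (induction Xs arbitrary: F Ys)
  case (Cons v Xs)
  have "v \<in> set Ys" using Cons.prems(3) by (metis list.set_intros(1) set_mset_mset)
  then obtain as bs where Ys: "Ys = as @ v # bs" by (meson split_list)
  have S: "set (as @ v # bs) \<subseteq> S" using Cons.prems(2,3) Ys by (metis set_mset_mset)
  have front: "G (as @ v # bs) = G (v # as @ bs)"
    if "\<And>xs u v ys. set (xs @ u # v # ys) \<subseteq> S \<Longrightarrow> G (xs @ u # v # ys) = G (xs @ v # u # ys)"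
      "set (as @ v # bs) \<subseteq> S" for as and G :: "'a list \<Rightarrow> 'b"
    using that
  proof (induction as arbitrary: G)
    case (Cons a as)
    have "G (a # as @ v # bs) = G (a # v # as @ bs)"
      using Cons.prems(2) Cons.prems(1)[of "a # _"] by (intro Cons.IH[of "\<lambda>xs. G (a # xs)"]) auto
    also have "\<dots> = G (v # a # as @ bs)"
      using Cons.prems(1)[of "[]" a v "as @ bs"] Cons.prems(2) by auto
    finally show ?case by simp
  qed simp
  have "F (v # as @ bs) = F (v # Xs)"
  proof (rule Cons.IH[of "\<lambda>xs. F (v # xs)"])
    fix xs a b ys assume "set (xs @ a # b # ys) \<subseteq> S"
    then show "F (v # xs @ a # b # ys) = F (v # xs @ b # a # ys)"
      using Cons.prems(1)[of "v # xs" a b ys] Cons.prems(2) by auto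
  qed (use Cons.prems Ys in auto)
  moreover have "F (as @ v # bs) = F (v # as @ bs)"
    by (rule front[of F as, OF _ S]) (rule Cons.prems(1))
  ultimately show ?case using Ys by simp
qed simp

lemma mset_list_update:
  assumes "i < length vs"
  shows "mset (vs[i := v]) = mset (v # take i vs @ drop (Suc i) vs)"
  using assms by (simp add: upd_conv_take_nth_drop)

text \<open>Symmetry moves any slot to the front, so linearity has to be checked in the first slot only.\<close>
lemma sym_form_iff:
  "sym_form A p r B \<longleftrightarrow>
    (\<forall>vs v w. Suc (length vs) = r \<and> set vs \<subseteq> tangent_space A p \<and> v \<in> tangent_space A p \<and>
       w \<in> tangent_space A p \<longrightarrow> B ((v + w) # vs) = B (v # vs) + B (w # vs)) \<and>
    (\<forall>vs v c. Suc (length vs) = r \<and> set vs \<subseteq> tangent_space A p \<and> v \<in> tangent_space A p \<longrightarrow>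
       B ((\<lambda>f. c * v f) # vs) = c * B (v # vs)) \<and>
    (\<forall>vs ws. length vs = r \<and> set vs \<subseteq> tangent_space A p \<and> mset ws = mset vs \<longrightarrow> B ws = B vs) \<and>
    (\<forall>vs. \<not> (length vs = r \<and> set vs \<subseteq> tangent_space A p) \<longrightarrow> B vs = 0)"
  (is "_ \<longleftrightarrow> ?a \<and> ?s \<and> ?m \<and> ?z")
proof (intro iffI conjI)
  assume *: "sym_form A p r B"
  show ?m ?z using * unfolding sym_form_def by blast+
  have "B ((v + w) # vs) = B (v # vs) + B (w # vs)"
    if "Suc (length vs) = r" "set vs \<subseteq> tangent_space A p" "v \<in> tangent_space A p" "w \<in> tangent_space A p" for vs v w
  proof -
    have "length (v # vs) = r \<and> set (v # vs) \<subseteq> tangent_space A p \<and> 0 < r \<and>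
        v \<in> tangent_space A p \<and> w \<in> tangent_space A p" using that by auto
    then have "B ((v # vs)[0 := v + w]) = B ((v # vs)[0 := v]) + B ((v # vs)[0 := w])"
      using * unfolding sym_form_def by blast
    then show ?thesis by simp
  qed
  then show ?a by blast
  have "B ((\<lambda>f. c * v f) # vs) = c * B (v # vs)"
    if "Suc (length vs) = r" "set vs \<subseteq> tangent_space A p" "v \<in> tangent_space A p" for vs v c
  proof -
    have "length (v # vs) = r \<and> set (v # vs) \<subseteq> tangent_space A p \<and> 0 < r \<and> v \<in> tangent_space A p"
      using that by auto
    then have "B ((v # vs)[0 := (\<lambda>f. c * v f)]) = c * B ((v # vs)[0 := v])"
      using * unfolding sym_form_def by blast
    then show ?thesis by simp
  qed
  then show ?s by blast
next
  assume *: "?a \<and> ?s \<and> ?m \<and> ?z"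
  then have m: ?m and z: ?z by blast+
  have upd: "B (vs[i := v]) = B (v # take i vs @ drop (Suc i) vs)" (is ?e)
    and rest: "set (take i vs @ drop (Suc i) vs) \<subseteq> tangent_space A p" (is ?r)
      "Suc (length (take i vs @ drop (Suc i) vs)) = r" (is ?l)
    if "length vs = r" "set vs \<subseteq> tangent_space A p" "i < r" for vs i v
  proof -
    show ?r using that(2) set_take_subset set_drop_subset by fastforce
    show ?l using that by auto
    show ?e
    proof (cases "v \<in> tangent_space A p")
      case True
      then have "length (v # take i vs @ drop (Suc i) vs) = r \<and>
          set (v # take i vs @ drop (Suc i) vs) \<subseteq> tangent_space A p"
        using \<open>?r\<close> \<open>?l\<close> by auto
      then show ?thesis
        by (intro m[rule_format] conjI mset_list_update) (use that in auto)
    next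
      case False
      have "v \<in> set (vs[i := v])" using that by (simp add: set_update_memI)
      then have "\<not> set (vs[i := v]) \<subseteq> tangent_space A p" using False by blast
      then have "B (vs[i := v]) = 0" using z by blast
      moreover have "B (v # take i vs @ drop (Suc i) vs) = 0" using z False by simp
      ultimately show ?thesis by simp
    qed
  qed
  show "sym_form A p r B"
    unfolding sym_form_def
  proof (intro conjI allI impI; (elim conjE)?)
    fix vs i v w
    assume h: "length vs = r" "set vs \<subseteq> tangent_space A p" "i < r" "v \<in> tangent_space A p" "w \<in> tangent_space A p"
    show "B (vs[i := v + w]) = B (vs[i := v]) + B (vs[i := w])"
      unfolding upd[OF h(1-3)] using * rest[OF h(1-3)] h(4,5) by blast
  next
    fix vs i v c
    assume h: "length vs = r" "set vs \<subseteq> tangent_space A p" "i < r" "v \<in> tangent_space A p"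
    show "B (vs[i := \<lambda>f. c * v f]) = c * B (vs[i := v])"
      unfolding upd[OF h(1-3)] using * rest[OF h(1-3)] h(4) by blast
  qed (use * in blast)+
qed

lemma component_apply: "component r \<Phi> p vs = (if length vs = r then \<Phi> p vs else 0)"
  by (simp add: component_def)

lemma at_fields_Cons: "at_fields \<Phi> (X # Xs) = (\<lambda>p. \<Phi> p (X p # map (\<lambda>X. X p) Xs))"
  by (simp add: at_fields_def)

lemma at_fields_contraction: "at_fields (contraction X \<Phi>) Xs = at_fields \<Phi> (X # Xs)"
  by (simp add: at_fields_def contraction_def)

lemma Upsilon_sumD:
  assumes "\<Phi> \<in> Upsilon_sum A"
  shows Upsilon_sum_add: "set vs \<subseteq> tangent_space A p \<Longrightarrow> v \<in> tangent_space A p \<Longrightarrow> w \<in> tangent_space A p \<Longrightarrow>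
      \<Phi> p ((v + w) # vs) = \<Phi> p (v # vs) + \<Phi> p (w # vs)"
    and Upsilon_sum_scale: "set vs \<subseteq> tangent_space A p \<Longrightarrow> v \<in> tangent_space A p \<Longrightarrow>
      \<Phi> p ((\<lambda>f. c * v f) # vs) = c * \<Phi> p (v # vs)"
    and Upsilon_sum_sym: "mset ws = mset vs \<Longrightarrow> \<Phi> p ws = \<Phi> p vs"
    and Upsilon_sum_outside: "\<not> set vs \<subseteq> tangent_space A p \<Longrightarrow> \<Phi> p vs = 0"
    and Upsilon_sum_smooth: "set Xs \<subseteq> vfields A \<Longrightarrow> at_fields \<Phi> Xs \<in> smooth_funs A"
    and Upsilon_sum_bounded: "\<exists>N. \<forall>p vs. N \<le> length vs \<longrightarrow> \<Phi> p vs = 0"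
proof -
  have c: "sym_form A p r (component r \<Phi> p)" for p r
    using assms by (auto simp: Upsilon_sum_def Upsilon_def)
  note c1 = c[unfolded sym_form_iff, THEN conjunct1]
    and c2 = c[unfolded sym_form_iff, THEN conjunct2, THEN conjunct1]
    and c3 = c[unfolded sym_form_iff, THEN conjunct2, THEN conjunct2, THEN conjunct1]
    and c4 = c[unfolded sym_form_iff, THEN conjunct2, THEN conjunct2, THEN conjunct2]
  show "set vs \<subseteq> tangent_space A p \<Longrightarrow> v \<in> tangent_space A p \<Longrightarrow> w \<in> tangent_space A p \<Longrightarrow>
      \<Phi> p ((v + w) # vs) = \<Phi> p (v # vs) + \<Phi> p (w # vs)"
    using c1[of "Suc (length vs)" p] by (simp add: component_apply)
  show "set vs \<subseteq> tangent_space A p \<Longrightarrow> v \<in> tangent_space A p \<Longrightarrow>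
      \<Phi> p ((\<lambda>f. c * v f) # vs) = c * \<Phi> p (v # vs)"
    using c2[of "Suc (length vs)" p] by (simp add: component_apply)
  show out: "\<not> set vs \<subseteq> tangent_space A p \<Longrightarrow> \<Phi> p vs = 0" for p vs
    using c4[of "length vs" p] by (auto simp: component_apply)
  show "mset ws = mset vs \<Longrightarrow> \<Phi> p ws = \<Phi> p vs"
    using c3[of "length vs" p, rule_format, of vs ws] out[of vs p] out[of ws p] mset_eq_length[of ws vs] mset_eq_setD[of ws vs]
    by (cases "set vs \<subseteq> tangent_space A p") (auto simp: component_apply)
  show "set Xs \<subseteq> vfields A \<Longrightarrow> at_fields \<Phi> Xs \<in> smooth_funs A"
  proof -
    assume "set Xs \<subseteq> vfields A"
    then have "at_fields (component (length Xs) \<Phi>) Xs \<in> smooth_funs A"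
      using assms by (auto simp: Upsilon_sum_def Upsilon_def)
    then show ?thesis by (simp add: at_fields_def component_def)
  qed
  have "finite {r. component r \<Phi> \<noteq> 0}" using assms by (simp add: Upsilon_sum_def)
  then obtain N where N: "{r. component r \<Phi> \<noteq> 0} \<subseteq> {..<N}" using finite_nat_bounded by blast
  have "\<Phi> p vs = 0" if "N \<le> length vs" for p vs
  proof -
    have "component (length vs) \<Phi> = 0" using N that by (meson leD lessThan_iff mem_Collect_eq subsetD)
    then have "component (length vs) \<Phi> p vs = 0" by simp
    then show ?thesis by (simp add: component_apply)
  qed
  then show "\<exists>N. \<forall>p vs. N \<le> length vs \<longrightarrow> \<Phi> p vs = 0" by blast
qed

lemma Upsilon_sum_memI:
  assumes "\<And>p vs v w. set vs \<subseteq> tangent_space A p \<Longrightarrow> v \<in> tangent_space A p \<Longrightarrow> w \<in> tangent_space A p \<Longrightarrow>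
      \<Phi> p ((v + w) # vs) = \<Phi> p (v # vs) + \<Phi> p (w # vs)"
    and "\<And>p vs v c. set vs \<subseteq> tangent_space A p \<Longrightarrow> v \<in> tangent_space A p \<Longrightarrow>
      \<Phi> p ((\<lambda>f. c * v f) # vs) = c * \<Phi> p (v # vs)"
    and "\<And>p vs ws. set vs \<subseteq> tangent_space A p \<Longrightarrow> mset ws = mset vs \<Longrightarrow> \<Phi> p ws = \<Phi> p vs"
    and "\<And>p vs. \<not> set vs \<subseteq> tangent_space A p \<Longrightarrow> \<Phi> p vs = 0"
    and "\<And>Xs. set Xs \<subseteq> vfields A \<Longrightarrow> at_fields \<Phi> Xs \<in> smooth_funs A"
    and "0 \<in> smooth_funs A"
    and "\<And>p vs. N \<le> length vs \<Longrightarrow> \<Phi> p vs = 0"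
  shows "\<Phi> \<in> Upsilon_sum A"
proof -
  have "component r \<Phi> \<in> Upsilon A r" for r
  proof -
    have "sym_form A p r (component r \<Phi> p)" for p
      unfolding sym_form_iff component_apply
    proof (intro conjI allI impI; (elim conjE)?)
      fix vs ws assume "length vs = r" "set vs \<subseteq> tangent_space A p" "mset ws = mset vs"
      then show "(if length ws = r then \<Phi> p ws else 0) = (if length vs = r then \<Phi> p vs else 0)"
        using assms(3)[of vs p ws] mset_eq_length[of ws vs] by simp
    qed (use assms(1,2,4) in auto)
    moreover have "at_fields (component r \<Phi>) Xs \<in> smooth_funs A" if "length Xs = r" "set Xs \<subseteq> vfields A" for Xs
      using assms(5)[OF that(2)] that(1) by (simp add: at_fields_def component_def)
    ultimately show ?thesis by (simp add: Upsilon_def)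
  qed
  moreover have "component r \<Phi> = 0" if "N \<le> r" for r
    using assms(7) that by (auto simp: component_def fun_eq_iff)
  then have "{r. component r \<Phi> \<noteq> 0} \<subseteq> {..<N}"
    by (metis (mono_tags, lifting) lessThan_iff linorder_not_le mem_Collect_eq subsetI)
  ultimately show ?thesis
    by (auto simp: Upsilon_sum_def intro: finite_subset)
qed

lemma Upsilon_iff:
  assumes "0 \<in> smooth_funs A"
  shows "\<phi> \<in> Upsilon A r \<longleftrightarrow> \<phi> \<in> Upsilon_sum A \<and> (\<forall>p vs. length vs \<noteq> r \<longrightarrow> \<phi> p vs = 0)"
proof
  assume *: "\<phi> \<in> Upsilon A r"
  then have z: "\<phi> p vs = 0" if "length vs \<noteq> r" for p vs
    using that by (auto simp: Upsilon_def sym_form_def)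
  have 0: "0 \<in> Upsilon A s" for s
    using assms by (auto simp: Upsilon_def sym_form_def at_fields_def zero_fun_def)
  have c: "component s \<phi> = (if s = r then \<phi> else 0)" for s
    using z by (auto simp: component_def fun_eq_iff)
  have "{s. component s \<phi> \<noteq> 0} \<subseteq> {r}" by (auto simp: c)
  then have "\<phi> \<in> Upsilon_sum A"
    using * 0 by (auto simp: Upsilon_sum_def c intro: finite_subset)
  with z show "\<phi> \<in> Upsilon_sum A \<and> (\<forall>p vs. length vs \<noteq> r \<longrightarrow> \<phi> p vs = 0)" by blast
next
  assume *: "\<phi> \<in> Upsilon_sum A \<and> (\<forall>p vs. length vs \<noteq> r \<longrightarrow> \<phi> p vs = 0)"
  then have "component r \<phi> = \<phi>" by (auto simp: component_def fun_eq_iff)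
  with * show "\<phi> \<in> Upsilon A r" by (auto simp: Upsilon_sum_def) metis
qed

definition act :: "'a vfield \<Rightarrow> ('a \<Rightarrow> real) \<Rightarrow> 'a \<Rightarrow> real" where
  "act X f = (\<lambda>p. X p f)"

context smooth_manifold
begin

abbreviation fields :: "'a vfield list \<Rightarrow> bool" where
  "fields Xs \<equiv> set Xs \<subseteq> VF"

text \<open>Linearity is required in the first slot only; symmetry carries it to the others.\<close>

definition tensorial :: "('a vfield list \<Rightarrow> 'a \<Rightarrow> real) \<Rightarrow> bool" where
  "tensorial F \<longleftrightarrow>
     (\<forall>Xs. fields Xs \<longrightarrow> F Xs \<in> CF) \<and>
     (\<forall>X\<in>VF. \<forall>Y\<in>VF. \<forall>Zs. fields Zs \<longrightarrow> F ((X + Y) # Zs) = F (X # Zs) + F (Y # Zs)) \<and>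
     (\<forall>f\<in>CF. \<forall>X\<in>VF. \<forall>Zs. fields Zs \<longrightarrow> F (fscale f X # Zs) = f * F (X # Zs)) \<and>
     (\<forall>Xs Ys. fields Xs \<and> mset Ys = mset Xs \<longrightarrow> F Ys = F Xs) \<and>
     (\<exists>N. \<forall>Xs. fields Xs \<and> N \<le> length Xs \<longrightarrow> F Xs = 0)"

lemma tensorialI:
  assumes "\<And>Xs. fields Xs \<Longrightarrow> F Xs \<in> CF"
    and "\<And>X Y Zs. X \<in> VF \<Longrightarrow> Y \<in> VF \<Longrightarrow> fields Zs \<Longrightarrow>
      F ((X + Y) # Zs) = F (X # Zs) + F (Y # Zs)"
    and "\<And>f X Zs. f \<in> CF \<Longrightarrow> X \<in> VF \<Longrightarrow> fields Zs \<Longrightarrow>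
      F (fscale f X # Zs) = f * F (X # Zs)"
    and "\<And>Xs X Y Ys. fields Xs \<Longrightarrow> X \<in> VF \<Longrightarrow> Y \<in> VF \<Longrightarrow> fields Ys \<Longrightarrow>
      F (Xs @ X # Y # Ys) = F (Xs @ Y # X # Ys)"
    and "\<exists>N. \<forall>Xs. fields Xs \<and> N \<le> length Xs \<longrightarrow> F Xs = 0"
  shows "tensorial F"
proof -
  have "F Ys = F Xs" if "fields Xs" "mset Ys = mset Xs" for Xs Ys
    by (rule symmetric_if_adjacent_swaps[OF _ that]) (use assms(4) in auto)
  then show ?thesis unfolding tensorial_def using assms(1,2,3,5) by blast
qed

lemma tensorialD:
  assumes "tensorial F"
  shows tensorial_smooth: "fields Xs \<Longrightarrow> F Xs \<in> CF"
    and tensorial_add: "X \<in> VF \<Longrightarrow> Y \<in> VF \<Longrightarrow> fields Zs \<Longrightarrow>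
      F ((X + Y) # Zs) = F (X # Zs) + F (Y # Zs)"
    and tensorial_fscale: "f \<in> CF \<Longrightarrow> X \<in> VF \<Longrightarrow> fields Zs \<Longrightarrow>
      F (fscale f X # Zs) = f * F (X # Zs)"
    and tensorial_sym: "fields Xs \<Longrightarrow> mset Ys = mset Xs \<Longrightarrow> F Ys = F Xs"
    and tensorial_bounded: "\<exists>N. \<forall>Xs. fields Xs \<and> N \<le> length Xs \<longrightarrow> F Xs = 0"
  using assms unfolding tensorial_def by (blast+)

lemma tensorial_swap:
  "tensorial F \<Longrightarrow> X \<in> VF \<Longrightarrow> Y \<in> VF \<Longrightarrow> fields Ys \<Longrightarrow> F (X # Y # Ys) = F (Y # X # Ys)"
  by (rule tensorial_sym) auto

lemma tensorial_Cons:
  assumes F: "tensorial F" and X: "X \<in> VF"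
  shows "tensorial (\<lambda>Xs. F (X # Xs))"
proof (rule tensorialI)
  fix Y Z Zs assume h: "Y \<in> VF" "Z \<in> VF" "fields Zs"
  then show "F (X # (Y + Z) # Zs) = F (X # Y # Zs) + F (X # Z # Zs)"
    using X tensorial_add[OF F h(1,2), of "X # Zs"]
    by (simp add: tensorial_swap[OF F X] vfields_add)
next
  fix f Y Zs assume h: "f \<in> CF" "Y \<in> VF" "fields Zs"
  then show "F (X # fscale f Y # Zs) = f * F (X # Y # Zs)"
    using X tensorial_fscale[OF F h(1,2), of "X # Zs"]
    by (simp add: tensorial_swap[OF F X] vfields_fscale)
next
  obtain N where N: "\<And>Xs. fields Xs \<Longrightarrow> N \<le> length Xs \<Longrightarrow> F Xs = 0"
    using tensorial_bounded[OF F] by blast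
  show "\<exists>N. \<forall>Xs. fields Xs \<and> N \<le> length Xs \<longrightarrow> F (X # Xs) = 0"
    using N X by (intro exI[of _ N]) auto
qed (rule tensorial_smooth[OF F], use X in simp, rule tensorial_sym[OF F], use X in auto)

lemma tensorial_zero_field:
  assumes "tensorial F" "fields Zs"
  shows "F (0 # Zs) = 0"
  using tensorial_fscale[OF assms(1) smooth_zero vfields_zero assms(2)]
  by (simp add: fscale_def zero_fun_def times_fun_def)

lemma tensorial_uminus:
  assumes "tensorial F" "X \<in> VF" "fields Zs"
  shows "F (- X # Zs) = - F (X # Zs)"
  using tensorial_fscale[OF assms(1) smooth_const[of "-1"] assms(2,3)]
  by (simp add: fscale_minus_one fun_eq_iff)

lemma tensorial_diff:
  assumes "tensorial F" "X \<in> VF" "Y \<in> VF" "fields Zs"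
  shows "F ((X - Y) # Zs) = F (X # Zs) - F (Y # Zs)"
  using tensorial_add[OF assms(1) assms(2) vfields_uminus[OF assms(3)] assms(4)]
    tensorial_uminus[OF assms(1,3,4)] by simp

lemma tensorial_sum:
  assumes F: "tensorial F" and Z: "fields Zs" and "\<And>i. i \<in> I \<Longrightarrow> X i \<in> VF"
  shows "F ((\<Sum>i\<in>I. X i) # Zs) = (\<Sum>i\<in>I. F (X i # Zs))"
  using assms(3)
  by (induction I rule: infinite_finite_induct)
    (auto simp: tensorial_zero_field[OF F Z] tensorial_add[OF F] vfields_sum Z)

lemma act_smooth: "X \<in> VF \<Longrightarrow> f \<in> CF \<Longrightarrow> act X f \<in> CF"
  unfolding act_def by (rule vfields_smooth)

lemma local_frame_fields:
  obtains \<beta> :: "'a \<Rightarrow> real" and \<xi> :: "'e \<Rightarrow> 'a \<Rightarrow> real" and E :: "'e \<Rightarrow> 'a vfield" where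
    "\<beta> \<in> CF" "\<beta> p \<noteq> 0" "\<And>i. \<xi> i \<in> CF" "\<And>i. E i \<in> VF"
    "\<And>X. X \<in> VF \<Longrightarrow> fscale (\<beta> * \<beta> * \<beta>) X =
       (\<Sum>i\<in>Basis. fscale (\<beta> * act X (\<xi> i) - \<xi> i * act X \<beta>) (E i))"
proof -
  obtain \<beta> and \<xi> :: "'e \<Rightarrow> 'a \<Rightarrow> real" and E where *: "\<beta> \<in> CF" "\<beta> p \<noteq> 0" "\<And>i. \<xi> i \<in> CF" "\<And>i. E i \<in> VF"
    "\<And>q v f. v \<in> TM q \<Longrightarrow> f \<in> CF \<Longrightarrow>
       \<beta> q ^ 3 * v f = (\<Sum>i\<in>Basis. (\<beta> q * v (\<xi> i) - \<xi> i q * v \<beta>) * E i q f)"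
    by (rule local_frame[of p]) (rule that)
  have "fscale (\<beta> * \<beta> * \<beta>) X = (\<Sum>i\<in>Basis. fscale (\<beta> * act X (\<xi> i) - \<xi> i * act X \<beta>) (E i))"
    if X: "X \<in> VF" for X
  proof (intro ext)
    fix q f
    have X': "X q \<in> TM q" and E': "E i q \<in> TM q" for i
      using X *(4) by (auto intro: vfields_tangent)
    show "fscale (\<beta> * \<beta> * \<beta>) X q f = (\<Sum>i\<in>Basis. fscale (\<beta> * act X (\<xi> i) - \<xi> i * act X \<beta>) (E i)) q f"
    proof (cases "f \<in> CF")
      case True
      then show ?thesis using *(5)[OF X' True]
        by (simp add: fscale_def act_def sum_fun_apply power3_eq_cube)
    next
      case False
      then show ?thesis using tangent_apply_nonsmooth[OF X'] tangent_apply_nonsmooth[OF E']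
        by (simp add: fscale_def sum_fun_apply)
    qed
  qed
  with *(1-4) that show ?thesis by blast
qed

lemma tangent_vector_extends:
  assumes v: "v \<in> TM p"
  shows "\<exists>X\<in>VF. X p = v"
proof -
  obtain \<beta> and \<xi> :: "'e \<Rightarrow> 'a \<Rightarrow> real" and E where *: "\<beta> \<in> CF" "\<beta> p \<noteq> 0" "\<And>i. \<xi> i \<in> CF" "\<And>i. E i \<in> VF"
    "\<And>q v f. v \<in> TM q \<Longrightarrow> f \<in> CF \<Longrightarrow>
       \<beta> q ^ 3 * v f = (\<Sum>i\<in>Basis. (\<beta> q * v (\<xi> i) - \<xi> i q * v \<beta>) * E i q f)"
    by (rule local_frame[of p]) (rule that)
  define c where "c i = (\<beta> p * v (\<xi> i) - \<xi> i p * v \<beta>) / \<beta> p ^ 3" for i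
  let ?X = "\<Sum>i\<in>Basis. fscale (\<lambda>_. c i) (E i)"
  have "?X \<in> VF" by (intro vfields_sum vfields_fscale smooth_const *)
  moreover have "?X p f = v f" for f
  proof (cases "f \<in> CF")
    case True
    have "?X p f = (\<Sum>i\<in>Basis. (\<beta> p * v (\<xi> i) - \<xi> i p * v \<beta>) * E i p f) / \<beta> p ^ 3"
      by (simp add: sum_fun_apply fscale_def c_def sum_divide_distrib)
    also have "\<dots> = v f" unfolding *(5)[OF v True, symmetric] using *(2) by simp
    finally show ?thesis .
  next
    case False
    have E': "E i p \<in> TM p" for i using *(4) by (rule vfields_tangent)
    show ?thesis using tangent_apply_nonsmooth[OF v False] tangent_apply_nonsmooth[OF E' False]
      by (simp add: fscale_def sum_fun_apply)
  qed
  ultimately show ?thesis by blast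
qed

lemma tangent_vectors_extend:
  assumes "set vs \<subseteq> TM p"
  shows "\<exists>Xs. fields Xs \<and> map (\<lambda>X. X p) Xs = vs"
  using assms
proof (induction vs)
  case (Cons v vs)
  then obtain X Xs where "X \<in> VF" "X p = v" "fields Xs" "map (\<lambda>X. X p) Xs = vs"
    using tangent_vector_extends by (metis list.set_intros(1) set_subset_Cons subset_code(1))
  then show ?case by (intro exI[of _ "X # Xs"]) auto
qed simp

text \<open>By the frame formula, \<open>\<beta>\<^sup>3 F(X, \<dots>)\<close> is a combination of the \<open>F(E i, \<dots>)\<close> with coefficients
  that depend on \<open>X\<close> only through its value at the point.\<close>

lemma tensorial_vanishes:
  assumes F: "tensorial F" and X: "X \<in> VF" and "X p = 0" and Z: "fields Zs"
  shows "F (X # Zs) p = 0"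
proof -
  obtain \<beta> and \<xi> :: "'e \<Rightarrow> 'a \<Rightarrow> real" and E where *: "\<beta> \<in> CF" "\<beta> p \<noteq> 0" "\<And>i. \<xi> i \<in> CF" "\<And>i. E i \<in> VF"
    "\<And>X. X \<in> VF \<Longrightarrow> fscale (\<beta> * \<beta> * \<beta>) X =
       (\<Sum>i\<in>Basis. fscale (\<beta> * act X (\<xi> i) - \<xi> i * act X \<beta>) (E i))"
    by (rule local_frame_fields[of p]) (rule that)
  have a: "\<beta> * act X (\<xi> i) - \<xi> i * act X \<beta> \<in> CF" for i
    by (intro smooth_intros act_smooth * X)
  have "(\<beta> * \<beta> * \<beta>) * F (X # Zs) = F (fscale (\<beta> * \<beta> * \<beta>) X # Zs)"
    by (rule tensorial_fscale[OF F _ X Z, symmetric]) (intro smooth_intros *)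
  also have "\<dots> = (\<Sum>i\<in>Basis. F (fscale (\<beta> * act X (\<xi> i) - \<xi> i * act X \<beta>) (E i) # Zs))"
    unfolding *(5)[OF X] by (rule tensorial_sum[OF F Z]) (intro vfields_fscale a *)
  also have "\<dots> = (\<Sum>i\<in>Basis. (\<beta> * act X (\<xi> i) - \<xi> i * act X \<beta>) * F (E i # Zs))"
    by (intro sum.cong refl tensorial_fscale[OF F a _ Z] *)
  finally have "((\<beta> * \<beta> * \<beta>) * F (X # Zs)) p = (\<Sum>i\<in>Basis. (\<beta> * act X (\<xi> i) - \<xi> i * act X \<beta>) * F (E i # Zs)) p"
    by simp
  then show ?thesis using *(2) assms(3) by (simp add: sum_fun_apply act_def)
qed

lemma tensorial_pointwise:
  assumes "tensorial F" "fields Xs" "fields Ys" "map (\<lambda>X. X p) Xs = map (\<lambda>X. X p) Ys"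
  shows "F Xs p = F Ys p"
  using assms
proof (induction Xs arbitrary: F Ys)
  case (Cons X Xs)
  then obtain Y Ys' where Y: "Ys = Y # Ys'" "X p = Y p" "map (\<lambda>X. X p) Xs = map (\<lambda>X. X p) Ys'" by auto
  have h: "X \<in> VF" "Y \<in> VF" "fields Ys'" using Cons.prems Y by auto
  have "F (X # Xs) p = F (X # Ys') p"
    using Cons.prems Y h by (intro Cons.IH[of "\<lambda>Xs. F (X # Xs)"] tensorial_Cons) auto
  moreover have "F ((X - Y) # Ys') p = 0"
    using Y(2) by (intro tensorial_vanishes Cons.prems vfields_diff h) (auto simp: fun_eq_iff)
  ultimately show ?case
    using tensorial_diff[OF Cons.prems(1) h] Y by simp
qed simp

lemma at_fields_tensorial:
  assumes "\<Phi> \<in> ST"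
  shows "tensorial (at_fields \<Phi>)"
proof (rule tensorialI)
  have T: "set (map (\<lambda>X. X p) Xs) \<subseteq> TM p" if "fields Xs" for Xs p
    using that vfields_tangent by auto
  show "at_fields \<Phi> ((X + Y) # Zs) = at_fields \<Phi> (X # Zs) + at_fields \<Phi> (Y # Zs)"
    if "X \<in> VF" "Y \<in> VF" "fields Zs" for X Y Zs
    using Upsilon_sum_add[OF assms T[OF that(3)] vfields_tangent[OF that(1)] vfields_tangent[OF that(2)]]
    by (simp add: at_fields_Cons fun_eq_iff)
  show "at_fields \<Phi> (fscale f X # Zs) = f * at_fields \<Phi> (X # Zs)"
    if "X \<in> VF" "fields Zs" for f X Zs
    using Upsilon_sum_scale[OF assms T[OF that(2)] vfields_tangent[OF that(1)]]
    by (simp add: at_fields_Cons fscale_def fun_eq_iff)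
  show "at_fields \<Phi> (Xs @ X # Y # Ys) = at_fields \<Phi> (Xs @ Y # X # Ys)" for Xs X Y Ys
    unfolding at_fields_def by (intro ext Upsilon_sum_sym[OF assms]) simp
  show "\<exists>N. \<forall>Xs. fields Xs \<and> N \<le> length Xs \<longrightarrow> at_fields \<Phi> Xs = 0"
  proof -
    obtain N where "\<And>p vs. N \<le> length vs \<Longrightarrow> \<Phi> p vs = 0" using Upsilon_sum_bounded[OF assms] by blast
    then show ?thesis by (intro exI[of _ N]) (auto simp: at_fields_def fun_eq_iff)
  qed
qed (rule Upsilon_sum_smooth[OF assms])

text \<open>Every list of tangent vectors at a point consists of values of vector fields.\<close>
lemma at_fields_inject:
  assumes "\<Phi> \<in> ST" "\<Psi> \<in> ST"
    and "\<And>Xs. fields Xs \<Longrightarrow> at_fields \<Phi> Xs = at_fields \<Psi> Xs"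
  shows "\<Phi> = \<Psi>"
proof (intro ext)
  fix p vs
  show "\<Phi> p vs = \<Psi> p vs"
  proof (cases "set vs \<subseteq> TM p")
    case True
    then obtain Xs where "fields Xs" "map (\<lambda>X. X p) Xs = vs" using tangent_vectors_extend by blast
    then show ?thesis using assms(3)[of Xs] by (auto simp: at_fields_def fun_eq_iff)
  next
    case False
    then show ?thesis using Upsilon_sum_outside assms(1,2) by metis
  qed
qed

text \<open>The tensor field is evaluated on tangent vectors by extending them to vector fields.  By pointwise
  dependence the choice of the extensions does not matter, so it may be made separately for each list.\<close>
lemma tensor_exists:
  assumes F: "tensorial F"
  shows "\<exists>\<Phi>\<in>ST. \<forall>Xs. fields Xs \<longrightarrow> at_fields \<Phi> Xs = F Xs"
proof -
  define ext where "ext p vs = (SOME Xs. fields Xs \<and> map (\<lambda>X. X p) Xs = vs)" for p :: 'a and vs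
  have ext: "fields (ext p vs)" "map (\<lambda>X. X p) (ext p vs) = vs" if "set vs \<subseteq> TM p" for p vs
    using someI_ex[OF tangent_vectors_extend[OF that]] by (auto simp: ext_def)
  have len: "length (ext p vs) = length vs" if "set vs \<subseteq> TM p" for p vs
    using arg_cong[OF ext(2)[OF that], of length] by simp
  define \<Phi> where "\<Phi> p vs = (if set vs \<subseteq> TM p then F (ext p vs) p else 0)" for p vs
  have val: "\<Phi> p (map (\<lambda>X. X p) Xs) = F Xs p" if "fields Xs" for p Xs
  proof -
    have T: "set (map (\<lambda>X. X p) Xs) \<subseteq> TM p" using that vfields_tangent by auto
    then show ?thesis using tensorial_pointwise[OF F ext(1)[OF T] that ext(2)[OF T]] by (simp add: \<Phi>_def)
  qed
  obtain N where N: "\<And>Xs. fields Xs \<Longrightarrow> N \<le> length Xs \<Longrightarrow> F Xs = 0"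
    using tensorial_bounded[OF F] by blast
  have at: "at_fields \<Phi> Xs = F Xs" if "fields Xs" for Xs
    using val[OF that] by (auto simp: at_fields_def)
  have "\<Phi> \<in> ST"
  proof (rule Upsilon_sum_memI[where N = N])
    fix p vs v w
    assume vs: "set vs \<subseteq> TM p" and v: "v \<in> TM p" and w: "w \<in> TM p"
    obtain Xs X Y where X: "fields Xs" "map (\<lambda>X. X p) Xs = vs" "X \<in> VF" "X p = v" "Y \<in> VF" "Y p = w"
      using tangent_vectors_extend[OF vs] tangent_vector_extends[OF v] tangent_vector_extends[OF w] by blast
    show "\<Phi> p ((v + w) # vs) = \<Phi> p (v # vs) + \<Phi> p (w # vs)"
      using val[of "(X + Y) # Xs" p] val[of "X # Xs" p] val[of "Y # Xs" p] X tensorial_add[OF F X(3,5,1)]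
      by (simp add: vfields_add)
  next
    fix p vs v and c :: real assume vs: "set vs \<subseteq> TM p" and v: "v \<in> TM p"
    obtain Xs X where X: "fields Xs" "map (\<lambda>X. X p) Xs = vs" "X \<in> VF" "X p = v"
      using tangent_vectors_extend[OF vs] tangent_vector_extends[OF v] by blast
    have c: "fscale (\<lambda>_. c) X p = (\<lambda>f. c * v f)" using X by (simp add: fscale_def)
    show "\<Phi> p ((\<lambda>f. c * v f) # vs) = c * \<Phi> p (v # vs)"
      using val[of "fscale (\<lambda>_. c) X # Xs" p] val[of "X # Xs" p] X tensorial_fscale[OF F smooth_const X(3,1), of c]
      by (simp add: vfields_fscale smooth_const c)
  next
    fix p vs ws assume vs: "set vs \<subseteq> TM p" and m: "mset ws = mset vs"
    obtain \<pi> where \<pi>: "\<pi> permutes {..<length vs}" "permute_list \<pi> vs = ws"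
      using mset_eq_permutation[OF m] by blast
    have \<pi>': "\<pi> permutes {..<length (ext p vs)}" using \<pi>(1) len[OF vs] by simp
    have "map (\<lambda>X. X p) (permute_list \<pi> (ext p vs)) = ws"
      using permute_list_map[OF \<pi>', of "\<lambda>X. X p"] ext(2)[OF vs] \<pi>(2) by simp
    then have "\<Phi> p ws = F (permute_list \<pi> (ext p vs)) p"
      using val[of "permute_list \<pi> (ext p vs)" p] ext(1)[OF vs] \<pi>' by simp
    also have "\<dots> = F (ext p vs) p"
      using tensorial_sym[OF F ext(1)[OF vs] mset_permute_list[OF \<pi>']] by simp
    finally show "\<Phi> p ws = \<Phi> p vs" using vs by (simp add: \<Phi>_def)
  next
    fix p vs assume "N \<le> length (vs :: 'a tvec list)"
    then show "\<Phi> p vs = 0" using N ext(1)[of vs p] len[of vs p] by (simp add: \<Phi>_def)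
  qed (use at tensorial_smooth[OF F] smooth_zero in \<open>auto simp: \<Phi>_def\<close>)
  with at show ?thesis by blast
qed

lemma tensor_of:
  assumes "tensorial F"
  shows tensor_of_mem: "tensor_of A F \<in> ST"
    and at_fields_tensor_of: "fields Xs \<Longrightarrow> at_fields (tensor_of A F) Xs = F Xs"
proof -
  have "\<exists>!\<Phi>. \<Phi> \<in> ST \<and> (\<forall>Xs. fields Xs \<longrightarrow> at_fields \<Phi> Xs = F Xs)"
    using tensor_exists[OF assms] at_fields_inject by (metis (no_types, lifting))
  from theI'[OF this] show "tensor_of A F \<in> ST"
    "fields Xs \<Longrightarrow> at_fields (tensor_of A F) Xs = F Xs"
    unfolding tensor_of_def by blast+
qed

text \<open>The tensor field with the values of \<open>\<Phi>\<close> on vector fields agrees with \<open>\<Phi>\<close> on all lists of tangent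
  vectors.\<close>
lemma Upsilon_sumI:
  assumes F: "tensorial (at_fields \<Phi>)" and out: "\<And>p vs. \<not> set vs \<subseteq> TM p \<Longrightarrow> \<Phi> p vs = 0"
  shows "\<Phi> \<in> ST"
proof -
  note \<Psi> = tensor_of[OF F]
  have "tensor_of A (at_fields \<Phi>) p vs = \<Phi> p vs" for p vs
  proof (cases "set vs \<subseteq> TM p")
    case True
    then obtain Xs where "fields Xs" "map (\<lambda>X. X p) Xs = vs" using tangent_vectors_extend by blast
    then show ?thesis using \<Psi>(2)[of Xs] by (auto simp: at_fields_def fun_eq_iff)
  next
    case False
    then show ?thesis using Upsilon_sum_outside[OF \<Psi>(1)] out by simp
  qed
  then have "tensor_of A (at_fields \<Phi>) = \<Phi>" by (intro ext)
  with \<Psi>(1) show ?thesis by simp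
qed

definition vtensorial :: "nat \<Rightarrow> ('a vfield list \<Rightarrow> 'a vfield) \<Rightarrow> bool" where
  "vtensorial k s \<longleftrightarrow>
     (\<forall>Xs. fields Xs \<and> length Xs = k \<longrightarrow> s Xs \<in> VF) \<and>
     (\<forall>X\<in>VF. \<forall>Y\<in>VF. \<forall>Zs. fields Zs \<and> Suc (length Zs) = k \<longrightarrow>
        s ((X + Y) # Zs) = s (X # Zs) + s (Y # Zs)) \<and>
     (\<forall>f\<in>CF. \<forall>X\<in>VF. \<forall>Zs. fields Zs \<and> Suc (length Zs) = k \<longrightarrow>
        s (fscale f X # Zs) = fscale f (s (X # Zs))) \<and>
     (\<forall>Xs Ys. fields Xs \<and> length Xs = k \<and> mset Ys = mset Xs \<longrightarrow> s Ys = s Xs)"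

lemma vtensorialI:
  assumes "\<And>Xs. fields Xs \<Longrightarrow> length Xs = k \<Longrightarrow> s Xs \<in> VF"
    and "\<And>X Y Zs. X \<in> VF \<Longrightarrow> Y \<in> VF \<Longrightarrow> fields Zs \<Longrightarrow> Suc (length Zs) = k \<Longrightarrow>
        s ((X + Y) # Zs) = s (X # Zs) + s (Y # Zs)"
    and "\<And>f X Zs. f \<in> CF \<Longrightarrow> X \<in> VF \<Longrightarrow> fields Zs \<Longrightarrow> Suc (length Zs) = k \<Longrightarrow>
        s (fscale f X # Zs) = fscale f (s (X # Zs))"
    and "\<And>Xs Ys. fields Xs \<Longrightarrow> length Xs = k \<Longrightarrow> mset Ys = mset Xs \<Longrightarrow> s Ys = s Xs"
  shows "vtensorial k s"
  unfolding vtensorial_def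
  by (intro conjI ballI allI impI; (elim conjE)?; rule assms; assumption)

lemma vtensorialD:
  assumes "vtensorial k s"
  shows vtensorial_mem: "fields Xs \<Longrightarrow> length Xs = k \<Longrightarrow> s Xs \<in> VF"
    and vtensorial_add: "X \<in> VF \<Longrightarrow> Y \<in> VF \<Longrightarrow> fields Zs \<Longrightarrow> Suc (length Zs) = k \<Longrightarrow>
        s ((X + Y) # Zs) = s (X # Zs) + s (Y # Zs)"
    and vtensorial_fscale: "f \<in> CF \<Longrightarrow> X \<in> VF \<Longrightarrow> fields Zs \<Longrightarrow> Suc (length Zs) = k \<Longrightarrow>
        s (fscale f X # Zs) = fscale f (s (X # Zs))"
    and vtensorial_sym: "fields Xs \<Longrightarrow> length Xs = k \<Longrightarrow> mset Ys = mset Xs \<Longrightarrow> s Ys = s Xs"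
  using assms unfolding vtensorial_def by (blast+)

text \<open>For fixed \<open>f\<close>, the function \<open>s Xs f\<close> depends on \<open>Xs\<close> as a tensor field with real values does; the
  tensor fields for all \<open>f\<close> are assembled into one with values in the tangent spaces.\<close>
lemma at_fields_vtensor_of:
  assumes s: "vtensorial k s" and "length Xs = k" "fields Xs"
  shows "at_fields (vtensor_of A k s) Xs = s Xs"
proof -
  let ?P = "\<lambda>\<sigma>. \<sigma> \<in> sym_vtensors A k \<and> (\<forall>Xs. length Xs = k \<and> fields Xs \<longrightarrow> at_fields \<sigma> Xs = s Xs)"
  define F where "F f Xs p = (if length Xs = k then s Xs p f else 0)" for f Xs p
  have sT: "s Xs p \<in> TM p" if "length Xs = k" "fields Xs" for Xs p
    using vtensorial_mem[OF s that(2,1)] by (rule vfields_tangent)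
  have F: "tensorial (F f)" for f
  proof (rule tensorialI)
    fix Xs assume Xs: "fields Xs"
    have "(\<lambda>p. s Xs p f) \<in> CF" if "length Xs = k"
    proof (cases "f \<in> CF")
      case True
      then show ?thesis using vtensorial_mem[OF s Xs that] by (rule vfields_smooth[rotated])
    next
      case False
      then show ?thesis using tangent_apply_nonsmooth[OF sT[OF that Xs]] smooth_const[of 0] by simp
    qed
    then show "F f Xs \<in> CF" using smooth_const[of 0] by (cases "length Xs = k") (auto simp: F_def[abs_def])
  next
    show "\<exists>N. \<forall>Xs. fields Xs \<and> N \<le> length Xs \<longrightarrow> F f Xs = 0"
      by (rule exI[of _ "Suc k"]) (auto simp: F_def fun_eq_iff)
  next
    fix Xs X Y Ys assume "fields Xs" "X \<in> VF" "Y \<in> VF" "fields Ys"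
    then show "F f (Xs @ X # Y # Ys) = F f (Xs @ Y # X # Ys)"
      using vtensorial_sym[OF s, of "Xs @ Y # X # Ys" "Xs @ X # Y # Ys"] by (auto simp: F_def)
  qed (auto simp: F_def fun_eq_iff vtensorial_add[OF s] vtensorial_fscale[OF s], simp add: fscale_def)
  define \<sigma> where "\<sigma> p vs f = tensor_of A (F f) p vs" for p vs f
  have val: "\<sigma> p (map (\<lambda>X. X p) Xs) f = F f Xs p" if "fields Xs" for p Xs f
    using at_fields_tensor_of[OF F that] by (auto simp: at_fields_def \<sigma>_def fun_eq_iff)
  have at: "at_fields \<sigma> Xs = s Xs" if "length Xs = k" "fields Xs" for Xs
    using val[OF that(2)] that(1) by (auto simp: at_fields_def F_def fun_eq_iff)
  have tan: "\<sigma> p vs \<in> TM p" if vs: "length vs = k" "set vs \<subseteq> TM p" for p vs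
  proof -
    obtain Xs where Xs: "fields Xs" "map (\<lambda>X. X p) Xs = vs" using tangent_vectors_extend[OF vs(2)] by blast
    then have l: "length Xs = k" using vs(1) by auto
    then have "\<sigma> p vs = s Xs p" using fun_cong[OF at[OF l Xs(1)], of p] Xs(2) by (simp add: at_fields_def)
    then show ?thesis using sT[OF l Xs(1)] by simp
  qed
  have sf: "sym_form A p k (\<lambda>vs. \<sigma> p vs f)" for p f
  proof -
    note \<Phi> = tensor_of_mem[OF F, of f]
    have "tensor_of A (F f) p vs = 0" if "length vs \<noteq> k" for p vs
    proof (cases "set vs \<subseteq> TM p")
      case True
      then obtain Xs where Xs: "fields Xs" "map (\<lambda>X. X p) Xs = vs" using tangent_vectors_extend by blast
      then have "length Xs \<noteq> k" using that by auto
      then show ?thesis using val[OF Xs(1), of p f] Xs(2) by (simp add: \<sigma>_def F_def)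
    qed (rule Upsilon_sum_outside[OF \<Phi>])
    then have "tensor_of A (F f) \<in> Upsilon A k" using \<Phi> Upsilon_iff[OF smooth_zero] by blast
    then show ?thesis by (simp add: Upsilon_def \<sigma>_def)
  qed
  have "?P \<sigma>"
    unfolding sym_vtensors_def using sf tan at vtensorial_mem[OF s] by auto
  moreover have "\<tau> = \<sigma>" if \<tau>: "?P \<tau>" for \<tau>
  proof (intro ext)
    fix p vs f
    have \<tau>f: "sym_form A p k (\<lambda>vs. \<tau> p vs f)" using \<tau> by (auto simp: sym_vtensors_def)
    show "\<tau> p vs f = \<sigma> p vs f"
    proof (cases "length vs = k \<and> set vs \<subseteq> TM p")
      case True
      then obtain Xs where Xs: "fields Xs" "map (\<lambda>X. X p) Xs = vs" using tangent_vectors_extend by blast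
      then have "length Xs = k" using True by auto
      then have "at_fields \<tau> Xs = at_fields \<sigma> Xs" using \<tau> at Xs(1) by simp
      then show ?thesis using Xs(2) by (auto simp: at_fields_def fun_eq_iff)
    next
      case False
      then show ?thesis using \<tau>f sf[of p f] unfolding sym_form_iff by auto
    qed
  qed
  ultimately have "?P (THE \<sigma>. ?P \<sigma>)" by (rule theI)
  then show ?thesis using assms(2,3) by (simp add: vtensor_of_def)
qed

end


section \<open>The symmetric product as a shuffle product\<close>

text \<open>On symmetric functions of lists, contraction with a vector is a derivation of the symmetric
  product.  Read as a recursion, this Leibniz rule determines the product.\<close>

fun shuffle :: "('v list \<Rightarrow> 'c::comm_ring_1) \<Rightarrow> ('v list \<Rightarrow> 'c) \<Rightarrow> 'v list \<Rightarrow> 'c" where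
  "shuffle F G [] = F [] * G []"
| "shuffle F G (v # vs) = shuffle (\<lambda>ws. F (v # ws)) G vs + shuffle F (\<lambda>ws. G (v # ws)) vs"

lemma shuffle_add_left: "shuffle (\<lambda>ws. F ws + F' ws) G vs = shuffle F G vs + shuffle F' G vs"
  by (induction vs arbitrary: F F' G) (auto simp: algebra_simps)

lemma shuffle_add_right: "shuffle F (\<lambda>ws. G ws + G' ws) vs = shuffle F G vs + shuffle F G' vs"
  by (induction vs arbitrary: F G G') (auto simp: algebra_simps)

lemma shuffle_scale_left: "shuffle (\<lambda>ws. c * F ws) G vs = c * shuffle F G vs"
  by (induction vs arbitrary: F G) (auto simp: algebra_simps)

lemma shuffle_scale_right: "shuffle F (\<lambda>ws. c * G ws) vs = c * shuffle F G vs"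
  by (induction vs arbitrary: F G) (auto simp: algebra_simps)

lemma shuffle_zero_left: "shuffle (\<lambda>_. 0) G vs = 0"
  by (induction vs arbitrary: G) auto

lemma shuffle_zero_right: "shuffle F (\<lambda>_. 0) vs = 0"
  by (induction vs arbitrary: F) auto

lemma shuffle_cong:
  assumes "\<And>ws. set ws \<subseteq> set vs \<Longrightarrow> F ws = F' ws" "\<And>ws. set ws \<subseteq> set vs \<Longrightarrow> G ws = G' ws"
  shows "shuffle F G vs = shuffle F' G' vs"
  using assms
proof (induction vs arbitrary: F F' G G')
  case (Cons v vs)
  have "shuffle (\<lambda>ws. F (v # ws)) G vs = shuffle (\<lambda>ws. F' (v # ws)) G' vs"
    by (rule Cons.IH) (use Cons.prems in \<open>auto simp: subset_insertI2\<close>)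
  moreover have "shuffle F (\<lambda>ws. G (v # ws)) vs = shuffle F' (\<lambda>ws. G' (v # ws)) vs"
    by (rule Cons.IH) (use Cons.prems in \<open>auto simp: subset_insertI2\<close>)
  ultimately show ?case by simp
qed simp

lemma shuffle_function_left:
  assumes "\<And>ws. ws \<noteq> [] \<Longrightarrow> F ws = 0"
  shows "shuffle F G vs = F [] * G vs"
  using assms by (induction vs arbitrary: G) (auto simp: shuffle_zero_left)

lemma shuffle_outside:
  assumes "\<And>ws. \<not> set ws \<subseteq> S \<Longrightarrow> F ws = 0" "\<And>ws. \<not> set ws \<subseteq> S \<Longrightarrow> G ws = 0" "\<not> set vs \<subseteq> S"
  shows "shuffle F G vs = 0"
  using assms
proof (induction vs arbitrary: F G)
  case (Cons v vs)
  show ?case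
  proof (cases "v \<in> S")
    case True
    then have "\<not> set vs \<subseteq> S" using Cons.prems(3) by auto
    then show ?thesis using Cons.prems(1,2) by (auto intro!: add_0_iff[THEN iffD2] simp: Cons.IH)
  next
    case False
    then have "(\<lambda>ws. F (v # ws)) = (\<lambda>_. 0)" "(\<lambda>ws. G (v # ws)) = (\<lambda>_. 0)"
      using Cons.prems(1,2) by auto
    then show ?thesis by (simp add: shuffle_zero_left shuffle_zero_right)
  qed
qed auto

lemma shuffle_degree:
  assumes "\<And>xs ys. length xs + length ys = length vs \<Longrightarrow> set xs \<subseteq> set vs \<Longrightarrow> set ys \<subseteq> set vs \<Longrightarrow> F xs * G ys = 0"
  shows "shuffle F G vs = 0"
  using assms
proof (induction vs arbitrary: F G)
  case (Cons v vs)
  have "shuffle (\<lambda>ws. F (v # ws)) G vs = 0"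
    by (rule Cons.IH) (use Cons.prems[of "v # _"] in \<open>auto simp: subset_insertI2\<close>)
  moreover have "shuffle F (\<lambda>ws. G (v # ws)) vs = 0"
    by (rule Cons.IH) (use Cons.prems[of _ "v # _"] in \<open>auto simp: subset_insertI2\<close>)
  ultimately show ?case by simp
qed simp

lemma shuffle_swap:
  assumes "\<And>xs ys. mset xs = mset ys \<Longrightarrow> F xs = F ys" "\<And>xs ys. mset xs = mset ys \<Longrightarrow> G xs = G ys"
  shows "shuffle F G (xs @ u # v # ys) = shuffle F G (xs @ v # u # ys)"
  using assms
proof (induction xs arbitrary: F G)
  case Nil
  have "(\<lambda>ws. F (u # v # ws)) = (\<lambda>ws. F (v # u # ws))" "(\<lambda>ws. G (u # v # ws)) = (\<lambda>ws. G (v # u # ws))"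
    by ((rule ext, rule Nil, simp)+)
  then show ?case by (simp add: algebra_simps)
next
  case (Cons x xs)
  have "shuffle (\<lambda>ws. F (x # ws)) G (xs @ u # v # ys) = shuffle (\<lambda>ws. F (x # ws)) G (xs @ v # u # ys)"
    by (rule Cons.IH) (rule Cons.prems, simp)+
  moreover have "shuffle F (\<lambda>ws. G (x # ws)) (xs @ u # v # ys) = shuffle F (\<lambda>ws. G (x # ws)) (xs @ v # u # ys)"
    by (rule Cons.IH) (rule Cons.prems, simp)+
  ultimately show ?case by simp
qed

lemma shuffle_permutation_invariant:
  assumes "\<And>xs ys. mset xs = mset ys \<Longrightarrow> F xs = F ys" "\<And>xs ys. mset xs = mset ys \<Longrightarrow> G xs = G ys"
    and "mset ws = mset vs"
  shows "shuffle F G ws = shuffle F G vs"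
proof (rule symmetric_if_adjacent_swaps[where S = UNIV])
  fix xs u v ys
  show "shuffle F G (xs @ u # v # ys) = shuffle F G (xs @ v # u # ys)"
    by (rule shuffle_swap[of F G]) (rule assms(1), assumption, rule assms(2), assumption)
qed (use assms(3) in auto)

text \<open>Expanding the recursion gives one summand for each way to distribute the entries of the list.\<close>

fun splits :: "'v list \<Rightarrow> ('v list \<times> 'v list) list" where
  "splits [] = [([], [])]"
| "splits (v # vs) = map (\<lambda>(a, b). (v # a, b)) (splits vs) @ map (\<lambda>(a, b). (a, v # b)) (splits vs)"

lemma shuffle_splits: "shuffle F G vs = (\<Sum>(a, b)\<leftarrow>splits vs. F a * G b)"
  by (induction vs arbitrary: F G) (auto simp: o_def split_def)

lemma splits_map: "splits (map f vs) = map (\<lambda>(a, b). (map f a, map f b)) (splits vs)"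
  by (induction vs) (auto simp: o_def split_def)

lemma mset_splits: "(a, b) \<in> set (splits vs) \<Longrightarrow> mset (a @ b) = mset vs"
  by (induction vs arbitrary: a b) auto

lemma sum_list_splits:
  "(\<Sum>(a, b)\<leftarrow>splits vs. h (length a)) = (\<Sum>r\<le>length vs. real (length vs choose r) * h r)"
proof (induction vs arbitrary: h)
  case (Cons v vs)
  let ?n = "length vs"
  have "(\<Sum>(a, b)\<leftarrow>splits (v # vs). h (length a)) =
      (\<Sum>r\<le>?n. real (?n choose r) * h (Suc r)) + (\<Sum>r\<le>?n. real (?n choose r) * h r)"
    using Cons.IH[of "\<lambda>r. h (Suc r)"] Cons.IH[of h] by (simp add: o_def split_def)
  also have "(\<Sum>r\<le>?n. real (?n choose r) * h r) = (\<Sum>r\<le>Suc ?n. real (?n choose r) * h r)"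
    by (simp add: binomial_eq_0)
  also have "\<dots> = h 0 + (\<Sum>r\<le>?n. real (?n choose Suc r) * h (Suc r))"
    by (simp only: sum.atMost_Suc_shift) simp
  also have "(\<Sum>r\<le>?n. real (?n choose r) * h (Suc r)) + (h 0 + (\<Sum>r\<le>?n. real (?n choose Suc r) * h (Suc r)))
      = h 0 + (\<Sum>r\<le>?n. real (Suc ?n choose Suc r) * h (Suc r))"
    by (simp add: sum.distrib algebra_simps)
  also have "\<dots> = (\<Sum>r\<le>Suc ?n. real (Suc ?n choose r) * h r)"
    by (simp only: sum.atMost_Suc_shift) simp
  finally show ?case by simp
qed simp

text \<open>Averaged over all permutations, every distribution with \<open>r\<close> entries on the left contributes
  as much as the one that takes the first \<open>r\<close> entries.\<close>

lemma sum_permutations_split: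
  assumes "(a, b) \<in> set (splits [0..<length vs])"
  shows "(\<Sum>\<pi> | \<pi> permutes {..<length vs}.
      F (map ((!) (permute_list \<pi> vs)) a) * G (map ((!) (permute_list \<pi> vs)) b)) =
    (\<Sum>\<pi> | \<pi> permutes {..<length vs}.
      F (take (length a) (permute_list \<pi> vs)) * G (drop (length a) (permute_list \<pi> vs)) :: real)"
proof -
  let ?n = "length vs"
  obtain \<rho> where \<rho>: "\<rho> permutes {..<?n}" "permute_list \<rho> [0..<?n] = a @ b"
    using mset_eq_permutation[OF mset_splits[OF assms]] by auto
  have ab: "map ((!) ws) a = take (length a) (permute_list \<rho> ws)"
    "map ((!) ws) b = drop (length a) (permute_list \<rho> ws)" if "length ws = ?n" for ws :: "'a list"
  proof -
    have "permute_list \<rho> ws = permute_list \<rho> (map ((!) ws) [0..<?n])"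
      using that by (metis map_nth)
    also have "\<dots> = map ((!) ws) a @ map ((!) ws) b"
      using permute_list_map[of \<rho> "[0..<?n]" "(!) ws"] \<rho> by simp
    finally show "map ((!) ws) a = take (length a) (permute_list \<rho> ws)"
      "map ((!) ws) b = drop (length a) (permute_list \<rho> ws)" by simp_all
  qed
  have "(\<Sum>\<pi> | \<pi> permutes {..<?n}.
      F (map ((!) (permute_list \<pi> vs)) a) * G (map ((!) (permute_list \<pi> vs)) b)) =
    (\<Sum>\<pi> | \<pi> permutes {..<?n}.
      F (take (length a) (permute_list (\<pi> \<circ> \<rho>) vs)) * G (drop (length a) (permute_list (\<pi> \<circ> \<rho>) vs)))"
    by (intro sum.cong refl) (simp add: ab permute_list_compose[OF \<rho>(1)])
  also have "\<dots> = (\<Sum>\<pi> | \<pi> permutes {..<?n}.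
      F (take (length a) (permute_list \<pi> vs)) * G (drop (length a) (permute_list \<pi> vs)))"
    by (rule sum_permutations_compose_right[OF \<rho>(1), symmetric])
  finally show ?thesis .
qed

text \<open>The shuffle product of symmetric functions is invariant under permutations of its argument and hence
  equal to its average over all of them.\<close>
lemma shuffle_eq_symmetrized:
  fixes F G :: "'v list \<Rightarrow> real"
  assumes F: "\<And>xs ys. mset xs = mset ys \<Longrightarrow> F xs = F ys" and G: "\<And>xs ys. mset xs = mset ys \<Longrightarrow> G xs = G ys"
  shows "shuffle F G vs = (\<Sum>r\<le>length vs. fact (length vs) / (fact r * fact (length vs - r)) *
    symmetrize (\<lambda>ws. F (take r ws) * G (drop r ws)) vs)"
proof -
  let ?n = "length vs"
  let ?P = "{\<pi>. \<pi> permutes {..<?n}}"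
  define h where "h r = (\<Sum>\<pi>\<in>?P. F (take r (permute_list \<pi> vs)) * G (drop r (permute_list \<pi> vs)))" for r
  have fin: "finite ?P" by (simp add: finite_permutations)
  have sh: "shuffle F G (permute_list \<pi> vs) = (\<Sum>(a, b)\<leftarrow>splits [0..<?n].
      F (map ((!) (permute_list \<pi> vs)) a) * G (map ((!) (permute_list \<pi> vs)) b))" for \<pi>
  proof -
    have "permute_list \<pi> vs = map ((!) (permute_list \<pi> vs)) [0..<?n]"
      by (metis length_permute_list map_nth)
    then have "splits (permute_list \<pi> vs) = map (\<lambda>(a, b). (map ((!) (permute_list \<pi> vs)) a,
        map ((!) (permute_list \<pi> vs)) b)) (splits [0..<?n])"
      using splits_map by metis
    then show ?thesis unfolding shuffle_splits by (simp add: o_def split_def)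
  qed
  have swap: "(\<Sum>\<pi>\<in>?P. \<Sum>z\<leftarrow>zs. k \<pi> z) = (\<Sum>z\<leftarrow>zs. \<Sum>\<pi>\<in>?P. k \<pi> z)" for k :: "_ \<Rightarrow> _ \<Rightarrow> real" and zs :: "'z list"
    by (induction zs) (auto simp: sum.distrib)
  have "fact ?n * shuffle F G vs = (\<Sum>\<pi>\<in>?P. shuffle F G vs)"
    by (simp add: card_permutations)
  also have "\<dots> = (\<Sum>\<pi>\<in>?P. shuffle F G (permute_list \<pi> vs))"
    by (intro sum.cong refl shuffle_permutation_invariant F G) auto
  also have "\<dots> = (\<Sum>(a, b)\<leftarrow>splits [0..<?n]. \<Sum>\<pi>\<in>?P.
      F (map ((!) (permute_list \<pi> vs)) a) * G (map ((!) (permute_list \<pi> vs)) b))"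
    unfolding sh swap by (simp add: split_def)
  also have "\<dots> = (\<Sum>(a, b)\<leftarrow>splits [0..<?n]. h (length a))"
    unfolding h_def using sum_permutations_split[of _ _ vs F G]
    by (intro arg_cong[of _ _ sum_list] map_cong refl) auto
  also have "\<dots> = (\<Sum>r\<le>?n. real (?n choose r) * h r)"
    using sum_list_splits[of h "[0..<?n]"] by simp
  finally have "shuffle F G vs = (\<Sum>r\<le>?n. real (?n choose r) * h r) / fact ?n"
    by (simp add: field_simps)
  also have "\<dots> = (\<Sum>r\<le>?n. fact ?n / (fact r * fact (?n - r)) * (h r / fact ?n))"
    by (simp add: sum_divide_distrib binomial_fact)
  finally show ?thesis by (simp add: symmetrize_def h_def)
qed

lemma sym_prod_eq_shuffle:
  assumes "\<Phi> \<in> Upsilon_sum A" "\<Psi> \<in> Upsilon_sum A"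
  shows "(\<Phi> \<odot> \<Psi>) p vs = shuffle (\<Phi> p) (\<Psi> p) vs"
proof -
  have "(\<Sum>\<pi> | \<pi> permutes {..<length vs}. tensor_prod r (component r \<Phi>) (component (length vs - r) \<Psi>) p (permute_list \<pi> vs))
      = (\<Sum>\<pi> | \<pi> permutes {..<length vs}. \<Phi> p (take r (permute_list \<pi> vs)) * \<Psi> p (drop r (permute_list \<pi> vs)))"
    if "r \<le> length vs" for r
    using that by (intro sum.cong refl) (simp add: tensor_prod_def component_def)
  then have "(\<Phi> \<odot> \<Psi>) p vs = (\<Sum>r\<le>length vs. fact (length vs) / (fact r * fact (length vs - r)) *
    symmetrize (\<lambda>ws. \<Phi> p (take r ws) * \<Psi> p (drop r ws)) vs)"
    unfolding sym_prod_def sym_prod_hom_def symmetrize_def by (intro sum.cong refl) auto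
  also have "\<dots> = shuffle (\<Phi> p) (\<Psi> p) vs"
    by (rule shuffle_eq_symmetrized[symmetric]) (auto intro: Upsilon_sum_sym assms)
  finally show ?thesis .
qed

lemma shuffle_at_fields:
  fixes \<Phi> \<Psi> :: "'a tensor"
  shows "shuffle (at_fields \<Phi>) (at_fields \<Psi>) Xs p = shuffle (\<Phi> p) (\<Psi> p) (map (\<lambda>X. X p) Xs)"
proof -
  have "shuffle F G Xs p = shuffle B C (map (\<lambda>X. X p) Xs)"
    if "\<And>Xs. F Xs p = B (map (\<lambda>X. X p) Xs)" "\<And>Xs. G Xs p = C (map (\<lambda>X. X p) Xs)"
    for F G :: "'a vfield list \<Rightarrow> 'a \<Rightarrow> real" and B C
    using that by (induction Xs arbitrary: F G B C) auto
  then show ?thesis by (simp add: at_fields_def)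
qed

lemma at_fields_sym_prod:
  assumes "\<Phi> \<in> Upsilon_sum A" "\<Psi> \<in> Upsilon_sum A"
  shows "at_fields (\<Phi> \<odot> \<Psi>) Xs = shuffle (at_fields \<Phi>) (at_fields \<Psi>) Xs"
  by (rule ext) (simp add: shuffle_at_fields at_fields_def[of "\<Phi> \<odot> \<Psi>"] sym_prod_eq_shuffle[OF assms])


section \<open>Contractions\<close>

text \<open>\<open>contr k s F\<close> sums \<open>F (s vs\<^sub>S # vs\<^sub>T)\<close> over the ways to distribute the entries of the list into
  \<open>k\<close> arguments \<open>vs\<^sub>S\<close> of \<open>s\<close> and the remaining ones.  The recursion says that its commutator with the
  contraction by \<open>Y\<close> is the same operator for the partial application of \<open>s\<close> to \<open>Y\<close>.\<close>

fun contr :: "nat \<Rightarrow> ('v list \<Rightarrow> 'v) \<Rightarrow> ('v list \<Rightarrow> 'c::comm_ring_1) \<Rightarrow> 'v list \<Rightarrow> 'c" where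
  "contr 0 s F Ys = F (s [] # Ys)"
| "contr (Suc k) s F [] = 0"
| "contr (Suc k) s F (Y # Ys) = contr (Suc k) s (\<lambda>Zs. F (Y # Zs)) Ys + contr k (\<lambda>Zs. s (Y # Zs)) F Ys"

lemma contr_add: "contr k s (\<lambda>Zs. F Zs + G Zs) Ys = contr k s F Ys + contr k s G Ys"
proof (induction k arbitrary: s F G Ys)
  case (Suc k)
  then show ?case by (induction Ys arbitrary: F G) (auto simp: algebra_simps)
qed simp

lemma contr_scale: "contr k s (\<lambda>Zs. c * F Zs) Ys = c * contr k s F Ys"
proof (induction k arbitrary: s F Ys)
  case (Suc k)
  then show ?case by (induction Ys arbitrary: F) (auto simp: algebra_simps)
qed simp

text \<open>The Leibniz rule is inherited along the recursion: for \<open>k = 0\<close> it is the recursion equation of the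
  shuffle product, and a commutator of derivations is a derivation.\<close>
lemma contr_shuffle:
  "contr k s (shuffle F G) Ys = shuffle (contr k s F) G Ys + shuffle F (contr k s G) Ys"
proof (induction k arbitrary: s F G Ys)
  case 0
  show ?case by simp
next
  case (Suc k)
  note IH = Suc
  show ?case
  proof (induction Ys arbitrary: F G)
    case (Cons Y Ys)
    then show ?case by (simp add: contr_add shuffle_add_left shuffle_add_right IH)
  qed simp
qed

context smooth_manifold
begin

lemma tensorial_plus:
  assumes F: "tensorial F" and G: "tensorial G"
  shows "tensorial (\<lambda>Xs. F Xs + G Xs)"
proof (rule tensorialI)
  obtain N M where "\<And>Xs. fields Xs \<Longrightarrow> N \<le> length Xs \<Longrightarrow> F Xs = 0" "\<And>Xs. fields Xs \<Longrightarrow> M \<le> length Xs \<Longrightarrow> G Xs = 0"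
    using tensorial_bounded[OF F] tensorial_bounded[OF G] by blast
  then show "\<exists>N. \<forall>Xs. fields Xs \<and> N \<le> length Xs \<longrightarrow> F Xs + G Xs = 0"
    by (intro exI[of _ "N + M"]) auto
  show "F (Xs @ X # Y # Ys) + G (Xs @ X # Y # Ys) = F (Xs @ Y # X # Ys) + G (Xs @ Y # X # Ys)"
    if "fields Xs" "X \<in> VF" "Y \<in> VF" "fields Ys" for Xs X Y Ys
    using tensorial_sym[OF F, of "Xs @ X # Y # Ys" "Xs @ Y # X # Ys"]
      tensorial_sym[OF G, of "Xs @ X # Y # Ys" "Xs @ Y # X # Ys"] that by simp
qed (auto simp: tensorial_add[OF F] tensorial_add[OF G] tensorial_fscale[OF F] tensorial_fscale[OF G]
    algebra_simps intro: smooth_add tensorial_smooth[OF F] tensorial_smooth[OF G])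

lemma tensorial_times:
  assumes F: "tensorial F" and g: "g \<in> CF"
  shows "tensorial (\<lambda>Xs. g * F Xs)"
proof (rule tensorialI)
  obtain N where "\<And>Xs. fields Xs \<Longrightarrow> N \<le> length Xs \<Longrightarrow> F Xs = 0"
    using tensorial_bounded[OF F] by blast
  then show "\<exists>N. \<forall>Xs. fields Xs \<and> N \<le> length Xs \<longrightarrow> g * F Xs = 0"
    by (intro exI[of _ N]) auto
  show "g * F (Xs @ X # Y # Ys) = g * F (Xs @ Y # X # Ys)"
    if "fields Xs" "X \<in> VF" "Y \<in> VF" "fields Ys" for Xs X Y Ys
    using tensorial_sym[OF F, of "Xs @ X # Y # Ys" "Xs @ Y # X # Ys"] that by simp
qed (auto simp: tensorial_add[OF F] tensorial_fscale[OF F]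
    algebra_simps intro: smooth_mult[OF g] tensorial_smooth[OF F])

lemma at_fields_arith:
  fixes \<Phi> \<Psi> :: "'a tensor"
  shows at_fields_plus: "at_fields (\<Phi> + \<Psi>) Xs = at_fields \<Phi> Xs + at_fields \<Psi> Xs"
    and at_fields_minus: "at_fields (\<Phi> - \<Psi>) Xs = at_fields \<Phi> Xs - at_fields \<Psi> Xs"
    and at_fields_uminus: "at_fields (- \<Phi>) Xs = - at_fields \<Phi> Xs"
    and at_fields_fscale: "at_fields (fscale f \<Phi>) Xs = f * at_fields \<Phi> Xs"
    and at_fields_zero: "at_fields 0 Xs = 0"
  by (auto simp: at_fields_def fun_eq_iff fscale_def)

lemma at_fields_sum:
  fixes \<Phi> :: "'i \<Rightarrow> 'a tensor"
  shows "at_fields (\<Sum>i\<in>I. \<Phi> i) Xs = (\<Sum>i\<in>I. at_fields (\<Phi> i) Xs)"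
  by (rule ext) (simp add: at_fields_def sum_fun_apply)

lemma Upsilon_sum_plus: "\<Phi> \<in> ST \<Longrightarrow> \<Psi> \<in> ST \<Longrightarrow> \<Phi> + \<Psi> \<in> ST"
  using tensorial_plus[OF at_fields_tensorial at_fields_tensorial, of \<Phi> \<Psi>]
  by (intro Upsilon_sumI) (auto simp: at_fields_plus[abs_def] Upsilon_sum_outside)

lemma Upsilon_sum_fscale: "f \<in> CF \<Longrightarrow> \<Phi> \<in> ST \<Longrightarrow> fscale f \<Phi> \<in> ST"
  using tensorial_times[OF at_fields_tensorial, of \<Phi> f]
  by (intro Upsilon_sumI) (simp add: at_fields_fscale[abs_def], simp add: Upsilon_sum_outside fscale_def)

lemma Upsilon_sum_zero: "0 \<in> ST"
  by (rule Upsilon_sumI, rule tensorialI) (auto simp: at_fields_zero intro: smooth_zero)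

lemma Upsilon_sum_uminus: "\<Phi> \<in> ST \<Longrightarrow> - \<Phi> \<in> ST"
  using Upsilon_sum_fscale[OF smooth_const[of "-1"], of \<Phi>] by (simp add: fscale_def fun_Compl_def)

lemma Upsilon_sum_minus: "\<Phi> \<in> ST \<Longrightarrow> \<Psi> \<in> ST \<Longrightarrow> \<Phi> - \<Psi> \<in> ST"
  using Upsilon_sum_plus[OF _ Upsilon_sum_uminus] by (metis diff_conv_add_uminus)

lemma Upsilon_sum_sum: "(\<And>i. i \<in> I \<Longrightarrow> \<Phi> i \<in> ST) \<Longrightarrow> (\<Sum>i\<in>I. \<Phi> i) \<in> ST"
  by (induction I rule: infinite_finite_induct) (auto intro: Upsilon_sum_plus Upsilon_sum_zero)

lemma Upsilon_sum_contraction: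
  assumes "X \<in> VF" "\<Phi> \<in> ST"
  shows "contraction X \<Phi> \<in> ST"
proof (rule Upsilon_sumI)
  show "tensorial (at_fields (contraction X \<Phi>))"
    using tensorial_Cons[OF at_fields_tensorial[OF assms(2)] assms(1)]
    by (simp add: at_fields_contraction[abs_def])
  show "contraction X \<Phi> p vs = 0" if "\<not> set vs \<subseteq> TM p" for p vs
    using that Upsilon_sum_outside[OF assms(2), of "X p # vs"] by (simp add: contraction_def)
qed

lemma tensorial_shuffle:
  assumes F: "tensorial F" and G: "tensorial G"
    and sym: "\<And>xs ys. mset xs = mset ys \<Longrightarrow> F xs = F ys" "\<And>xs ys. mset xs = mset ys \<Longrightarrow> G xs = G ys"
  shows "tensorial (shuffle F G)"
proof (rule tensorialI)
  show "shuffle F G Xs \<in> CF" if "fields Xs" for Xs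
    using that F G
  proof (induction Xs arbitrary: F G)
    case Nil
    then show ?case unfolding shuffle.simps by (intro smooth_mult tensorial_smooth) auto
  next
    case (Cons X Xs)
    then show ?case unfolding shuffle.simps by (intro smooth_add Cons.IH tensorial_Cons) auto
  qed
  fix X Y Zs assume h: "X \<in> VF" "Y \<in> VF" "fields Zs"
  have "shuffle (\<lambda>ws. F ((X + Y) # ws)) G Zs = shuffle (\<lambda>ws. F (X # ws) + F (Y # ws)) G Zs"
    by (rule shuffle_cong) (use h tensorial_add[OF F] in auto)
  moreover have "shuffle F (\<lambda>ws. G ((X + Y) # ws)) Zs = shuffle F (\<lambda>ws. G (X # ws) + G (Y # ws)) Zs"
    by (rule shuffle_cong) (use h tensorial_add[OF G] in auto)
  ultimately show "shuffle F G ((X + Y) # Zs) = shuffle F G (X # Zs) + shuffle F G (Y # Zs)"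
    by (simp add: shuffle_add_left shuffle_add_right)
next
  fix f X Zs assume h: "f \<in> CF" "X \<in> VF" "fields Zs"
  have "shuffle (\<lambda>ws. F (fscale f X # ws)) G Zs = shuffle (\<lambda>ws. f * F (X # ws)) G Zs"
    by (rule shuffle_cong) (use h tensorial_fscale[OF F] in auto)
  moreover have "shuffle F (\<lambda>ws. G (fscale f X # ws)) Zs = shuffle F (\<lambda>ws. f * G (X # ws)) Zs"
    by (rule shuffle_cong) (use h tensorial_fscale[OF G] in auto)
  ultimately show "shuffle F G (fscale f X # Zs) = f * shuffle F G (X # Zs)"
    by (simp add: shuffle_scale_left shuffle_scale_right algebra_simps)
next
  show "shuffle F G (Xs @ X # Y # Ys) = shuffle F G (Xs @ Y # X # Ys)" for Xs X Y Ys
    by (rule shuffle_swap) (rule sym(1), assumption, rule sym(2), assumption)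
next
  obtain N M where NM: "\<And>Xs. fields Xs \<Longrightarrow> N \<le> length Xs \<Longrightarrow> F Xs = 0" "\<And>Xs. fields Xs \<Longrightarrow> M \<le> length Xs \<Longrightarrow> G Xs = 0"
    using tensorial_bounded[OF F] tensorial_bounded[OF G] by blast
  have "shuffle F G Xs = 0" if "fields Xs" "N + M \<le> length Xs" for Xs
  proof (rule shuffle_degree)
    fix xs ys assume "length xs + length ys = length Xs" "set xs \<subseteq> set Xs" "set ys \<subseteq> set Xs"
    then show "F xs * G ys = 0"
      using that NM(1)[of xs] NM(2)[of ys] by (cases "N \<le> length xs") auto
  qed
  then show "\<exists>N. \<forall>Xs. fields Xs \<and> N \<le> length Xs \<longrightarrow> shuffle F G Xs = 0" by blast
qed

lemma Upsilon_sum_sym_prod: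
  assumes "\<Phi> \<in> ST" "\<Psi> \<in> ST"
  shows "\<Phi> \<odot> \<Psi> \<in> ST"
proof (rule Upsilon_sumI)
  have "at_fields (\<Phi> \<odot> \<Psi>) = shuffle (at_fields \<Phi>) (at_fields \<Psi>)"
    by (rule ext) (rule at_fields_sym_prod[OF assms])
  moreover have "at_fields \<Theta> xs = at_fields \<Theta> ys" if "\<Theta> \<in> ST" "mset xs = mset ys" for \<Theta> :: "'a tensor" and xs ys
    unfolding at_fields_def by (intro ext Upsilon_sum_sym[OF that(1)]) (simp add: that(2))
  ultimately show "tensorial (at_fields (\<Phi> \<odot> \<Psi>))"
    by (simp only:) (rule tensorial_shuffle; use assms at_fields_tensorial in blast)
  show "(\<Phi> \<odot> \<Psi>) p vs = 0" if "\<not> set vs \<subseteq> TM p" for p vs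
    unfolding sym_prod_eq_shuffle[OF assms] using that
    by (intro shuffle_outside[where S = "TM p"]) (auto intro: Upsilon_sum_outside assms)
qed

definition into_fields :: "nat \<Rightarrow> ('a vfield list \<Rightarrow> 'a vfield) \<Rightarrow> bool" where
  "into_fields k s \<longleftrightarrow> (\<forall>Xs. fields Xs \<and> length Xs = k \<longrightarrow> s Xs \<in> VF)"

lemma into_fields_Cons: "into_fields (Suc k) s \<Longrightarrow> X \<in> VF \<Longrightarrow> into_fields k (\<lambda>Zs. s (X # Zs))"
  unfolding into_fields_def by simp

lemma vtensorial_into_fields: "vtensorial k s \<Longrightarrow> into_fields k s"
  unfolding into_fields_def using vtensorial_mem by blast

lemma vtensorial_Cons:
  assumes s: "vtensorial (Suc k) s" and X: "X \<in> VF"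
  shows "vtensorial k (\<lambda>Zs. s (X # Zs))"
proof -
  have swap: "s (X # Y # Zs) = s (Y # X # Zs)" if "Y \<in> VF" "fields Zs" "Suc (length Zs) = k" for Y Zs
    by (rule vtensorial_sym[OF s]) (use that X in auto)
  show ?thesis
  proof (rule vtensorialI)
    show "s (X # (Y + Z) # Zs) = s (X # Y # Zs) + s (X # Z # Zs)"
      if "Y \<in> VF" "Z \<in> VF" "fields Zs" "Suc (length Zs) = k" for Y Z Zs
      using that X vtensorial_add[OF s, of Y Z "X # Zs"] by (simp add: swap vfields_add)
    show "s (X # fscale f Y # Zs) = fscale f (s (X # Y # Zs))"
      if "f \<in> CF" "Y \<in> VF" "fields Zs" "Suc (length Zs) = k" for f Y Zs
      using that X vtensorial_fscale[OF s, of f Y "X # Zs"] by (simp add: swap vfields_fscale)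
    show "s (X # Xs) \<in> VF" if "fields Xs" "length Xs = k" for Xs
      by (rule vtensorial_mem[OF s]) (use X that in auto)
    show "s (X # Ys) = s (X # Xs)" if "fields Xs" "length Xs = k" "mset Ys = mset Xs" for Xs Ys
      by (rule vtensorial_sym[OF s]) (use X that in auto)
  qed
qed

lemma contr_cong:
  assumes "into_fields k s" "\<And>Xs. fields Xs \<Longrightarrow> length Xs = k \<Longrightarrow> s Xs = t Xs"
    and "\<And>Xs. fields Xs \<Longrightarrow> F Xs = G Xs" "fields Ys"
  shows "contr k s F Ys = contr k t G Ys"
  using assms
proof (induction k arbitrary: s t F G Ys)
  case 0
  then show ?case by (simp add: into_fields_def)
next
  case (Suc k)
  note IH = Suc.IH
  from Suc.prems(4,1-3) show ?case
  proof (induction Ys arbitrary: F G)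
    case (Cons Y Ys)
    have "contr (Suc k) s (\<lambda>Zs. F (Y # Zs)) Ys = contr (Suc k) t (\<lambda>Zs. G (Y # Zs)) Ys"
      by (rule Cons.IH) (use Cons.prems in auto)
    moreover have "contr k (\<lambda>Zs. s (Y # Zs)) F Ys = contr k (\<lambda>Zs. t (Y # Zs)) G Ys"
      by (rule IH) (use Cons.prems into_fields_Cons in auto)
    ultimately show ?case by simp
  qed simp
qed

text \<open>The empty list is excluded because \<open>F\<close> is only evaluated on lists that start with a value of \<open>s\<close>;
  thus contractions kill functions even if \<open>length Ys = k - 1\<close>.\<close>
lemma contr_degree:
  fixes F :: "'a vfield list \<Rightarrow> 'a \<Rightarrow> real"
  assumes "into_fields k s" "fields Ys"
    and "\<And>Zs. fields Zs \<Longrightarrow> Zs \<noteq> [] \<Longrightarrow> length Zs + k = Suc (length Ys) \<Longrightarrow> F Zs = 0"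
  shows "contr k s F Ys = 0"
  using assms
proof (induction k arbitrary: s F Ys)
  case 0
  then show ?case by (simp add: into_fields_def)
next
  case (Suc k)
  note IH = Suc.IH
  from Suc.prems(2,1,3) show ?case
  proof (induction Ys arbitrary: F)
    case (Cons Y Ys)
    have "contr (Suc k) s (\<lambda>Zs. F (Y # Zs)) Ys = 0"
      by (rule Cons.IH) (use Cons.prems in auto)
    moreover have "contr k (\<lambda>Zs. s (Y # Zs)) F Ys = 0"
      by (rule IH) (use Cons.prems into_fields_Cons in auto)
    ultimately show ?case by simp
  qed simp
qed

lemma contr_smooth:
  assumes "into_fields k s" "tensorial F" "fields Ys"
  shows "contr k s F Ys \<in> CF"
  using assms
proof (induction k arbitrary: s F Ys)
  case 0
  then show ?case by (auto simp: into_fields_def intro!: tensorial_smooth)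
next
  case (Suc k)
  note IH = Suc.IH
  from Suc.prems(3,1,2) show ?case
  proof (induction Ys arbitrary: F)
    case Nil
    show ?case unfolding contr.simps by (rule smooth_zero)
  next
    case (Cons Y Ys)
    then show ?case unfolding contr.simps
      by (intro smooth_add Cons.IH IH tensorial_Cons into_fields_Cons) auto
  qed
qed

lemma contr_plus_op:
  assumes "into_fields k s" "into_fields k t" "tensorial F" "fields Ys"
  shows "contr k (\<lambda>Zs. s Zs + t Zs) F Ys = contr k s F Ys + contr k t F Ys"
  using assms
proof (induction k arbitrary: s t F Ys)
  case 0
  then show ?case unfolding contr.simps by (intro tensorial_add) (auto simp: into_fields_def)
next
  case (Suc k)
  note IH = Suc.IH
  from Suc.prems(4,1-3) show ?case
  proof (induction Ys arbitrary: F)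
    case (Cons Y Ys)
    have "contr (Suc k) (\<lambda>Zs. s Zs + t Zs) (\<lambda>Zs. F (Y # Zs)) Ys =
        contr (Suc k) s (\<lambda>Zs. F (Y # Zs)) Ys + contr (Suc k) t (\<lambda>Zs. F (Y # Zs)) Ys"
      by (rule Cons.IH) (use Cons.prems tensorial_Cons in auto)
    moreover have "contr k (\<lambda>Zs. s (Y # Zs) + t (Y # Zs)) F Ys =
        contr k (\<lambda>Zs. s (Y # Zs)) F Ys + contr k (\<lambda>Zs. t (Y # Zs)) F Ys"
      by (rule IH) (use Cons.prems into_fields_Cons in auto)
    ultimately have "contr (Suc k) (\<lambda>Zs. s Zs + t Zs) F (Y # Ys) =
        contr (Suc k) s F (Y # Ys) + contr (Suc k) t F (Y # Ys)" by (simp add: algebra_simps)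
    then show ?case .
  qed simp
qed

lemma contr_fscale_op:
  assumes "into_fields k s" "f \<in> CF" "tensorial F" "fields Ys"
  shows "contr k (\<lambda>Zs. fscale f (s Zs)) F Ys = f * contr k s F Ys"
  using assms
proof (induction k arbitrary: s F Ys)
  case 0
  then show ?case unfolding contr.simps by (intro tensorial_fscale) (auto simp: into_fields_def)
next
  case (Suc k)
  note IH = Suc.IH
  from Suc.prems(4,1-3) show ?case
  proof (induction Ys arbitrary: F)
    case (Cons Y Ys)
    have "contr (Suc k) (\<lambda>Zs. fscale f (s Zs)) (\<lambda>Zs. F (Y # Zs)) Ys =
        f * contr (Suc k) s (\<lambda>Zs. F (Y # Zs)) Ys"
      by (rule Cons.IH) (use Cons.prems tensorial_Cons in auto)
    moreover have "contr k (\<lambda>Zs. fscale f (s (Y # Zs))) F Ys = f * contr k (\<lambda>Zs. s (Y # Zs)) F Ys"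
      by (rule IH) (use Cons.prems into_fields_Cons in auto)
    ultimately have "contr (Suc k) (\<lambda>Zs. fscale f (s Zs)) F (Y # Ys) = f * contr (Suc k) s F (Y # Ys)"
      by (simp add: algebra_simps)
    then show ?case .
  qed simp
qed

lemma contr_swap:
  assumes "vtensorial k s" "tensorial F" "fields Xs" "X \<in> VF" "Y \<in> VF" "fields Ys"
  shows "contr k s F (Xs @ X # Y # Ys) = contr k s F (Xs @ Y # X # Ys)"
  using assms
proof (induction k arbitrary: s F Xs Ys)
  case 0
  then have "s [] \<in> VF" using vtensorial_mem by force
  then show ?case using 0 by (auto intro!: tensorial_sym[of F])
next
  case (Suc k)
  note IH = Suc.IH
  from Suc.prems(3,1,2,4-) show ?case
  proof (induction Xs arbitrary: F)
    case Nil
    note s = Nil.prems(2) and F = Nil.prems(3) and X = Nil.prems(4) and Y = Nil.prems(5) and Ys = Nil.prems(6)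
    have 1: "contr (Suc k) s (\<lambda>Zs. F (X # Y # Zs)) Ys = contr (Suc k) s (\<lambda>Zs. F (Y # X # Zs)) Ys"
      by (rule contr_cong[OF vtensorial_into_fields[OF s] _ _ Ys]) (auto intro!: tensorial_swap F X Y)
    have 2: "contr k (\<lambda>Zs. s (Y # Zs)) (\<lambda>Zs. F (X # Zs)) Ys + contr k (\<lambda>Zs. s (X # Zs)) F (Y # Ys)
        = contr k (\<lambda>Zs. s (X # Zs)) (\<lambda>Zs. F (Y # Zs)) Ys + contr k (\<lambda>Zs. s (Y # Zs)) F (X # Ys)"
    proof (cases k)
      case 0
      then have "s [X] \<in> VF" "s [Y] \<in> VF" using vtensorial_mem[OF s] X Y by auto
      then show ?thesis using 0 tensorial_swap[OF F _ X Ys] tensorial_swap[OF F _ Y Ys] by (simp add: add.commute)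
    next
      case (Suc j)
      have "contr j (\<lambda>Zs. s (X # Y # Zs)) F Ys = contr j (\<lambda>Zs. s (Y # X # Zs)) F Ys"
      proof (rule contr_cong[OF _ _ refl Ys])
        show "into_fields j (\<lambda>Zs. s (X # Y # Zs))"
          using vtensorial_into_fields[OF vtensorial_Cons[OF vtensorial_Cons[OF s X, unfolded Suc] Y]] .
        show "s (X # Y # Zs) = s (Y # X # Zs)" if "fields Zs" "length Zs = j" for Zs
          by (rule vtensorial_sym[OF s]) (use that X Y Suc in auto)
      qed
      then show ?thesis using Suc by (simp add: algebra_simps)
    qed
    have "contr (Suc k) s F (X # Y # Ys) = contr (Suc k) s F (Y # X # Ys)"
      unfolding contr.simps 1 add.assoc 2 ..
    then show ?case by (simp only: append_Nil)
  next
    case (Cons Z Xs)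
    have "contr (Suc k) s (\<lambda>Zs. F (Z # Zs)) (Xs @ X # Y # Ys) = contr (Suc k) s (\<lambda>Zs. F (Z # Zs)) (Xs @ Y # X # Ys)"
      by (rule Cons.IH) (use Cons.prems tensorial_Cons in auto)
    moreover have "contr k (\<lambda>Zs. s (Z # Zs)) F (Xs @ X # Y # Ys) = contr k (\<lambda>Zs. s (Z # Zs)) F (Xs @ Y # X # Ys)"
      by (rule IH) (use Cons.prems vtensorial_Cons in auto)
    ultimately show ?case by simp
  qed
qed

lemma contr_tensorial:
  assumes s: "vtensorial k s" and F: "tensorial F"
  shows "tensorial (contr k s F)"
proof (rule tensorialI)
  note si = vtensorial_into_fields[OF s]
  show "contr k s F Xs \<in> CF" if "fields Xs" for Xs
    by (rule contr_smooth[OF si F that])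
  show "contr k s F ((X + Y) # Zs) = contr k s F (X # Zs) + contr k s F (Y # Zs)"
    if h: "X \<in> VF" "Y \<in> VF" "fields Zs" for X Y Zs
  proof (cases k)
    case 0
    then have "s [] \<in> VF" using vtensorial_mem[OF s] by auto
    then show ?thesis using 0 tensorial_add[OF tensorial_Cons[OF F] h] by simp
  next
    case (Suc j)
    note sX = vtensorial_into_fields[OF vtensorial_Cons[OF s[unfolded Suc]]]
    have "contr k s (\<lambda>Ws. F ((X + Y) # Ws)) Zs = contr k s (\<lambda>Ws. F (X # Ws) + F (Y # Ws)) Zs"
      by (rule contr_cong[OF si refl _ h(3)]) (rule tensorial_add[OF F h(1,2)])
    moreover have "contr j (\<lambda>Ws. s ((X + Y) # Ws)) F Zs = contr j (\<lambda>Ws. s (X # Ws) + s (Y # Ws)) F Zs"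
      by (rule contr_cong[OF sX[OF vfields_add[OF h(1,2)]] _ refl h(3)]) (use vtensorial_add[OF s h(1,2)] Suc in auto)
    ultimately show ?thesis
      using Suc contr_plus_op[OF sX[OF h(1)] sX[OF h(2)] F h(3)] by (simp add: contr_add algebra_simps)
  qed
  show "contr k s F (fscale f X # Zs) = f * contr k s F (X # Zs)"
    if h: "f \<in> CF" "X \<in> VF" "fields Zs" for f X Zs
  proof (cases k)
    case 0
    then have "s [] \<in> VF" using vtensorial_mem[OF s] by auto
    then show ?thesis using 0 tensorial_fscale[OF tensorial_Cons[OF F] h] by simp
  next
    case (Suc j)
    note sX = vtensorial_into_fields[OF vtensorial_Cons[OF s[unfolded Suc]]]
    have "contr k s (\<lambda>Ws. F (fscale f X # Ws)) Zs = contr k s (\<lambda>Ws. f * F (X # Ws)) Zs"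
      by (rule contr_cong[OF si refl _ h(3)]) (rule tensorial_fscale[OF F h(1,2)])
    moreover have "contr j (\<lambda>Ws. s (fscale f X # Ws)) F Zs = contr j (\<lambda>Ws. fscale f (s (X # Ws))) F Zs"
      by (rule contr_cong[OF sX[OF vfields_fscale[OF h(1,2)]] _ refl h(3)]) (use vtensorial_fscale[OF s h(1,2)] Suc in auto)
    ultimately show ?thesis
      using Suc contr_fscale_op[OF sX[OF h(2)] h(1) F h(3)] by (simp add: contr_scale algebra_simps)
  qed
  show "contr k s F (Xs @ X # Y # Ys) = contr k s F (Xs @ Y # X # Ys)"
    if "fields Xs" "X \<in> VF" "Y \<in> VF" "fields Ys" for Xs X Y Ys
    by (rule contr_swap[OF s F that])
  obtain N where N: "\<And>Xs. fields Xs \<Longrightarrow> N \<le> length Xs \<Longrightarrow> F Xs = 0"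
    using tensorial_bounded[OF F] by blast
  have "contr k s F Xs = 0" if "fields Xs" "N + k \<le> length Xs" for Xs
    by (rule contr_degree[OF si that(1)]) (use N that in auto)
  then show "\<exists>N. \<forall>Xs. fields Xs \<and> N \<le> length Xs \<longrightarrow> contr k s F Xs = 0" by blast
qed

lemma contr_one_form:
  fixes F :: "'a vfield list \<Rightarrow> 'a \<Rightarrow> real"
  assumes "into_fields k s" "length Xs = k" "fields Xs" "\<And>Zs. fields Zs \<Longrightarrow> length Zs \<noteq> 1 \<Longrightarrow> F Zs = 0"
  shows "contr k s F Xs = F [s Xs]"
  using assms
proof (induction k arbitrary: s Xs)
  case (Suc k)
  then obtain X Ys where Xs: "Xs = X # Ys" by (cases Xs) auto
  have "contr (Suc k) s (\<lambda>Zs. F (X # Zs)) Ys = 0"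
    by (rule contr_degree) (use Suc.prems Xs in auto)
  moreover have "contr k (\<lambda>Zs. s (X # Zs)) F Ys = F [s (X # Ys)]"
    by (rule Suc.IH) (use Suc.prems Xs into_fields_Cons in auto)
  ultimately show ?case by (simp add: Xs)
qed simp

definition contr_tensor :: "nat \<Rightarrow> ('a vfield list \<Rightarrow> 'a vfield) \<Rightarrow> 'a tensor \<Rightarrow> 'a tensor" where
  "contr_tensor k s \<Phi> = tensor_of A (contr k s (at_fields \<Phi>))"

lemma contr_tensor:
  assumes "vtensorial k s" "\<Phi> \<in> ST"
  shows contr_tensor_mem: "contr_tensor k s \<Phi> \<in> ST"
    and at_fields_contr_tensor: "fields Xs \<Longrightarrow> at_fields (contr_tensor k s \<Phi>) Xs = contr k s (at_fields \<Phi>) Xs"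
  unfolding contr_tensor_def
  using tensor_of[OF contr_tensorial[OF assms(1) at_fields_tensorial[OF assms(2)]]] by auto

end


section \<open>Derivations of the symmetric algebra\<close>

context smooth_manifold
begin

lemma Upsilon_subset: "\<phi> \<in> Upsilon A r \<Longrightarrow> \<phi> \<in> ST"
  and Upsilon_degree: "\<phi> \<in> Upsilon A r \<Longrightarrow> length vs \<noteq> r \<Longrightarrow> \<phi> p vs = 0"
  using Upsilon_iff[OF smooth_zero] by blast+

lemma UpsilonI: "\<phi> \<in> ST \<Longrightarrow> (\<And>p vs. length vs \<noteq> r \<Longrightarrow> \<phi> p vs = 0) \<Longrightarrow> \<phi> \<in> Upsilon A r"
  using Upsilon_iff[OF smooth_zero] by blast

lemma at_fields_degree: "\<phi> \<in> Upsilon A r \<Longrightarrow> length Xs \<noteq> r \<Longrightarrow> at_fields \<phi> Xs = 0"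
  by (auto simp: at_fields_def fun_eq_iff intro: Upsilon_degree)

lemma component_Upsilon: "\<Phi> \<in> ST \<Longrightarrow> component r \<Phi> \<in> Upsilon A r"
  by (simp add: Upsilon_sum_def)

lemma sum_components:
  assumes "\<Phi> \<in> ST"
  obtains N where "\<Phi> = (\<Sum>r<N. component r \<Phi>)"
proof -
  obtain N where N: "\<And>p vs. N \<le> length vs \<Longrightarrow> \<Phi> p vs = 0"
    using Upsilon_sum_bounded[OF assms] by blast
  have "\<Phi> p vs = (\<Sum>r<N. component r \<Phi>) p vs" for p vs
    using N[of vs p] by (cases "length vs < N") (auto simp: sum_fun_apply component_apply)
  then have "\<Phi> = (\<Sum>r<N. component r \<Phi>)" by (intro ext)
  with that show ?thesis by blast
qed

lemma contraction_Upsilon: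
  assumes "\<phi> \<in> Upsilon A (Suc r)" "X \<in> VF"
  shows "contraction X \<phi> \<in> Upsilon A r"
proof (rule UpsilonI)
  show "contraction X \<phi> \<in> ST"
    by (rule Upsilon_sum_contraction[OF assms(2) Upsilon_subset[OF assms(1)]])
  show "contraction X \<phi> p vs = 0" if "length vs \<noteq> r" for p vs
    using Upsilon_degree[OF assms(1), of "X p # vs"] that by (simp add: contraction_def)
qed

lemma act_arith:
  assumes "X \<in> VF"
  shows act_add: "f \<in> CF \<Longrightarrow> g \<in> CF \<Longrightarrow> act X (f + g) = act X f + act X g"
    and act_mult: "f \<in> CF \<Longrightarrow> g \<in> CF \<Longrightarrow> act X (f * g) = f * act X g + g * act X f"
    and act_zero: "act X 0 = 0"
  using tangent_apply_add[OF vfields_tangent[OF assms]] tangent_apply_mult[OF vfields_tangent[OF assms]]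
    tangent_apply_zero[OF vfields_tangent[OF assms]]
  by (auto simp: act_def fun_eq_iff)

lemma act_add_field: "act (X + Y) f = act X f + act Y f"
  and act_diff_field: "act (X - Y) f = act X f - act Y f"
  and act_fscale_field: "act (fscale h X) f = h * act X f"
  by (auto simp: act_def fscale_def fun_eq_iff)

text \<open>For a frame \<open>E i\<close> with dual coframe \<open>\<alpha> i\<close>, Euler's identity \<open>\<Sum>\<^sub>i \<alpha> i \<odot> \<iota>(E i) \<phi> = deg(\<phi>) \<phi>\<close>
  expresses \<open>\<phi>\<close> through tensor fields of smaller degree.  Here the frame and the coframe
  \<open>\<alpha> i = \<beta> d(\<xi> i) - \<xi> i d\<beta>\<close> are cut off, and \<open>f\<close> is the resulting factor \<open>\<beta>\<^sup>3\<close>.\<close>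

lemma local_coframe:
  obtains f :: "'a tensor" and \<alpha> :: "'e \<Rightarrow> 'a tensor" and E :: "'e \<Rightarrow> 'a vfield" where
    "f \<in> Upsilon A 0" "f p [] \<noteq> 0" "\<And>i. \<alpha> i \<in> Upsilon A 1" "\<And>i. E i \<in> VF"
    "\<And>r \<phi>. \<phi> \<in> Upsilon A (Suc r) \<Longrightarrow>
       f \<odot> \<phi> = fscale (\<lambda>_. 1 / real (Suc r)) (\<Sum>i\<in>Basis. \<alpha> i \<odot> contraction (E i) \<phi>)"
proof -
  obtain \<beta> and \<xi> :: "'e \<Rightarrow> 'a \<Rightarrow> real" and E where *:
    "\<beta> \<in> CF" "\<beta> p \<noteq> 0" "\<And>i. \<xi> i \<in> CF" "\<And>i. E i \<in> VF"
    "\<And>X. X \<in> VF \<Longrightarrow> fscale (\<beta> * \<beta> * \<beta>) X =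
       (\<Sum>i\<in>Basis. fscale (\<beta> * act X (\<xi> i) - \<xi> i * act X \<beta>) (E i))"
    by (rule local_frame_fields[of p]) (rule that)
  let ?b = "\<beta> * \<beta> * \<beta>"
  have b: "?b \<in> CF" by (intro smooth_intros *)
  define f :: "'a tensor" where "f q vs = (if vs = [] then ?b q else 0)" for q vs
  define \<alpha> :: "'e \<Rightarrow> 'a tensor" where "\<alpha> i q vs = (if length vs = 1 \<and> set vs \<subseteq> TM q
    then \<beta> q * hd vs (\<xi> i) - \<xi> i q * hd vs \<beta> else 0)" for i q vs
  have f_at: "at_fields f Xs = (if Xs = [] then ?b else 0)" for Xs
    by (auto simp: at_fields_def f_def)
  have fU: "f \<in> Upsilon A 0"
  proof (rule UpsilonI[OF Upsilon_sumI])
    show "tensorial (at_fields f)"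
      by (rule tensorialI) (auto simp: f_at b intro: smooth_zero intro!: exI[of _ 1])
  qed (auto simp: f_def)
  define a where "a i X = \<beta> * act X (\<xi> i) - \<xi> i * act X \<beta>" for i X
  have aR: "a i X \<in> CF" if "X \<in> VF" for i X
    unfolding a_def by (intro smooth_intros act_smooth * that)
  have \<alpha>_at: "at_fields (\<alpha> i) Xs = (if length Xs = 1 then a i (hd Xs) else 0)" if "fields Xs" for i Xs
    using that vfields_tangent
    by (cases Xs) (auto simp: at_fields_def \<alpha>_def a_def act_def fun_eq_iff)
  have \<alpha>U: "\<alpha> i \<in> Upsilon A 1" for i
  proof (rule UpsilonI[OF Upsilon_sumI])
    show "tensorial (at_fields (\<alpha> i))"
    proof (rule tensorialI)
      fix X Y Zs assume "X \<in> VF" "Y \<in> VF" "fields Zs"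
      then show "at_fields (\<alpha> i) ((X + Y) # Zs) = at_fields (\<alpha> i) (X # Zs) + at_fields (\<alpha> i) (Y # Zs)"
        by (simp add: \<alpha>_at vfields_add a_def act_add_field algebra_simps)
    next
      fix g X Zs assume "g \<in> CF" "X \<in> VF" "fields Zs"
      then show "at_fields (\<alpha> i) (fscale g X # Zs) = g * at_fields (\<alpha> i) (X # Zs)"
        by (simp add: \<alpha>_at vfields_fscale a_def act_fscale_field algebra_simps)
    next
      fix Xs assume "fields Xs"
      then show "at_fields (\<alpha> i) Xs \<in> CF"
        using smooth_zero aR[of "hd Xs"] by (cases Xs) (auto simp: \<alpha>_at)
    next
      show "\<exists>N. \<forall>Xs. fields Xs \<and> N \<le> length Xs \<longrightarrow> at_fields (\<alpha> i) Xs = 0"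
        by (rule exI[of _ 2]) (auto simp: \<alpha>_at)
    qed (auto simp: \<alpha>_at)
  qed (auto simp: \<alpha>_def)
  have euler: "(\<Sum>i\<in>Basis. shuffle (at_fields (\<alpha> i)) (\<lambda>Zs. F (E i # Zs)) Xs) = of_nat (length Xs) * (?b * F Xs)"
    if "tensorial F" "fields Xs" for F Xs
    using that
  proof (induction Xs arbitrary: F)
    case Nil
    show ?case by (simp add: \<alpha>_at)
  next
    case (Cons X Xs)
    have X: "X \<in> VF" and Xs: "fields Xs" using Cons.prems by auto
    note F = Cons.prems(1)
    have 1: "shuffle (\<lambda>ws. at_fields (\<alpha> i) (X # ws)) (\<lambda>Zs. F (E i # Zs)) Xs = a i X * F (E i # Xs)" for i
    proof -
      have "shuffle (\<lambda>ws. at_fields (\<alpha> i) (X # ws)) (\<lambda>Zs. F (E i # Zs)) Xs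
          = shuffle (\<lambda>ws. if ws = [] then a i X else 0) (\<lambda>Zs. F (E i # Zs)) Xs"
        by (rule shuffle_cong) (use X Xs in \<open>auto simp: \<alpha>_at\<close>)
      also have "\<dots> = a i X * F (E i # Xs)"
        by (subst shuffle_function_left) auto
      finally show ?thesis .
    qed
    have 2: "shuffle (at_fields (\<alpha> i)) (\<lambda>ws. F (E i # X # ws)) Xs
        = shuffle (at_fields (\<alpha> i)) (\<lambda>ws. F (X # E i # ws)) Xs" for i
      by (rule shuffle_cong) (use X Xs in \<open>auto intro!: tensorial_swap F *\<close>)
    have 3: "(\<Sum>i\<in>Basis. a i X * F (E i # Xs)) = ?b * F (X # Xs)"
    proof -
      have "?b * F (X # Xs) = F ((\<Sum>i\<in>Basis. fscale (a i X) (E i)) # Xs)"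
        unfolding a_def *(5)[OF X, symmetric] using tensorial_fscale[OF F b X Xs] by simp
      also have "\<dots> = (\<Sum>i\<in>Basis. F (fscale (a i X) (E i) # Xs))"
        by (rule tensorial_sum[OF F Xs]) (intro vfields_fscale aR X *)
      also have "\<dots> = (\<Sum>i\<in>Basis. a i X * F (E i # Xs))"
        by (intro sum.cong refl tensorial_fscale[OF F _ _ Xs] aR X *)
      finally show ?thesis by simp
    qed
    have "(\<Sum>i\<in>Basis. shuffle (at_fields (\<alpha> i)) (\<lambda>Zs. F (E i # Zs)) (X # Xs))
        = ?b * F (X # Xs) + of_nat (length Xs) * (?b * F (X # Xs))"
      unfolding shuffle.simps 1 2 sum.distrib 3 Cons.IH[OF tensorial_Cons[OF F X] Xs] ..
    also have "\<dots> = of_nat (length (X # Xs)) * (?b * F (X # Xs))"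
      by (simp add: algebra_simps)
    finally show ?case .
  qed
  have "f \<odot> \<phi> = fscale (\<lambda>_. 1 / real (Suc r)) (\<Sum>i\<in>Basis. \<alpha> i \<odot> contraction (E i) \<phi>)"
    if \<phi>: "\<phi> \<in> Upsilon A (Suc r)" for r \<phi>
  proof (rule at_fields_inject)
    note U = Upsilon_subset[OF \<phi>] Upsilon_subset[OF fU] Upsilon_subset[OF \<alpha>U] Upsilon_sum_contraction[OF *(4) Upsilon_subset[OF \<phi>]]
    show "f \<odot> \<phi> \<in> ST" by (intro Upsilon_sum_sym_prod U)
    show "fscale (\<lambda>_. 1 / real (Suc r)) (\<Sum>i\<in>Basis. \<alpha> i \<odot> contraction (E i) \<phi>) \<in> ST"
      by (intro Upsilon_sum_fscale smooth_const Upsilon_sum_sum Upsilon_sum_sym_prod U)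
    fix Xs assume Xs: "fields Xs"
    have "at_fields (f \<odot> \<phi>) Xs = ?b * at_fields \<phi> Xs"
      unfolding at_fields_sym_prod[OF U(2,1)] by (subst shuffle_function_left) (auto simp: f_at)
    moreover have "at_fields (\<Sum>i\<in>Basis. \<alpha> i \<odot> contraction (E i) \<phi>) Xs = of_nat (length Xs) * (?b * at_fields \<phi> Xs)"
      using euler[OF at_fields_tensorial[OF U(1)] Xs]
      by (simp add: at_fields_sum at_fields_sym_prod[OF U(3,4)] at_fields_contraction[abs_def])
    moreover have "(\<lambda>_. 1 / real (Suc r)) * (of_nat (length Xs) * (?b * at_fields \<phi> Xs)) = ?b * at_fields \<phi> Xs"
    proof (cases "length Xs = Suc r")
      case True
      then show ?thesis by (simp add: fun_eq_iff of_nat_fun del: of_nat_Suc)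
    next
      case False
      then show ?thesis using at_fields_degree[OF \<phi>] by simp
    qed
    ultimately show "at_fields (f \<odot> \<phi>) Xs =
        at_fields (fscale (\<lambda>_. 1 / real (Suc r)) (\<Sum>i\<in>Basis. \<alpha> i \<odot> contraction (E i) \<phi>)) Xs"
      by (simp add: at_fields_fscale)
  qed
  moreover have "f p [] \<noteq> 0" using *(2) by (simp add: f_def)
  ultimately show ?thesis using that fU \<alpha>U *(4) by blast
qed

lemma derivationD:
  assumes "derivation A d D"
  shows derivation_mem: "\<Phi> \<in> ST \<Longrightarrow> D \<Phi> \<in> ST"
    and derivation_add: "\<Phi> \<in> ST \<Longrightarrow> \<Psi> \<in> ST \<Longrightarrow> D (\<Phi> + \<Psi>) = D \<Phi> + D \<Psi>"
    and derivation_scale: "\<Phi> \<in> ST \<Longrightarrow> D (fscale (\<lambda>_. c) \<Phi>) = fscale (\<lambda>_. c) (D \<Phi>)"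
    and derivation_sym_prod: "\<Phi> \<in> ST \<Longrightarrow> \<Psi> \<in> ST \<Longrightarrow> D (\<Phi> \<odot> \<Psi>) = D \<Phi> \<odot> \<Psi> + \<Phi> \<odot> D \<Psi>"
    and derivation_outside: "\<Phi> \<notin> ST \<Longrightarrow> D \<Phi> = 0"
  using assms unfolding derivation_def by (elim conjE, blast)+

lemma derivation_sum:
  assumes "derivation A d D" "\<And>i. i \<in> I \<Longrightarrow> \<Phi> i \<in> ST"
  shows "D (\<Sum>i\<in>I. \<Phi> i) = (\<Sum>i\<in>I. D (\<Phi> i))"
proof -
  have "D 0 = 0" using derivation_add[OF assms(1) Upsilon_sum_zero Upsilon_sum_zero] by simp
  then show ?thesis using assms(2)
    by (induction I rule: infinite_finite_induct) (auto simp: derivation_add[OF assms(1)] Upsilon_sum_sum)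
qed

text \<open>By the Leibniz rule a derivation is determined on products by its values on the factors.  Locally
  every homogeneous element of positive degree is, up to an invertible function, a sum of products of a 1-form and an
  element of smaller degree.\<close>
lemma derivation_eqI:
  assumes D: "derivation A d D" and D': "derivation A d D'"
    and 0: "\<And>\<phi>. \<phi> \<in> Upsilon A 0 \<Longrightarrow> D \<phi> = D' \<phi>" and 1: "\<And>\<phi>. \<phi> \<in> Upsilon A 1 \<Longrightarrow> D \<phi> = D' \<phi>"
  shows "D = D'"
proof
  have hom: "D \<phi> = D' \<phi>" if "\<phi> \<in> Upsilon A r" for r \<phi>
    using that
  proof (induction r arbitrary: \<phi>)
    case 0
    then show ?case by (rule assms(3))
  next
    case (Suc r)
    note \<phi> = Upsilon_subset[OF Suc.prems]
    show ?case
    proof (intro ext)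
      fix p vs
      obtain f and \<alpha> :: "'e \<Rightarrow> 'a tensor" and E where *:
        "f \<in> Upsilon A 0" "f p [] \<noteq> 0" "\<And>i. \<alpha> i \<in> Upsilon A 1" "\<And>i. E i \<in> VF"
        "\<And>r \<phi>. \<phi> \<in> Upsilon A (Suc r) \<Longrightarrow>
           f \<odot> \<phi> = fscale (\<lambda>_. 1 / real (Suc r)) (\<Sum>i\<in>Basis. \<alpha> i \<odot> contraction (E i) \<phi>)"
        by (rule local_coframe[of p]) (rule that)
      have i: "contraction (E i) \<phi> \<in> Upsilon A r" for i
        by (rule contraction_Upsilon[OF Suc.prems *(4)])
      note U = Upsilon_subset[OF *(1)] Upsilon_subset[OF *(3)] Upsilon_subset[OF i] \<phi>
      have expand: "\<Delta> (f \<odot> \<phi>) = fscale (\<lambda>_. 1 / real (Suc r))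
          (\<Sum>i\<in>Basis. \<Delta> (\<alpha> i) \<odot> contraction (E i) \<phi> + \<alpha> i \<odot> \<Delta> (contraction (E i) \<phi>))"
        if \<Delta>: "derivation A d \<Delta>" for \<Delta>
        unfolding *(5)[OF Suc.prems]
        by (subst derivation_scale[OF \<Delta>], intro Upsilon_sum_sum Upsilon_sum_sym_prod U,
            subst derivation_sum[OF \<Delta>], intro Upsilon_sum_sym_prod U,
            subst derivation_sym_prod[OF \<Delta> U(2,3)]) (rule refl)
      have "D (f \<odot> \<phi>) = D' (f \<odot> \<phi>)"
        unfolding expand[OF D] expand[OF D'] by (simp only: 1[OF *(3)] Suc.IH[OF i])
      then have "f \<odot> D \<phi> = f \<odot> D' \<phi>"
        unfolding derivation_sym_prod[OF D U(1) \<phi>] derivation_sym_prod[OF D' U(1) \<phi>] 0[OF *(1)] by simp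
      moreover have "(f \<odot> \<Psi>) p vs = f p [] * \<Psi> p vs" if "\<Psi> \<in> ST" for \<Psi>
        unfolding sym_prod_eq_shuffle[OF U(1) that]
        by (rule shuffle_function_left) (auto intro: Upsilon_degree[OF *(1)])
      ultimately show "D \<phi> p vs = D' \<phi> p vs"
        using *(2) derivation_mem[OF D \<phi>] derivation_mem[OF D' \<phi>] by (metis mult_left_cancel)
    qed
  qed
  fix \<Phi> show "D \<Phi> = D' \<Phi>"
  proof (cases "\<Phi> \<in> ST")
    case True
    obtain N where N: "\<Phi> = (\<Sum>r<N. component r \<Phi>)" by (rule sum_components[OF True])
    have c: "component r \<Phi> \<in> ST" for r by (rule Upsilon_subset[OF component_Upsilon[OF True]])
    have "D \<Phi> = (\<Sum>r<N. D (component r \<Phi>))"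
      by (subst N, rule derivation_sum[OF D]) (rule c)
    also have "\<dots> = (\<Sum>r<N. D' (component r \<Phi>))"
      by (intro sum.cong refl hom[OF component_Upsilon[OF True]])
    also have "\<dots> = D' \<Phi>"
      by (subst (2) N, rule derivation_sum[OF D', symmetric]) (rule c)
    finally show ?thesis .
  next
    case False
    then show ?thesis using derivation_outside[OF D] derivation_outside[OF D'] by simp
  qed
qed

lemma contr_tensor_add:
  assumes s: "vtensorial k s" and "\<Phi> \<in> ST" "\<Psi> \<in> ST"
  shows "contr_tensor k s (\<Phi> + \<Psi>) = contr_tensor k s \<Phi> + contr_tensor k s \<Psi>"
  by (rule at_fields_inject)
    (auto simp: at_fields_contr_tensor[OF s] at_fields_plus contr_add[of k s, symmetric] Upsilon_sum_plus assms
      at_fields_plus[abs_def] intro!: Upsilon_sum_plus contr_tensor_mem[OF s])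

lemma contr_tensor_scale:
  assumes s: "vtensorial k s" and \<Phi>: "\<Phi> \<in> ST"
  shows "contr_tensor k s (fscale (\<lambda>_. c) \<Phi>) = fscale (\<lambda>_. c) (contr_tensor k s \<Phi>)"
proof (rule at_fields_inject)
  note U = Upsilon_sum_fscale[OF smooth_const]
  show "contr_tensor k s (fscale (\<lambda>_. c) \<Phi>) \<in> ST" by (intro contr_tensor_mem[OF s] U \<Phi>)
  show "fscale (\<lambda>_. c) (contr_tensor k s \<Phi>) \<in> ST" by (intro contr_tensor_mem[OF s] U \<Phi>)
  fix Xs assume "fields Xs"
  then show "at_fields (contr_tensor k s (fscale (\<lambda>_. c) \<Phi>)) Xs = at_fields (fscale (\<lambda>_. c) (contr_tensor k s \<Phi>)) Xs"
    by (simp add: at_fields_contr_tensor[OF s] U \<Phi> at_fields_fscale[abs_def] contr_scale)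
qed

lemma contr_tensor_derivation:
  assumes s: "vtensorial k s"
  shows "derivation A (int k - 1) (\<lambda>\<Phi>. if \<Phi> \<in> ST then contr_tensor k s \<Phi> else 0)"
proof -
  have prod: "contr_tensor k s (\<Phi> \<odot> \<Psi>) = contr_tensor k s \<Phi> \<odot> \<Psi> + \<Phi> \<odot> contr_tensor k s \<Psi>"
    if U: "\<Phi> \<in> ST" "\<Psi> \<in> ST" for \<Phi> \<Psi>
  proof (rule at_fields_inject)
    note cU = contr_tensor_mem[OF s U(1)] contr_tensor_mem[OF s U(2)]
    show "contr_tensor k s (\<Phi> \<odot> \<Psi>) \<in> ST" by (intro contr_tensor_mem[OF s] Upsilon_sum_sym_prod U)
    show "contr_tensor k s \<Phi> \<odot> \<Psi> + \<Phi> \<odot> contr_tensor k s \<Psi> \<in> ST"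
      by (intro Upsilon_sum_plus Upsilon_sum_sym_prod U cU)
    fix Xs assume Xs: "fields Xs"
    have "at_fields (contr_tensor k s (\<Phi> \<odot> \<Psi>)) Xs = contr k s (shuffle (at_fields \<Phi>) (at_fields \<Psi>)) Xs"
      by (simp add: at_fields_contr_tensor[OF s Upsilon_sum_sym_prod[OF U] Xs] at_fields_sym_prod[OF U, abs_def])
    also have "\<dots> = shuffle (at_fields (contr_tensor k s \<Phi>)) (at_fields \<Psi>) Xs
        + shuffle (at_fields \<Phi>) (at_fields (contr_tensor k s \<Psi>)) Xs"
      unfolding contr_shuffle
      by (intro arg_cong2[where f = "(+)"] shuffle_cong) (use Xs U at_fields_contr_tensor[OF s] in auto)
    also have "\<dots> = at_fields (contr_tensor k s \<Phi> \<odot> \<Psi> + \<Phi> \<odot> contr_tensor k s \<Psi>) Xs"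
      by (simp only: at_fields_plus at_fields_sym_prod[OF cU(1) U(2)] at_fields_sym_prod[OF U(1) cU(2)])
    finally show "at_fields (contr_tensor k s (\<Phi> \<odot> \<Psi>)) Xs
        = at_fields (contr_tensor k s \<Phi> \<odot> \<Psi> + \<Phi> \<odot> contr_tensor k s \<Psi>) Xs" .
  qed
  have deg: "component m (contr_tensor k s \<phi>) = 0" if \<phi>: "\<phi> \<in> Upsilon A r" and m: "int m \<noteq> int r + (int k - 1)" for r m \<phi>
  proof (rule at_fields_inject[OF _ Upsilon_sum_zero])
    note U = Upsilon_subset[OF \<phi>]
    show "component m (contr_tensor k s \<phi>) \<in> ST"
      by (rule Upsilon_subset[OF component_Upsilon[OF contr_tensor_mem[OF s U]]])
    fix Xs assume Xs: "fields Xs"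
    have "contr k s (at_fields \<phi>) Xs = 0" if "length Xs = m"
      by (rule contr_degree[OF vtensorial_into_fields[OF s] Xs], rule at_fields_degree[OF \<phi>]) (use m that in auto)
    then have "at_fields (contr_tensor k s \<phi>) Xs = 0" if "length Xs = m"
      using that at_fields_contr_tensor[OF s U Xs] by simp
    then show "at_fields (component m (contr_tensor k s \<phi>)) Xs = at_fields 0 Xs"
      by (auto simp: at_fields_def component_def fun_eq_iff)
  qed
  show ?thesis
    unfolding derivation_def
    by (auto simp: contr_tensor_mem[OF s] contr_tensor_add[OF s] contr_tensor_scale[OF s] prod deg Upsilon_sum_plus
        Upsilon_sum_fscale smooth_const Upsilon_sum_sym_prod dest: Upsilon_subset)
qed

text \<open>The explicit operator \<open>contr_tensor k s\<close> is a derivation with the prescribed values on functions and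
  1-forms, and these determine a derivation.\<close>
lemma sym_contraction_eq:
  assumes s: "vtensorial k s" and \<sigma>: "\<And>Xs. fields Xs \<Longrightarrow> length Xs = k \<Longrightarrow> at_fields \<sigma> Xs = s Xs"
    and \<Phi>: "\<Phi> \<in> ST"
  shows "sym_contraction A k \<sigma> \<Phi> = contr_tensor k s \<Phi>"
proof -
  let ?D = "\<lambda>\<Phi>. if \<Phi> \<in> ST then contr_tensor k s \<Phi> else 0"
  let ?P = "\<lambda>D. derivation A (int k - 1) D \<and> (\<forall>f\<in>Upsilon A 0. D f = 0) \<and>
    (\<forall>\<alpha>\<in>Upsilon A 1. \<forall>Xs. length Xs = k \<and> fields Xs \<longrightarrow> at_fields (D \<alpha>) Xs = at_fields \<alpha> [at_fields \<sigma> Xs])"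
  have der: "derivation A (int k - 1) ?D" by (rule contr_tensor_derivation[OF s])
  have fun0: "?D f = 0" if f: "f \<in> Upsilon A 0" for f
  proof -
    have "contr_tensor k s f = 0"
    proof (rule at_fields_inject[OF contr_tensor_mem[OF s Upsilon_subset[OF f]] Upsilon_sum_zero])
      fix Xs assume Xs: "fields Xs"
      have "contr k s (at_fields f) Xs = 0"
        by (rule contr_degree[OF vtensorial_into_fields[OF s] Xs], rule at_fields_degree[OF f]) auto
      then show "at_fields (contr_tensor k s f) Xs = at_fields 0 Xs"
        by (simp add: at_fields_contr_tensor[OF s Upsilon_subset[OF f] Xs] at_fields_zero)
    qed
    then show ?thesis by simp
  qed
  have form1: "at_fields (?D \<alpha>) Xs = at_fields \<alpha> [at_fields \<sigma> Xs]"
    if \<alpha>: "\<alpha> \<in> Upsilon A 1" and Xs: "length Xs = k" "fields Xs" for \<alpha> Xs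
  proof -
    have "contr k s (at_fields \<alpha>) Xs = at_fields \<alpha> [s Xs]"
      by (rule contr_one_form[OF vtensorial_into_fields[OF s] Xs]) (rule at_fields_degree[OF \<alpha>])
    then show ?thesis
      using at_fields_contr_tensor[OF s Upsilon_subset[OF \<alpha>] Xs(2)] \<sigma>[OF Xs(2,1)] Upsilon_subset[OF \<alpha>] by simp
  qed
  have "(THE D. ?P D) = ?D"
  proof (rule the_equality)
    show "?P ?D" using der fun0 form1 by blast
    fix D assume D: "?P D"
    show "D = ?D"
    proof (rule derivation_eqI[of "int k - 1"])
      show "derivation A (int k - 1) D" using D by blast
      show "derivation A (int k - 1) ?D" by (rule der)
      show "D \<phi> = ?D \<phi>" if "\<phi> \<in> Upsilon A 0" for \<phi> using D fun0[OF that] that by metis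
      show "D \<phi> = ?D \<phi>" if \<phi>: "\<phi> \<in> Upsilon A 1" for \<phi>
      proof (rule at_fields_inject)
        show "D \<phi> \<in> ST" using D derivation_mem Upsilon_subset[OF \<phi>] by blast
        show "?D \<phi> \<in> ST" by (rule derivation_mem[OF der Upsilon_subset[OF \<phi>]])
        fix Xs assume Xs: "fields Xs"
        show "at_fields (D \<phi>) Xs = at_fields (?D \<phi>) Xs"
        proof (cases "length Xs = k")
          case True
          then have "at_fields (D \<phi>) Xs = at_fields \<phi> [at_fields \<sigma> Xs]" using D \<phi> Xs by blast
          then show ?thesis using form1[OF \<phi> True Xs] by simp
        next
          case False
          have vanish: "at_fields (\<Delta> \<phi>) Xs = 0" if \<Delta>: "derivation A (int k - 1) \<Delta>" for \<Delta>
          proof -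
            have "int (length Xs) \<noteq> int 1 + (int k - 1)" using False by auto
            then have "component (length Xs) (\<Delta> \<phi>) = 0" using \<Delta> \<phi> unfolding derivation_def by blast
            then have "component (length Xs) (\<Delta> \<phi>) p (map (\<lambda>X. X p) Xs) = 0" for p by simp
            then show ?thesis by (auto simp: component_apply at_fields_def fun_eq_iff)
          qed
          show ?thesis unfolding vanish[OF conjunct1[OF D]] vanish[OF der] ..
        qed
      qed
    qed
  qed
  then show ?thesis using \<Phi> unfolding sym_contraction_def by simp
qed

end


section \<open>The symmetric derivative\<close>

text \<open>For \<open>G Y = \<nabla>\<^sub>Y \<phi>\<close> this is the symmetric derivative of \<open>\<phi>\<close>: the sum over all ways to use one entry
  of the list as the direction and the others as arguments.  The recursion separates the terms in
  which the first entry is the direction.\<close>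
fun polar :: "('v \<Rightarrow> 'v list \<Rightarrow> 'c::comm_ring_1) \<Rightarrow> 'v list \<Rightarrow> 'c" where
  "polar G [] = 0"
| "polar G (Y # Ys) = G Y Ys + polar (\<lambda>Z Zs. G Z (Y # Zs)) Ys"

lemma polar_eq_sum:
  "polar G Ys = (\<Sum>j<length Ys. G (Ys ! j) (take j Ys @ drop (Suc j) Ys))"
  by (induction Ys arbitrary: G) (simp_all add: sum.lessThan_Suc_shift del: sum.lessThan_Suc)

lemma polar_add: "polar (\<lambda>Z Zs. G Z Zs + G' Z Zs) Ys = polar G Ys + polar G' Ys"
  by (induction Ys arbitrary: G G') (simp_all add: algebra_simps)

lemma polar_diff: "polar (\<lambda>Z Zs. G Z Zs - G' Z Zs) Ys = polar G Ys - polar G' Ys"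
  by (induction Ys arbitrary: G G') (simp_all add: algebra_simps)

lemma polar_scale: "polar (\<lambda>Z Zs. c * G Z Zs) Ys = c * polar G Ys"
  by (induction Ys arbitrary: G) (simp_all add: algebra_simps)

lemma polar_cong:
  assumes "\<And>Z Zs. Z \<in> set Ys \<Longrightarrow> set Zs \<subseteq> set Ys \<Longrightarrow> G Z Zs = G' Z Zs"
  shows "polar G Ys = polar G' Ys"
  using assms
proof (induction Ys arbitrary: G G')
  case (Cons Y Ys)
  have "polar (\<lambda>Z Zs. G Z (Y # Zs)) Ys = polar (\<lambda>Z Zs. G' Z (Y # Zs)) Ys"
    by (intro Cons.IH Cons.prems) auto
  moreover have "G Y Ys = G' Y Ys" by (rule Cons.prems) auto
  ultimately show ?case by (simp only: polar.simps)
qed simp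

lemma polar_degree:
  assumes "\<And>Z Zs. Z \<in> set Ys \<Longrightarrow> set Zs \<subseteq> set Ys \<Longrightarrow> Suc (length Zs) = length Ys \<Longrightarrow> G Z Zs = 0"
  shows "polar G Ys = 0"
  unfolding polar_eq_sum
proof (rule sum.neutral, rule ballI)
  fix j assume "j \<in> {..<length Ys}"
  then show "G (Ys ! j) (take j Ys @ drop (Suc j) Ys) = 0"
    using set_take_subset set_drop_subset by (intro assms) fastforce+
qed

lemma sum_list_update_eq_contr:
  "(\<Sum>i<length Ys. F (Ys[i := h (Ys ! i)])) = contr 1 (\<lambda>Zs. h (Zs ! 0)) F Ys"
  by (induction Ys arbitrary: F) (simp_all add: sum.lessThan_Suc_shift add.commute del: sum.lessThan_Suc)

context smooth_manifold
begin

lemma polar_tensorial: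
  assumes G: "\<And>X. X \<in> VF \<Longrightarrow> tensorial (G X)"
    and add: "\<And>X Y Zs. X \<in> VF \<Longrightarrow> Y \<in> VF \<Longrightarrow> fields Zs \<Longrightarrow> G (X + Y) Zs = G X Zs + G Y Zs"
    and scale: "\<And>f X Zs. f \<in> CF \<Longrightarrow> X \<in> VF \<Longrightarrow> fields Zs \<Longrightarrow> G (fscale f X) Zs = f * G X Zs"
    and bounded: "\<And>X Zs. X \<in> VF \<Longrightarrow> fields Zs \<Longrightarrow> N \<le> length Zs \<Longrightarrow> G X Zs = 0"
  shows "tensorial (polar G)"
proof (rule tensorialI)
  show "polar G Xs \<in> CF" if Xs: "fields Xs" for Xs
    unfolding polar_eq_sum
  proof (rule smooth_sum)
    fix j assume "j \<in> {..<length Xs}"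
    then have "Xs ! j \<in> VF" "fields (take j Xs @ drop (Suc j) Xs)"
      using Xs set_take_subset[of j Xs] set_drop_subset[of "Suc j" Xs] by auto
    then show "G (Xs ! j) (take j Xs @ drop (Suc j) Xs) \<in> CF"
      by (intro tensorial_smooth[OF G])
  qed
next
  fix X Y Zs assume h: "X \<in> VF" "Y \<in> VF" "fields Zs"
  have "polar (\<lambda>Z Ws. G Z ((X + Y) # Ws)) Zs = polar (\<lambda>Z Ws. G Z (X # Ws) + G Z (Y # Ws)) Zs"
    by (rule polar_cong, rule tensorial_add[OF G]) (use h in auto)
  then show "polar G ((X + Y) # Zs) = polar G (X # Zs) + polar G (Y # Zs)"
    using add[OF h] by (simp add: polar_add algebra_simps)
next
  fix f X Zs assume h: "f \<in> CF" "X \<in> VF" "fields Zs"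
  have "polar (\<lambda>Z Ws. G Z (fscale f X # Ws)) Zs = polar (\<lambda>Z Ws. f * G Z (X # Ws)) Zs"
    by (rule polar_cong, rule tensorial_fscale[OF G]) (use h in auto)
  then show "polar G (fscale f X # Zs) = f * polar G (X # Zs)"
    using scale[OF h] by (simp add: polar_scale algebra_simps)
next
  fix Xs X Y Ys assume h: "fields Xs" "X \<in> VF" "Y \<in> VF" "fields Ys"
  show "polar G (Xs @ X # Y # Ys) = polar G (Xs @ Y # X # Ys)"
    using h(1) G
  proof (induction Xs arbitrary: G)
    case Nil
    have "polar (\<lambda>Z Zs. G Z (X # Y # Zs)) Ys = polar (\<lambda>Z Zs. G Z (Y # X # Zs)) Ys"
      by (rule polar_cong, rule tensorial_swap[OF Nil(2)]) (use h in auto)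
    then have "polar G (X # Y # Ys) = polar G (Y # X # Ys)"
      by (simp add: algebra_simps)
    then show ?case by (simp only: append_Nil)
  next
    case (Cons Z Xs)
    have "polar (\<lambda>W Zs. G W (Z # Zs)) (Xs @ X # Y # Ys) = polar (\<lambda>W Zs. G W (Z # Zs)) (Xs @ Y # X # Ys)"
      by (rule Cons.IH) (use Cons.prems tensorial_Cons in auto)
    moreover have "G Z (Xs @ X # Y # Ys) = G Z (Xs @ Y # X # Ys)"
      by (rule tensorial_sym[of "G Z"]) (use Cons.prems h in auto)
    ultimately have "polar G (Z # Xs @ X # Y # Ys) = polar G (Z # Xs @ Y # X # Ys)"
      by (simp only: polar.simps)
    then show ?case by (simp only: append_Cons)
  qed
next
  have "polar G Xs = 0" if "fields Xs" "Suc N \<le> length Xs" for Xs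
    by (rule polar_degree, rule bounded) (use that in auto)
  then show "\<exists>N. \<forall>Xs. fields Xs \<and> N \<le> length Xs \<longrightarrow> polar G Xs = 0" by blast
qed

lemma tensor_of_cong:
  assumes "\<And>Xs. fields Xs \<Longrightarrow> F Xs = G Xs"
  shows "tensor_of A F = tensor_of A G"
  unfolding tensor_of_def using assms by (metis (no_types, lifting))

end

locale torsion_free_connection = smooth_manifold A
  for A :: "('a::{t2_space,second_countable_topology}, 'e::euclidean_space) atlas" +
  fixes nabla :: "'a connection"
  assumes conn: "is_connection A nabla" and torsion: "torsion_free A nabla"
begin

lemma nabla_mem: "X \<in> VF \<Longrightarrow> Y \<in> VF \<Longrightarrow> nabla X Y \<in> VF"
  using conn unfolding is_connection_def by (elim conjE) blast

lemma nabla_add_left: "X \<in> VF \<Longrightarrow> X' \<in> VF \<Longrightarrow> Y \<in> VF \<Longrightarrow>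
    nabla (X + X') Y = nabla X Y + nabla X' Y"
  using conn unfolding is_connection_def by (elim conjE) blast

lemma nabla_fscale_left: "f \<in> CF \<Longrightarrow> X \<in> VF \<Longrightarrow> Y \<in> VF \<Longrightarrow>
    nabla (fscale f X) Y = fscale f (nabla X Y)"
  using conn unfolding is_connection_def by (elim conjE) blast

lemma nabla_add_right: "X \<in> VF \<Longrightarrow> Y \<in> VF \<Longrightarrow> Y' \<in> VF \<Longrightarrow>
    nabla X (Y + Y') = nabla X Y + nabla X Y'"
  using conn unfolding is_connection_def by (elim conjE) blast

lemma nabla_fscale_right: "f \<in> CF \<Longrightarrow> X \<in> VF \<Longrightarrow> Y \<in> VF \<Longrightarrow>
    nabla X (fscale f Y) = fscale f (nabla X Y) + fscale (act X f) Y"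
  using conn unfolding is_connection_def act_def by (elim conjE) blast

lemma bracket_eq: "X \<in> VF \<Longrightarrow> Y \<in> VF \<Longrightarrow> lie_bracket X Y = nabla X Y - nabla Y X"
  using torsion unfolding torsion_free_def by simp

lemma nabla_diff_left: "X \<in> VF \<Longrightarrow> X' \<in> VF \<Longrightarrow> Y \<in> VF \<Longrightarrow>
    nabla (X - X') Y = nabla X Y - nabla X' Y"
  using nabla_add_left[of "X - X'" X' Y] by (simp add: vfields_diff)

lemma act_bracket:
  assumes "X \<in> VF" "Y \<in> VF"
  shows "act (nabla X Y) f - act (nabla Y X) f = act X (act Y f) - act Y (act X f)"
  unfolding act_diff_field[symmetric] bracket_eq[OF assms, symmetric]
  by (simp add: act_def lie_bracket_def fun_eq_iff)

definition cov :: "'a vfield \<Rightarrow> ('a vfield list \<Rightarrow> 'a \<Rightarrow> real) \<Rightarrow> 'a vfield list \<Rightarrow> 'a \<Rightarrow> real" where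
  "cov X F Ys = act X (F Ys) - contr 1 (\<lambda>Zs. nabla X (Zs ! 0)) F Ys"

lemma cov_Cons: "cov X F (Y # Ys) = cov X (\<lambda>Zs. F (Y # Zs)) Ys - F (nabla X Y # Ys)"
  by (simp add: cov_def)

lemma nabla_into_fields: "X \<in> VF \<Longrightarrow> into_fields 1 (\<lambda>Zs. nabla X (Zs ! 0))"
  unfolding into_fields_def using nabla_mem by (auto simp: length_Suc_conv)

lemma cov_cong:
  assumes "X \<in> VF" "\<And>Zs. fields Zs \<Longrightarrow> F Zs = G Zs" "fields Ys"
  shows "cov X F Ys = cov X G Ys"
  using contr_cong[OF nabla_into_fields[OF assms(1)] refl assms(2,3)] assms(2,3) by (simp add: cov_def)

lemma cov_add:
  assumes "X \<in> VF" "tensorial F" "tensorial G" "fields Ys"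
  shows "cov X (\<lambda>Zs. F Zs + G Zs) Ys = cov X F Ys + cov X G Ys"
  using act_add[OF assms(1) tensorial_smooth[OF assms(2,4)] tensorial_smooth[OF assms(3,4)]]
  by (simp add: cov_def contr_add algebra_simps)

lemma cov_mult:
  assumes "X \<in> VF" "tensorial F" "f \<in> CF" "fields Ys"
  shows "cov X (\<lambda>Zs. f * F Zs) Ys = f * cov X F Ys + act X f * F Ys"
  using act_mult[OF assms(1) assms(3) tensorial_smooth[OF assms(2,4)]]
  by (simp add: cov_def contr_scale algebra_simps)

lemma cov_degree:
  assumes "X \<in> VF" "fields Ys" "\<And>Zs. fields Zs \<Longrightarrow> length Zs = length Ys \<Longrightarrow> F Zs = 0"
  shows "cov X F Ys = 0"
proof -
  have "contr 1 (\<lambda>Zs. nabla X (Zs ! 0)) F Ys = 0"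
    by (rule contr_degree[OF nabla_into_fields[OF assms(1)] assms(2)]) (use assms(3) in auto)
  then show ?thesis using assms by (simp add: cov_def act_zero)
qed

lemma cov_tensorial:
  assumes X: "X \<in> VF" and F: "tensorial F"
  shows "tensorial (cov X F)"
proof (rule tensorialI)
  show "cov X F Xs \<in> CF" if "fields Xs" for Xs
    unfolding cov_def using that
    by (intro smooth_diff act_smooth X tensorial_smooth[OF F] contr_smooth[OF nabla_into_fields] F)
next
  fix Y Z Zs assume h: "Y \<in> VF" "Z \<in> VF" "fields Zs"
  have "cov X (\<lambda>Ws. F ((Y + Z) # Ws)) Zs = cov X (\<lambda>Ws. F (Y # Ws) + F (Z # Ws)) Zs"
    by (rule cov_cong[OF X _ h(3)]) (rule tensorial_add[OF F h(1,2)])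
  then show "cov X F ((Y + Z) # Zs) = cov X F (Y # Zs) + cov X F (Z # Zs)"
    using h by (simp add: cov_Cons cov_add[OF X tensorial_Cons[OF F] tensorial_Cons[OF F]]
        nabla_add_right X nabla_mem tensorial_add[OF F] algebra_simps)
next
  fix f Y Zs assume h: "f \<in> CF" "Y \<in> VF" "fields Zs"
  have "cov X (\<lambda>Ws. F (fscale f Y # Ws)) Zs = cov X (\<lambda>Ws. f * F (Y # Ws)) Zs"
    by (rule cov_cong[OF X _ h(3)]) (rule tensorial_fscale[OF F h(1,2)])
  \<comment> \<open>The two terms with the derivative of \<open>f\<close> cancel, which makes \<open>cov X F\<close> tensorial.\<close>
  then show "cov X F (fscale f Y # Zs) = f * cov X F (Y # Zs)"
    using h by (simp add: cov_Cons cov_mult[OF X tensorial_Cons[OF F]] nabla_fscale_right X nabla_mem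
        act_smooth vfields_fscale tensorial_add[OF F] tensorial_fscale[OF F] algebra_simps)
next
  fix Xs Y Z Ys assume h: "fields Xs" "Y \<in> VF" "Z \<in> VF" "fields Ys"
  show "cov X F (Xs @ Y # Z # Ys) = cov X F (Xs @ Z # Y # Ys)"
    using h(1) F
  proof (induction Xs arbitrary: F)
    case Nil
    have "cov X (\<lambda>Zs. F (Y # Z # Zs)) Ys = cov X (\<lambda>Zs. F (Z # Y # Zs)) Ys"
      by (rule cov_cong[OF X _ h(4)]) (rule tensorial_swap[OF Nil(2) h(2,3)])
    then have "cov X F (Y # Z # Ys) = cov X F (Z # Y # Ys)"
      using tensorial_swap[OF Nil(2) nabla_mem[OF X h(2)] h(3,4)] tensorial_swap[OF Nil(2) h(2) nabla_mem[OF X h(3)] h(4)]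
      by (simp add: cov_Cons algebra_simps)
    then show ?case by (simp only: append_Nil)
  next
    case (Cons W Xs)
    have "cov X (\<lambda>Zs. F (W # Zs)) (Xs @ Y # Z # Ys) = cov X (\<lambda>Zs. F (W # Zs)) (Xs @ Z # Y # Ys)"
      by (rule Cons.IH) (use Cons.prems tensorial_Cons in auto)
    moreover have "F (nabla X W # Xs @ Y # Z # Ys) = F (nabla X W # Xs @ Z # Y # Ys)"
      by (rule tensorial_sym[OF Cons.prems(2)]) (use Cons.prems h nabla_mem X in auto)
    ultimately have "cov X F (W # Xs @ Y # Z # Ys) = cov X F (W # Xs @ Z # Y # Ys)"
      by (simp only: cov_Cons)
    then show ?case by (simp only: append_Cons)
  qed
next
  obtain N where N: "\<And>Xs. fields Xs \<Longrightarrow> N \<le> length Xs \<Longrightarrow> F Xs = 0"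
    using tensorial_bounded[OF F] by blast
  have "cov X F Xs = 0" if "fields Xs" "N \<le> length Xs" for Xs
    by (rule cov_degree[OF X that(1)], rule N) (use that in auto)
  then show "\<exists>N. \<forall>Xs. fields Xs \<and> N \<le> length Xs \<longrightarrow> cov X F Xs = 0" by blast
qed

lemma cov_add_field:
  assumes "X \<in> VF" "Y \<in> VF" "tensorial F" "fields Zs"
  shows "cov (X + Y) F Zs = cov X F Zs + cov Y F Zs"
proof -
  have "contr 1 (\<lambda>Zs. nabla (X + Y) (Zs ! 0)) F Zs = contr 1 (\<lambda>Zs. nabla X (Zs ! 0) + nabla Y (Zs ! 0)) F Zs"
    by (rule contr_cong[OF nabla_into_fields[OF vfields_add[OF assms(1,2)]] _ refl assms(4)])
      (auto simp: length_Suc_conv nabla_add_left assms)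
  then show ?thesis
    unfolding cov_def contr_plus_op[OF nabla_into_fields[OF assms(1)] nabla_into_fields[OF assms(2)] assms(3,4)]
    by (simp add: act_add_field)
qed

lemma cov_fscale_field:
  assumes "f \<in> CF" "X \<in> VF" "tensorial F" "fields Zs"
  shows "cov (fscale f X) F Zs = f * cov X F Zs"
proof -
  have "contr 1 (\<lambda>Zs. nabla (fscale f X) (Zs ! 0)) F Zs = contr 1 (\<lambda>Zs. fscale f (nabla X (Zs ! 0))) F Zs"
    by (rule contr_cong[OF nabla_into_fields[OF vfields_fscale[OF assms(1,2)]] _ refl assms(4)])
      (auto simp: length_Suc_conv nabla_fscale_left assms)
  then show ?thesis
    unfolding cov_def contr_fscale_op[OF nabla_into_fields[OF assms(2)] assms(1,3,4)]
    by (simp add: act_fscale_field algebra_simps)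
qed

lemma cov_deriv_eq: "cov_deriv A nabla X \<Phi> = tensor_of A (cov X (at_fields \<Phi>))"
proof -
  have "(\<lambda>Ys p. X p (at_fields \<Phi> Ys) - (\<Sum>i<length Ys. at_fields \<Phi> (Ys[i := nabla X (Ys ! i)]) p))
      = cov X (at_fields \<Phi>)"
    using fun_cong[OF sum_list_update_eq_contr[of "at_fields \<Phi>" _ "nabla X"]]
    by (intro ext) (simp add: cov_def act_def sum_fun_apply)
  then show ?thesis unfolding cov_deriv_def by simp
qed

lemma sym_deriv:
  assumes \<Phi>: "\<Phi> \<in> ST"
  shows sym_deriv_mem: "sym_deriv A nabla \<Phi> \<in> ST"
    and at_fields_sym_deriv: "fields Xs \<Longrightarrow>
      at_fields (sym_deriv A nabla \<Phi>) Xs = polar (\<lambda>X. cov X (at_fields \<Phi>)) Xs"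
proof -
  let ?F = "at_fields \<Phi>"
  note F = at_fields_tensorial[OF \<Phi>]
  have "sym_deriv A nabla \<Phi> = tensor_of A (polar (\<lambda>X. cov X ?F))"
    unfolding sym_deriv_def
  proof (rule tensor_of_cong)
    fix Xs assume Xs: "fields Xs"
    have "at_fields (cov_deriv A nabla (Xs ! j) \<Phi>) (take j Xs @ drop (Suc j) Xs)
        = cov (Xs ! j) ?F (take j Xs @ drop (Suc j) Xs)" if "j < length Xs" for j
    proof -
      have "Xs ! j \<in> VF" "fields (take j Xs @ drop (Suc j) Xs)"
        using that Xs set_take_subset[of j Xs] set_drop_subset[of "Suc j" Xs] by auto
      then show ?thesis unfolding cov_deriv_eq by (intro at_fields_tensor_of cov_tensorial F)
    qed
    then show "(\<lambda>p. \<Sum>j<length Xs. at_fields (cov_deriv A nabla (Xs ! j) \<Phi>) (take j Xs @ drop (Suc j) Xs) p)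
        = polar (\<lambda>X. cov X ?F) Xs"
      unfolding polar_eq_sum by (intro ext) (simp add: sum_fun_apply)
  qed
  moreover have "tensorial (polar (\<lambda>X. cov X ?F))"
  proof -
    obtain N where N: "\<And>Xs. fields Xs \<Longrightarrow> N \<le> length Xs \<Longrightarrow> ?F Xs = 0"
      using tensorial_bounded[OF F] by blast
    show ?thesis
      by (rule polar_tensorial[where N = N])
        (auto intro!: cov_tensorial cov_add_field cov_fscale_field F cov_degree N)
  qed
  ultimately show "sym_deriv A nabla \<Phi> \<in> ST"
    "fields Xs \<Longrightarrow> at_fields (sym_deriv A nabla \<Phi>) Xs = polar (\<lambda>X. cov X ?F) Xs"
    using tensor_of by simp_all
qed

abbreviation D :: "'a tensor \<Rightarrow> 'a tensor" where "D \<equiv> sym_deriv A nabla"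
abbreviation L :: "'a vfield \<Rightarrow> 'a tensor \<Rightarrow> 'a tensor" where "L \<equiv> sym_lie A nabla"
abbreviation sbr :: "'a vfield \<Rightarrow> 'a vfield \<Rightarrow> 'a vfield" where "sbr \<equiv> sym_bracket nabla"

lemma sym_bracket_mem: "X \<in> VF \<Longrightarrow> Y \<in> VF \<Longrightarrow> sbr X Y \<in> VF"
  by (simp add: sym_bracket_def vfields_add nabla_mem)

lemma sym_deriv_add:
  assumes "\<Phi> \<in> ST" "\<Psi> \<in> ST"
  shows "D (\<Phi> + \<Psi>) = D \<Phi> + D \<Psi>"
proof (rule at_fields_inject)
  note U = assms Upsilon_sum_plus[OF assms]
  show "D (\<Phi> + \<Psi>) \<in> ST" "D \<Phi> + D \<Psi> \<in> ST"
    by (intro sym_deriv_mem Upsilon_sum_plus assms)+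
  fix Xs assume Xs: "fields Xs"
  have "polar (\<lambda>X. cov X (at_fields (\<Phi> + \<Psi>))) Xs = polar (\<lambda>X Zs. cov X (at_fields \<Phi>) Zs + cov X (at_fields \<Psi>) Zs) Xs"
  proof (rule polar_cong)
    fix Z Zs assume "Z \<in> set Xs" "set Zs \<subseteq> set Xs"
    then have "Z \<in> VF" "fields Zs" using Xs by auto
    then show "cov Z (at_fields (\<Phi> + \<Psi>)) Zs = cov Z (at_fields \<Phi>) Zs + cov Z (at_fields \<Psi>) Zs"
      unfolding at_fields_plus[abs_def] by (intro cov_add at_fields_tensorial assms)
  qed
  then show "at_fields (D (\<Phi> + \<Psi>)) Xs = at_fields (D \<Phi> + D \<Psi>) Xs"
    by (simp add: at_fields_sym_deriv[OF U(1) Xs] at_fields_sym_deriv[OF U(2) Xs] at_fields_sym_deriv[OF U(3) Xs]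
        at_fields_plus polar_add)
qed

lemma sym_deriv_diff:
  assumes "\<Phi> \<in> ST" "\<Psi> \<in> ST"
  shows "D (\<Phi> - \<Psi>) = D \<Phi> - D \<Psi>"
  using sym_deriv_add[OF Upsilon_sum_minus[OF assms] assms(2)] by (simp add: algebra_simps)

lemma contraction_add: "contraction X (\<Phi> + \<Psi>) = contraction X \<Phi> + contraction X \<Psi>"
  and contraction_diff: "contraction X (\<Phi> - \<Psi>) = contraction X \<Phi> - contraction X \<Psi>"
  for \<Phi> \<Psi> :: "'a tensor"
  by (auto simp: contraction_def fun_eq_iff)

lemma sym_lie_eq: "L X \<Phi> = contraction X (D \<Phi>) - D (contraction X \<Phi>)"
  by (simp add: sym_lie_def commutator_def)

lemma sym_lie_mem: "X \<in> VF \<Longrightarrow> \<Phi> \<in> ST \<Longrightarrow> L X \<Phi> \<in> ST"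
  unfolding sym_lie_eq by (intro Upsilon_sum_minus Upsilon_sum_contraction sym_deriv_mem)

lemma sym_lie_diff:
  assumes "X \<in> VF" "\<Phi> \<in> ST" "\<Psi> \<in> ST"
  shows "L X (\<Phi> - \<Psi>) = L X \<Phi> - L X \<Psi>"
  unfolding sym_lie_eq
  by (simp add: sym_deriv_diff contraction_diff Upsilon_sum_contraction assms algebra_simps)

lemma sym_lie_add:
  assumes "X \<in> VF" "\<Phi> \<in> ST" "\<Psi> \<in> ST"
  shows "L X (\<Phi> + \<Psi>) = L X \<Phi> + L X \<Psi>"
  unfolding sym_lie_eq
  by (simp add: sym_deriv_add contraction_add Upsilon_sum_contraction assms algebra_simps)

lemma contraction_sym_deriv: "contraction X (D \<Phi>) = D (contraction X \<Phi>) + L X \<Phi>"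
  by (simp add: sym_lie_eq)

lemma at_fields_sym_deriv_Nil: "\<Phi> \<in> ST \<Longrightarrow> at_fields (D \<Phi>) [] = 0"
  by (simp add: at_fields_sym_deriv)

text \<open>That is, \<open>L\<^sub>X = \<nabla>\<^sub>X - \<iota>\<^sub>A\<close> where \<open>A\<close> is the endomorphism \<open>Y \<mapsto> \<nabla>\<^sub>Y X\<close>: of the terms of \<open>\<nabla>\<^sup>s \<phi>\<close> with
  \<open>X\<close> as first entry, those with direction \<open>X\<close> give \<open>\<nabla>\<^sub>X \<phi>\<close>, and the others differ from the terms of
  \<open>\<nabla>\<^sup>s(\<iota>\<^sub>X \<phi>)\<close> by the derivative of \<open>X\<close>.\<close>
lemma at_fields_sym_lie:
  assumes X: "X \<in> VF" and \<Phi>: "\<Phi> \<in> ST" and Ys: "fields Ys"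
  shows "at_fields (L X \<Phi>) Ys =
    cov X (at_fields \<Phi>) Ys - polar (\<lambda>Z Zs. at_fields \<Phi> (nabla Z X # Zs)) Ys"
proof -
  let ?F = "at_fields \<Phi>"
  have "at_fields (D \<Phi>) (X # Ys) = cov X ?F Ys + polar (\<lambda>Z Zs. cov Z ?F (X # Zs)) Ys"
    using at_fields_sym_deriv[OF \<Phi>, of "X # Ys"] X Ys by simp
  also have "\<dots> = cov X ?F Ys + (polar (\<lambda>Z Zs. cov Z (\<lambda>Ws. ?F (X # Ws)) Zs) Ys
      - polar (\<lambda>Z Zs. ?F (nabla Z X # Zs)) Ys)"
    unfolding cov_Cons polar_diff ..
  finally show ?thesis
    unfolding sym_lie_eq at_fields_minus at_fields_contraction
      at_fields_sym_deriv[OF Upsilon_sum_contraction[OF X \<Phi>] Ys] at_fields_contraction[abs_def] by simp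
qed

lemma at_fields_sym_lie_Nil:
  assumes "X \<in> VF" "\<Phi> \<in> ST"
  shows "at_fields (L X \<Phi>) [] = act X (at_fields \<Phi> [])"
  using at_fields_sym_lie[OF assms, of "[]"] by (simp add: cov_def)

text \<open>In \<open>L\<^sub>X = \<nabla>\<^sub>X - \<iota>\<^sub>A\<close>, the commutator of \<open>\<iota>\<^sub>Z\<close> with \<open>\<nabla>\<^sub>X\<close> contributes \<open>\<nabla>\<^sub>X Z\<close> and the one with
  \<open>\<iota>\<^sub>A\<close> contributes \<open>\<nabla>\<^sub>Z X\<close>, which add up to the symmetric bracket.\<close>
lemma contraction_sym_lie:
  assumes X: "X \<in> VF" and Z: "Z \<in> VF" and \<Phi>: "\<Phi> \<in> ST"
  shows "contraction Z (L X \<Phi>) = L X (contraction Z \<Phi>) - contraction (sbr X Z) \<Phi>"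
proof (rule at_fields_inject)
  let ?F = "at_fields \<Phi>"
  note F = at_fields_tensorial[OF \<Phi>]
  show "contraction Z (L X \<Phi>) \<in> ST" "L X (contraction Z \<Phi>) - contraction (sbr X Z) \<Phi> \<in> ST"
    by (intro Upsilon_sum_minus Upsilon_sum_contraction sym_lie_mem sym_bracket_mem assms)+
  fix Ys assume Ys: "fields Ys"
  have p: "polar (\<lambda>W Ws. ?F (nabla W X # Z # Ws)) Ys = polar (\<lambda>W Ws. ?F (Z # nabla W X # Ws)) Ys"
    by (rule polar_cong, rule tensorial_swap[OF F]) (use X Z Ys nabla_mem in auto)
  have "at_fields (contraction Z (L X \<Phi>)) Ys = cov X ?F (Z # Ys) - polar (\<lambda>W Ws. ?F (nabla W X # Ws)) (Z # Ys)"
    unfolding at_fields_contraction by (rule at_fields_sym_lie[OF X \<Phi>]) (use Z Ys in auto)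
  also have "\<dots> = cov X (\<lambda>Ws. ?F (Z # Ws)) Ys - polar (\<lambda>W Ws. ?F (Z # nabla W X # Ws)) Ys
      - (?F (nabla X Z # Ys) + ?F (nabla Z X # Ys))"
    unfolding cov_Cons polar.simps p by (simp add: algebra_simps)
  also have "\<dots> = at_fields (L X (contraction Z \<Phi>) - contraction (sbr X Z) \<Phi>) Ys"
    unfolding at_fields_minus at_fields_contraction at_fields_sym_lie[OF X Upsilon_sum_contraction[OF Z \<Phi>] Ys]
      at_fields_contraction[abs_def] sym_bracket_def tensorial_add[OF F nabla_mem[OF X Z] nabla_mem[OF Z X] Ys] ..
  finally show "at_fields (contraction Z (L X \<Phi>)) Ys = at_fields (L X (contraction Z \<Phi>) - contraction (sbr X Z) \<Phi>) Ys" .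
qed

end


section \<open>The curvature terms\<close>

lemma symmetrize_two: "symmetrize B [y, z] = (B [y, z] + B [z, y]) / 2"
proof -
  have "{\<pi>. \<pi> permutes {..<length [y, z]}} = {id, Transposition.transpose 0 (Suc 0)}"
    using permutes_doubleton_iff[of _ 0 "Suc 0"] by (auto simp: numeral_2_eq_2 lessThan_Suc insert_commute)
  moreover have "permute_list (Transposition.transpose 0 (Suc 0)) [y, z] = [z, y]"
    by (simp add: permute_list_def)
  moreover have "id \<noteq> Transposition.transpose 0 (Suc 0)"
    by (metis id_apply transpose_apply_first zero_neq_one One_nat_def)
  ultimately show ?thesis by (simp add: symmetrize_def)
qed

context smooth_manifold
begin

lemma vtensorial_1I:
  assumes "\<And>Y. Y \<in> VF \<Longrightarrow> h Y \<in> VF"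
    and "\<And>Y Z. Y \<in> VF \<Longrightarrow> Z \<in> VF \<Longrightarrow> h (Y + Z) = h Y + h Z"
    and "\<And>f Y. f \<in> CF \<Longrightarrow> Y \<in> VF \<Longrightarrow> h (fscale f Y) = fscale f (h Y)"
  shows "vtensorial 1 (\<lambda>Ys. h (Ys ! 0))"
proof (rule vtensorialI)
  fix Xs Ys :: "'a vfield list" assume "length Xs = 1" "mset Ys = mset Xs"
  then have "Ys = Xs" by (auto simp: length_Suc_conv)
  then show "h (Ys ! 0) = h (Xs ! 0)" by simp
qed (use assms in \<open>auto simp: length_Suc_conv\<close>)

lemma vtensorial_2I:
  assumes s: "\<And>Y Z. Y \<in> VF \<Longrightarrow> Z \<in> VF \<Longrightarrow> s [Y, Z] = h Y Z + h Z Y"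
    and mem: "\<And>Y Z. Y \<in> VF \<Longrightarrow> Z \<in> VF \<Longrightarrow> h Y Z \<in> VF"
    and add: "\<And>Y Y' Z. Y \<in> VF \<Longrightarrow> Y' \<in> VF \<Longrightarrow> Z \<in> VF \<Longrightarrow>
      h (Y + Y') Z + h Z (Y + Y') = (h Y Z + h Z Y) + (h Y' Z + h Z Y')"
    and scale: "\<And>f Y Z. f \<in> CF \<Longrightarrow> Y \<in> VF \<Longrightarrow> Z \<in> VF \<Longrightarrow>
      h (fscale f Y) Z + h Z (fscale f Y) = fscale f (h Y Z + h Z Y)"
  shows "vtensorial 2 s"
proof (rule vtensorialI)
  fix Xs Ys :: "'a vfield list" assume F: "fields Xs" and Xs: "length Xs = 2" "mset Ys = mset Xs"
  then obtain X Y where X: "Xs = [X, Y]" by (auto simp: length_Suc_conv numeral_2_eq_2)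
  have "length Ys = 2" using Xs mset_eq_length by metis
  then obtain X' Y' where Y: "Ys = [X', Y']" by (auto simp: length_Suc_conv numeral_2_eq_2)
  have "{#X', Y'#} = {#X, Y#}" using Xs X Y by simp
  then have "X' = X \<and> Y' = Y \<or> X' = Y \<and> Y' = X" by (auto simp: add_eq_conv_ex)
  then show "s Ys = s Xs" using F unfolding X Y by (auto simp: s add.commute)
qed (auto simp: length_Suc_conv numeral_2_eq_2 s add scale vfields_add vfields_fscale intro!: vfields_add mem)

end

context torsion_free_connection
begin

lemma curvature_eq:
  assumes "X \<in> VF" "Y \<in> VF" "Z \<in> VF"
  shows "curvature nabla X Y Z =
    nabla X (nabla Y Z) - nabla Y (nabla X Z) - (nabla (nabla X Y) Z - nabla (nabla Y X) Z)"
  unfolding curvature_def bracket_eq[OF assms(1,2)] by (simp add: nabla_diff_left nabla_mem assms)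

lemma curvature_mem:
  "X \<in> VF \<Longrightarrow> Y \<in> VF \<Longrightarrow> Z \<in> VF \<Longrightarrow> curvature nabla X Y Z \<in> VF"
  by (simp add: curvature_eq vfields_diff nabla_mem)

lemma curvature_linear:
  assumes X: "X \<in> VF" and Y: "Y \<in> VF" and Z: "Z \<in> VF"
  shows curvature_add_2: "Y' \<in> VF \<Longrightarrow>
      curvature nabla X (Y + Y') Z = curvature nabla X Y Z + curvature nabla X Y' Z"
    and curvature_add_3: "Z' \<in> VF \<Longrightarrow>
      curvature nabla X Y (Z + Z') = curvature nabla X Y Z + curvature nabla X Y Z'"
    and curvature_fscale_2: "f \<in> CF \<Longrightarrow>
      curvature nabla X (fscale f Y) Z = fscale f (curvature nabla X Y Z)"
    and curvature_fscale_3: "f \<in> CF \<Longrightarrow>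
      curvature nabla X Y (fscale f Z) = fscale f (curvature nabla X Y Z)"
proof -
  note S = X Y Z nabla_mem vfields_add vfields_fscale act_smooth
    nabla_add_left nabla_add_right nabla_fscale_left nabla_fscale_right
  show "curvature nabla X (Y + Y') Z = curvature nabla X Y Z + curvature nabla X Y' Z" if "Y' \<in> VF"
    using that by (simp add: curvature_eq S algebra_simps)
  show "curvature nabla X Y (Z + Z') = curvature nabla X Y Z + curvature nabla X Y Z'" if "Z' \<in> VF"
    using that by (simp add: curvature_eq S algebra_simps)
  show "curvature nabla X (fscale f Y) Z = fscale f (curvature nabla X Y Z)" if "f \<in> CF"
    using that by (simp add: curvature_eq S) (simp add: fscale_def fun_eq_iff algebra_simps)
  show "curvature nabla X Y (fscale f Z) = fscale f (curvature nabla X Y Z)" if "f \<in> CF"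
  proof -
    have "act X (act Y f) p - act Y (act X f) p = act (nabla X Y) f p - act (nabla Y X) f p" for p
      using fun_cong[OF act_bracket[OF X Y, of f], of p] by simp
    then have "act X (act Y f) p + act (nabla Y X) f p = act Y (act X f) p + act (nabla X Y) f p" for p
      by (simp add: algebra_simps)
    from arg_cong[OF this, of "(*) c" for c]
    have "c * act X (act Y f) p + c * act (nabla Y X) f p = c * act Y (act X f) p + c * act (nabla X Y) f p" for c p
      by (simp add: distrib_left)
    then show ?thesis
      using that by (simp add: curvature_eq S) (simp add: fscale_def fun_eq_iff algebra_simps)
  qed
qed

text \<open>The second covariant derivative of \<open>X\<close>; it is tensorial in \<open>Y\<close> and \<open>Z\<close>, and the sum over both
  orders of \<open>Y\<close> and \<open>Z\<close> is the symmetric curvature operator.\<close>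
definition hess :: "'a vfield \<Rightarrow> 'a vfield \<Rightarrow> 'a vfield \<Rightarrow> 'a vfield" where
  "hess X Y Z = nabla Y (nabla Z X) - nabla (nabla Y Z) X"

lemma hess_linear:
  assumes X: "X \<in> VF" and Y: "Y \<in> VF" and Z: "Z \<in> VF"
  shows hess_mem: "hess X Y Z \<in> VF"
    and hess_add_2: "Y' \<in> VF \<Longrightarrow> hess X (Y + Y') Z = hess X Y Z + hess X Y' Z"
    and hess_add_3: "Z' \<in> VF \<Longrightarrow> hess X Y (Z + Z') = hess X Y Z + hess X Y Z'"
    and hess_fscale_2: "f \<in> CF \<Longrightarrow> hess X (fscale f Y) Z = fscale f (hess X Y Z)"
    and hess_fscale_3: "f \<in> CF \<Longrightarrow> hess X Y (fscale f Z) = fscale f (hess X Y Z)"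
proof -
  note S = X Y Z nabla_mem vfields_add vfields_fscale act_smooth
    nabla_add_left nabla_add_right nabla_fscale_left nabla_fscale_right
  show "hess X Y Z \<in> VF" by (simp add: hess_def S vfields_diff)
  show "hess X (Y + Y') Z = hess X Y Z + hess X Y' Z" if "Y' \<in> VF"
    using that by (simp add: hess_def S algebra_simps)
  show "hess X Y (Z + Z') = hess X Y Z + hess X Y Z'" if "Z' \<in> VF"
    using that by (simp add: hess_def S algebra_simps)
  show "hess X (fscale f Y) Z = fscale f (hess X Y Z)" if "f \<in> CF"
    using that by (simp add: hess_def S) (simp add: fscale_def fun_eq_iff algebra_simps)
  show "hess X Y (fscale f Z) = fscale f (hess X Y Z)" if "f \<in> CF"
    using that by (simp add: hess_def S) (simp add: fscale_def fun_eq_iff algebra_simps)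
qed

definition curv_term :: "'a vfield \<Rightarrow> 'a vfield list \<Rightarrow> 'a vfield" where
  "curv_term X Ys = (curvature nabla X (Ys ! 0) (Ys ! 1) + hess X (Ys ! 0) (Ys ! 1))
     + (curvature nabla X (Ys ! 1) (Ys ! 0) + hess X (Ys ! 1) (Ys ! 0))"

lemma curv_term_vtensorial:
  assumes X: "X \<in> VF"
  shows "vtensorial 2 (curv_term X)"
proof (rule vtensorial_2I[where h = "\<lambda>Y Z. curvature nabla X Y Z + hess X Y Z"])
  show "curv_term X [Y, Z] = (curvature nabla X Y Z + hess X Y Z) + (curvature nabla X Z Y + hess X Z Y)" for Y Z
    by (simp add: curv_term_def)
qed (use X in \<open>simp_all add: vfields_add curvature_mem hess_mem curvature_linear hess_linear,
    simp_all add: fscale_def fun_eq_iff algebra_simps\<close>)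

lemma nabla_endo_vtensorial: "X \<in> VF \<Longrightarrow> vtensorial 1 (\<lambda>Ys. nabla (Ys ! 0) X)"
  by (rule vtensorial_1I; rule nabla_mem nabla_add_left nabla_fscale_left; assumption)

lemma at_fields_nabla_endo:
  "X \<in> VF \<Longrightarrow> fields Ys \<Longrightarrow> length Ys = 1 \<Longrightarrow>
    at_fields (nabla_endo A nabla X) Ys = nabla (Ys ! 0) X"
  unfolding nabla_endo_def by (rule at_fields_vtensor_of[OF nabla_endo_vtensorial])

lemma at_fields_curvature_terms:
  assumes X: "X \<in> VF" and Ys: "fields Ys" "length Ys = 2"
  shows "at_fields (sym_curvature_contraction A nabla X + sym_curvature A nabla X) Ys = curv_term X Ys"
proof -
  let ?r = "\<lambda>Ys p f. 2 * symmetrize (\<lambda>Zs. curvature nabla X (Zs ! 0) (Zs ! 1) p f) Ys"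
  let ?h = "\<lambda>Ys. let Y = Ys ! 0; Z = Ys ! 1 in
       nabla Y (nabla Z X) + nabla Z (nabla Y X) - nabla (sym_bracket nabla Y Z) X"
  obtain Y Z where Y: "Ys = [Y, Z]" using Ys(2) by (auto simp: length_Suc_conv numeral_2_eq_2)
  have r: "?r [Y, Z] = curvature nabla X Y Z + curvature nabla X Z Y" for Y Z
    by (simp add: symmetrize_two fun_eq_iff)
  have vr: "vtensorial 2 ?r"
    by (rule vtensorial_2I[where h = "curvature nabla X", OF r])
      (use X in \<open>simp_all add: curvature_mem curvature_linear\<close>, simp_all add: fscale_def fun_eq_iff algebra_simps)
  have h: "?h [Y, Z] = hess X Y Z + hess X Z Y" if "Y \<in> VF" "Z \<in> VF" for Y Z
    using that X by (simp add: hess_def sym_bracket_def nabla_add_left nabla_mem)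
  have vh: "vtensorial 2 ?h"
    by (rule vtensorial_2I[where h = "hess X", OF h])
      (use X in \<open>simp_all add: hess_linear\<close>, simp_all add: fscale_def fun_eq_iff algebra_simps)
  have "at_fields (sym_curvature_contraction A nabla X) Ys = ?r Ys"
    unfolding sym_curvature_contraction_def by (rule at_fields_vtensor_of[OF vr Ys(2,1)])
  moreover have "at_fields (sym_curvature A nabla X) Ys = ?h Ys"
    unfolding sym_curvature_def by (rule at_fields_vtensor_of[OF vh Ys(2,1)])
  moreover have "at_fields (\<sigma> + \<tau>) Ys = at_fields \<sigma> Ys + at_fields \<tau> Ys" for \<sigma> \<tau> :: "'a vtensor"
    by (auto simp: at_fields_def)
  ultimately have "at_fields (sym_curvature_contraction A nabla X + sym_curvature A nabla X) Ys = ?r Ys + ?h Ys"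
    by simp
  also have "\<dots> = curv_term X Ys"
    using Ys(1) unfolding Y r by (subst h) (auto simp: curv_term_def)
  finally show ?thesis .
qed


section \<open>The commutator identity\<close>

lemma contraction_contr_tensor:
  assumes s: "vtensorial (Suc k) s" and Y: "Y \<in> VF" and \<Phi>: "\<Phi> \<in> ST"
  shows "contraction Y (contr_tensor (Suc k) s \<Phi>) =
    contr_tensor (Suc k) s (contraction Y \<Phi>) + contr_tensor k (\<lambda>Zs. s (Y # Zs)) \<Phi>"
proof (rule at_fields_inject)
  note sY = vtensorial_Cons[OF s Y] and iY = Upsilon_sum_contraction[OF Y \<Phi>]
  show "contraction Y (contr_tensor (Suc k) s \<Phi>) \<in> ST"
    by (intro Upsilon_sum_contraction Y contr_tensor_mem[OF s] \<Phi>)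
  show "contr_tensor (Suc k) s (contraction Y \<Phi>) + contr_tensor k (\<lambda>Zs. s (Y # Zs)) \<Phi> \<in> ST"
    by (intro Upsilon_sum_plus contr_tensor_mem[OF s] contr_tensor_mem[OF sY] iY \<Phi>)
  fix Ys assume Ys: "fields Ys"
  have "fields (Y # Ys)" using Y Ys by simp
  from at_fields_contr_tensor[OF s \<Phi> this]
  show "at_fields (contraction Y (contr_tensor (Suc k) s \<Phi>)) Ys =
      at_fields (contr_tensor (Suc k) s (contraction Y \<Phi>) + contr_tensor k (\<lambda>Zs. s (Y # Zs)) \<Phi>) Ys"
    unfolding at_fields_plus at_fields_contr_tensor[OF s iY Ys] at_fields_contr_tensor[OF sY \<Phi> Ys]
      at_fields_contraction at_fields_contraction[abs_def] by simp
qed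

lemma contr_tensor_0:
  assumes s: "vtensorial 0 s" and \<Phi>: "\<Phi> \<in> ST"
  shows "contr_tensor 0 s \<Phi> = contraction (s []) \<Phi>"
proof (rule at_fields_inject)
  have "s [] \<in> VF" using vtensorial_mem[OF s] by simp
  then show "contraction (s []) \<Phi> \<in> ST" by (rule Upsilon_sum_contraction[OF _ \<Phi>])
  show "contr_tensor 0 s \<Phi> \<in> ST" by (rule contr_tensor_mem[OF s \<Phi>])
qed (simp add: at_fields_contr_tensor[OF s \<Phi>] at_fields_contraction)

lemma contraction_contr_tensor_1:
  assumes s: "vtensorial 1 s" and Y: "Y \<in> VF" and \<Phi>: "\<Phi> \<in> ST"
  shows "contraction Y (contr_tensor 1 s \<Phi>) = contr_tensor 1 s (contraction Y \<Phi>) + contraction (s [Y]) \<Phi>"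
  using contraction_contr_tensor[of 0 s Y \<Phi>] contr_tensor_0[of "\<lambda>Zs. s (Y # Zs)" \<Phi>] vtensorial_Cons[of 0 s Y] assms
  by simp

lemma contr_tensor_diff:
  assumes s: "vtensorial k s" and "\<Phi> \<in> ST" "\<Psi> \<in> ST"
  shows "contr_tensor k s (\<Phi> - \<Psi>) = contr_tensor k s \<Phi> - contr_tensor k s \<Psi>"
  using contr_tensor_add[OF s Upsilon_sum_minus[OF assms(2,3)] assms(3)] by (simp add: algebra_simps)

lemma at_fields_contr_tensor_Nil:
  "vtensorial (Suc k) s \<Longrightarrow> \<Phi> \<in> ST \<Longrightarrow> at_fields (contr_tensor (Suc k) s \<Phi>) [] = 0"
  by (simp add: at_fields_contr_tensor)

text \<open>Here the curvature enters.  Vanishing torsion turns the difference of \<open>\<nabla>\<^sub>X \<nabla>\<^sub>Y Z\<close> and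
  \<open>\<nabla>\<^sub>Y \<nabla>\<^sub>X Z\<close>, together with \<open>\<nabla>\<close> along \<open>\<nabla>\<^sub>X Y - \<nabla>\<^sub>Y X\<close>, into \<open>R(X, Y) Z\<close>, and likewise with \<open>Y\<close>
  and \<open>Z\<close> exchanged; the remaining second derivatives of \<open>X\<close> form the symmetric curvature.\<close>
lemma curv_term_identity:
  assumes X: "X \<in> VF" and Y: "Y \<in> VF" and Z: "Z \<in> VF"
  shows "sbr X (sbr Y Z) - sbr Y (sbr X Z) - sbr (sbr X Y) Z =
    (nabla (sbr Y Z) X - sbr Y (nabla Z X) - sbr (nabla Y X) Z) +
    (nabla (sbr Y Z) X - sbr Y (nabla Z X) - sbr (nabla Y X) Z) + curv_term X [Y, Z]"
  unfolding curv_term_def sym_bracket_def hess_def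
  by (simp add: curvature_eq nabla_add_left nabla_add_right nabla_mem vfields_add X Y Z algebra_simps)

definition contr_nabla :: "'a vfield \<Rightarrow> 'a tensor \<Rightarrow> 'a tensor" where
  "contr_nabla X = contr_tensor 1 (\<lambda>Ys. nabla (Ys ! 0) X)"

definition contr_curv_partial :: "'a vfield \<Rightarrow> 'a vfield \<Rightarrow> 'a tensor \<Rightarrow> 'a tensor" where
  "contr_curv_partial X Y = contr_tensor 1 (\<lambda>Zs. curv_term X (Y # Zs))"

definition contr_curv :: "'a vfield \<Rightarrow> 'a tensor \<Rightarrow> 'a tensor" where
  "contr_curv X = contr_tensor 2 (curv_term X)"

lemma curv_term_Cons:
  "X \<in> VF \<Longrightarrow> Y \<in> VF \<Longrightarrow> vtensorial 1 (\<lambda>Zs. curv_term X (Y # Zs))"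
  using vtensorial_Cons[of 1 "curv_term X" Y] curv_term_vtensorial[of X] by (simp add: numeral_2_eq_2)

lemma curv_term_mem:
  "X \<in> VF \<Longrightarrow> Y \<in> VF \<Longrightarrow> Z \<in> VF \<Longrightarrow> curv_term X [Y, Z] \<in> VF"
  using vtensorial_mem[OF curv_term_vtensorial[of X], of "[Y, Z]"] by simp

lemma contr_nabla:
  assumes X: "X \<in> VF" and \<Phi>: "\<Phi> \<in> ST"
  shows contr_nabla_mem: "contr_nabla X \<Phi> \<in> ST"
    and contr_nabla_add: "\<Psi> \<in> ST \<Longrightarrow> contr_nabla X (\<Phi> + \<Psi>) = contr_nabla X \<Phi> + contr_nabla X \<Psi>"
    and contr_nabla_diff: "\<Psi> \<in> ST \<Longrightarrow> contr_nabla X (\<Phi> - \<Psi>) = contr_nabla X \<Phi> - contr_nabla X \<Psi>"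
    and contr_nabla_Nil: "at_fields (contr_nabla X \<Phi>) [] = 0"
    and contraction_contr_nabla: "Y \<in> VF \<Longrightarrow>
      contraction Y (contr_nabla X \<Phi>) = contr_nabla X (contraction Y \<Phi>) + contraction (nabla Y X) \<Phi>"
  using contr_tensor_mem[OF nabla_endo_vtensorial[OF X]] contr_tensor_add[OF nabla_endo_vtensorial[OF X]]
    contr_tensor_diff[OF nabla_endo_vtensorial[OF X]] contraction_contr_tensor_1[OF nabla_endo_vtensorial[OF X]]
    at_fields_contr_tensor_Nil[of 0] nabla_endo_vtensorial[OF X] \<Phi>
  unfolding contr_nabla_def by simp_all

lemma contr_curv_partial:
  assumes X: "X \<in> VF" and Y: "Y \<in> VF" and \<Phi>: "\<Phi> \<in> ST"
  shows contr_curv_partial_mem: "contr_curv_partial X Y \<Phi> \<in> ST"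
    and contr_curv_partial_Nil: "at_fields (contr_curv_partial X Y \<Phi>) [] = 0"
    and contraction_contr_curv_partial: "Z \<in> VF \<Longrightarrow> contraction Z (contr_curv_partial X Y \<Phi>) =
      contr_curv_partial X Y (contraction Z \<Phi>) + contraction (curv_term X [Y, Z]) \<Phi>"
  using contr_tensor_mem[OF curv_term_Cons[OF X Y]] contraction_contr_tensor_1[OF curv_term_Cons[OF X Y]]
    at_fields_contr_tensor_Nil[of 0] curv_term_Cons[OF X Y] \<Phi>
  unfolding contr_curv_partial_def by simp_all

lemma contr_curv:
  assumes X: "X \<in> VF" and \<Phi>: "\<Phi> \<in> ST"
  shows contr_curv_mem: "contr_curv X \<Phi> \<in> ST"
    and contr_curv_Nil: "at_fields (contr_curv X \<Phi>) [] = 0"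
    and contraction_contr_curv: "Y \<in> VF \<Longrightarrow>
      contraction Y (contr_curv X \<Phi>) = contr_curv X (contraction Y \<Phi>) + contr_curv_partial X Y \<Phi>"
  using contr_tensor_mem[OF curv_term_vtensorial[OF X]] contraction_contr_tensor[of 1 "curv_term X"]
    at_fields_contr_tensor_Nil[of 1] curv_term_vtensorial[OF X] \<Phi>
  unfolding contr_curv_def contr_curv_partial_def by (simp_all add: numeral_2_eq_2)

lemmas closed = Upsilon_sum_contraction sym_lie_mem sym_deriv_mem sym_bracket_mem nabla_mem
  Upsilon_sum_plus Upsilon_sum_minus contr_nabla_mem contr_curv_partial_mem contr_curv_mem

text \<open>The value of a tensor field on a list is obtained by successive contractions.  Hence an operator is
  determined by its degree 0 part and its commutators with the contractions.  This replaces
  computations with arguments \<open>X\<^sub>1, \<dots>, X\<^sub>r\<close> by computations with commutators.\<close>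
lemma operator_eqI:
  fixes P Q :: "'a tensor \<Rightarrow> 'a tensor"
  assumes P: "\<And>\<Phi>. \<Phi> \<in> ST \<Longrightarrow> P \<Phi> \<in> ST"
    and Q: "\<And>\<Phi>. \<Phi> \<in> ST \<Longrightarrow> Q \<Phi> \<in> ST"
    and base: "\<And>\<Phi>. \<Phi> \<in> ST \<Longrightarrow> at_fields (P \<Phi>) [] = at_fields (Q \<Phi>) []"
    and comm: "\<And>Z \<Phi>. Z \<in> VF \<Longrightarrow> \<Phi> \<in> ST \<Longrightarrow>
      contraction Z (P \<Phi>) - P (contraction Z \<Phi>) = contraction Z (Q \<Phi>) - Q (contraction Z \<Phi>)"
    and \<Phi>: "\<Phi> \<in> ST"
  shows "P \<Phi> = Q \<Phi>"
proof (rule at_fields_inject[OF P[OF \<Phi>] Q[OF \<Phi>]])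
  show "at_fields (P \<Phi>) Zs = at_fields (Q \<Phi>) Zs" if "fields Zs" for Zs
    using that \<Phi>
  proof (induction Zs arbitrary: \<Phi>)
    case Nil
    show ?case by (rule base[OF Nil.prems(2)])
  next
    case (Cons Z Zs)
    have Z: "Z \<in> VF" and Zs: "fields Zs" using Cons.prems by auto
    have "at_fields (P (contraction Z \<Phi>)) Zs = at_fields (Q (contraction Z \<Phi>)) Zs"
      by (rule Cons.IH[OF Zs Upsilon_sum_contraction[OF Z Cons.prems(2)]])
    moreover have "at_fields (contraction Z (P \<Phi>)) Zs - at_fields (P (contraction Z \<Phi>)) Zs =
        at_fields (contraction Z (Q \<Phi>)) Zs - at_fields (Q (contraction Z \<Phi>)) Zs"
      unfolding at_fields_minus[symmetric] comm[OF Z Cons.prems(2)] ..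
    ultimately have "at_fields (contraction Z (P \<Phi>)) Zs = at_fields (contraction Z (Q \<Phi>)) Zs"
      by simp
    then show ?case by (simp only: at_fields_contraction)
  qed
qed

lemma contraction_linear_field:
  assumes "X \<in> VF" "Y \<in> VF" "\<Phi> \<in> ST"
  shows contraction_add_field: "contraction (X + Y) \<Phi> = contraction X \<Phi> + contraction Y \<Phi>"
    and contraction_diff_field: "contraction (X - Y) \<Phi> = contraction X \<Phi> - contraction Y \<Phi>"
  using assms
  by (auto intro!: at_fields_inject Upsilon_sum_contraction Upsilon_sum_plus Upsilon_sum_minus vfields_add vfields_diff
      simp: at_fields_contraction at_fields_plus at_fields_minus tensorial_add[OF at_fields_tensorial]
        tensorial_diff[OF at_fields_tensorial])

text \<open>This is the commutator with \<open>\<iota>\<^sub>Y\<close> of the identity to be proved.  Its own commutator with \<open>\<iota>\<^sub>Z\<close> is an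
  identity between contractions with vector fields, namely \<open>curv_term_identity\<close>; in degree 0 it
  compares second derivatives of functions, where vanishing torsion is used once more.\<close>
lemma commutator_of_sym_lie:
  assumes X: "X \<in> VF" and Y: "Y \<in> VF" and \<Phi>: "\<Phi> \<in> ST"
  shows "L Y (L X \<Phi>) - L X (L Y \<Phi>) + L (sbr X Y) \<Phi> =
    (L (nabla Y X) \<Phi> + contr_nabla X (L Y \<Phi>) - L Y (contr_nabla X \<Phi>)) +
    (L (nabla Y X) \<Phi> + contr_nabla X (L Y \<Phi>) - L Y (contr_nabla X \<Phi>)) + contr_curv_partial X Y \<Phi>"
proof -
  define P where "P \<Phi> = L Y (L X \<Phi>) - L X (L Y \<Phi>) + L (sbr X Y) \<Phi>" for \<Phi>
  define Q where "Q \<Phi> = L (nabla Y X) \<Phi> + contr_nabla X (L Y \<Phi>) - L Y (contr_nabla X \<Phi>)" for \<Phi>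
  have "P \<Phi> = Q \<Phi> + Q \<Phi> + contr_curv_partial X Y \<Phi>"
  proof (rule operator_eqI[OF _ _ _ _ \<Phi>])
    fix \<Phi> assume \<Phi>: "\<Phi> \<in> ST"
    show "P \<Phi> \<in> ST" "Q \<Phi> + Q \<Phi> + contr_curv_partial X Y \<Phi> \<in> ST"
      unfolding P_def Q_def by (intro closed X Y \<Phi>)+
    let ?f = "at_fields \<Phi> []"
    have "act Y (act X ?f) - act X (act Y ?f) + act (sbr X Y) ?f = act (nabla Y X) ?f + act (nabla Y X) ?f"
      using act_bracket[OF X Y, of ?f] by (simp add: sym_bracket_def act_add_field algebra_simps)
    moreover have "at_fields (Q \<Phi>) [] = act (nabla Y X) ?f"
      using \<Phi> X Y by (simp add: Q_def at_fields_arith at_fields_sym_lie_Nil closed contr_nabla_Nil act_zero)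
    ultimately show "at_fields (P \<Phi>) [] = at_fields (Q \<Phi> + Q \<Phi> + contr_curv_partial X Y \<Phi>) []"
      using \<Phi> X Y unfolding at_fields_plus
      by (simp add: P_def at_fields_arith at_fields_sym_lie_Nil closed contr_curv_partial_Nil)
    fix Z assume Z: "Z \<in> VF"
    have P: "contraction Z (P \<Phi>) - P (contraction Z \<Phi>) =
        contraction (sbr X (sbr Y Z) - sbr Y (sbr X Z) - sbr (sbr X Y) Z) \<Phi>"
      using \<Phi> X Y Z by (simp add: P_def contraction_add contraction_diff contraction_sym_lie sym_lie_diff
          contraction_diff_field vfields_diff closed)
    have Q: "contraction Z (Q \<Phi>) - Q (contraction Z \<Phi>) =
        contraction (nabla (sbr Y Z) X - sbr Y (nabla Z X) - sbr (nabla Y X) Z) \<Phi>"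
      using \<Phi> X Y Z by (simp add: Q_def contraction_add contraction_diff contraction_sym_lie sym_lie_diff sym_lie_add
          contraction_contr_nabla contr_nabla_diff contraction_diff_field vfields_diff closed)
    have "contraction Z (P \<Phi>) - P (contraction Z \<Phi>) =
        (contraction Z (Q \<Phi>) - Q (contraction Z \<Phi>)) + (contraction Z (Q \<Phi>) - Q (contraction Z \<Phi>)) +
        contraction (curv_term X [Y, Z]) \<Phi>"
      unfolding P Q curv_term_identity[OF X Y Z]
      using \<Phi> X Y Z curv_term_mem[OF X Y Z]
      by (simp only: contraction_add_field vfields_add vfields_diff closed)
    then show "contraction Z (P \<Phi>) - P (contraction Z \<Phi>) =
        contraction Z (Q \<Phi> + Q \<Phi> + contr_curv_partial X Y \<Phi>) -
        (Q (contraction Z \<Phi>) + Q (contraction Z \<Phi>) + contr_curv_partial X Y (contraction Z \<Phi>))"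
      unfolding contraction_add contraction_contr_curv_partial[OF X Y \<Phi> Z] by (simp add: algebra_simps)
  qed
  then show ?thesis by (simp only: P_def Q_def)
qed

lemma commutator_sym_deriv_sym_lie:
  assumes X: "X \<in> VF" and \<Phi>: "\<Phi> \<in> ST"
  shows "D (L X \<Phi>) - L X (D \<Phi>) =
    (contr_nabla X (D \<Phi>) - D (contr_nabla X \<Phi>)) + (contr_nabla X (D \<Phi>) - D (contr_nabla X \<Phi>)) + contr_curv X \<Phi>"
proof -
  define P where "P \<Phi> = D (L X \<Phi>) - L X (D \<Phi>)" for \<Phi>
  define Q where "Q \<Phi> = contr_nabla X (D \<Phi>) - D (contr_nabla X \<Phi>)" for \<Phi>
  have "P \<Phi> = Q \<Phi> + Q \<Phi> + contr_curv X \<Phi>"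
  proof (rule operator_eqI[OF _ _ _ _ \<Phi>])
    fix \<Phi> assume \<Phi>: "\<Phi> \<in> ST"
    show "P \<Phi> \<in> ST" "Q \<Phi> + Q \<Phi> + contr_curv X \<Phi> \<in> ST"
      unfolding P_def Q_def by (intro closed X \<Phi>)+
    show "at_fields (P \<Phi>) [] = at_fields (Q \<Phi> + Q \<Phi> + contr_curv X \<Phi>) []"
      using \<Phi> X unfolding at_fields_plus
      by (simp add: P_def Q_def at_fields_arith at_fields_sym_lie_Nil at_fields_sym_deriv_Nil closed
          contr_nabla_Nil contr_curv_Nil act_zero)
    fix Y assume Y: "Y \<in> VF"
    have P: "contraction Y (P \<Phi>) - P (contraction Y \<Phi>) = L Y (L X \<Phi>) - L X (L Y \<Phi>) + L (sbr X Y) \<Phi>"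
      using \<Phi> X Y by (simp add: P_def contraction_diff contraction_sym_lie contraction_sym_deriv sym_lie_add
          sym_deriv_diff closed)
    have Q: "contraction Y (Q \<Phi>) - Q (contraction Y \<Phi>) =
        L (nabla Y X) \<Phi> + contr_nabla X (L Y \<Phi>) - L Y (contr_nabla X \<Phi>)"
      using \<Phi> X Y by (simp add: Q_def contraction_diff contraction_sym_deriv sym_deriv_add
          contraction_contr_nabla contr_nabla_add closed)
    have "contraction Y (P \<Phi>) - P (contraction Y \<Phi>) =
        (contraction Y (Q \<Phi>) - Q (contraction Y \<Phi>)) + (contraction Y (Q \<Phi>) - Q (contraction Y \<Phi>)) +
        contr_curv_partial X Y \<Phi>"
      unfolding P Q by (rule commutator_of_sym_lie[OF X Y \<Phi>])
    then show "contraction Y (P \<Phi>) - P (contraction Y \<Phi>) =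
        contraction Y (Q \<Phi> + Q \<Phi> + contr_curv X \<Phi>) -
        (Q (contraction Y \<Phi>) + Q (contraction Y \<Phi>) + contr_curv X (contraction Y \<Phi>))"
      unfolding contraction_add contraction_contr_curv[OF X \<Phi> Y] by (simp add: algebra_simps)
  qed
  then show ?thesis by (simp only: P_def Q_def)
qed

end

theorem proposition3p7:
  fixes A :: "('a::{t2_space,second_countable_topology}, 'e::euclidean_space) atlas"
    and nabla :: "'a connection" and X :: "'a vfield"
  assumes "smooth_atlas A"
    and "is_connection A nabla" and "torsion_free A nabla"
    and "X \<in> vfields A"
  shows "\<forall>\<Phi>\<in>Upsilon_sum A.
    commutator (sym_deriv A nabla) (sym_lie A nabla X) \<Phi> =
      fscale (\<lambda>_. 2) (sym_deriv_along A nabla (nabla_endo A nabla X) \<Phi>) +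
      sym_contraction A 2 (sym_curvature_contraction A nabla X + sym_curvature A nabla X) \<Phi>"
proof
  interpret torsion_free_connection A nabla
    using assms by (intro torsion_free_connection.intro smooth_manifold.intro torsion_free_connection_axioms.intro)
  note X = assms(4)
  fix \<Phi> assume \<Phi>: "\<Phi> \<in> Upsilon_sum A"
  have endo: "sym_contraction A 1 (nabla_endo A nabla X) \<Psi> = contr_nabla X \<Psi>"
    if "\<Psi> \<in> Upsilon_sum A" for \<Psi>
    unfolding contr_nabla_def by (rule sym_contraction_eq[OF nabla_endo_vtensorial[OF X] at_fields_nabla_endo[OF X] that])
  have curv: "sym_contraction A 2 (sym_curvature_contraction A nabla X + sym_curvature A nabla X) \<Phi> =
      contr_curv X \<Phi>"
    unfolding contr_curv_def by (rule sym_contraction_eq[OF curv_term_vtensorial[OF X] at_fields_curvature_terms[OF X] \<Phi>])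
  have "fscale (\<lambda>_. 2) T = T + T" for T :: "'a tensor"
    by (simp add: fscale_def fun_eq_iff)
  then show "commutator (sym_deriv A nabla) (sym_lie A nabla X) \<Phi> =
      fscale (\<lambda>_. 2) (sym_deriv_along A nabla (nabla_endo A nabla X) \<Phi>) +
      sym_contraction A 2 (sym_curvature_contraction A nabla X + sym_curvature A nabla X) \<Phi>"
    unfolding curv sym_deriv_along_def commutator_def endo[OF \<Phi>] endo[OF sym_deriv_mem[OF \<Phi>]]
    using commutator_sym_deriv_sym_lie[OF X \<Phi>] by simp
qed

end
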